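(* Let $P\equiv(P,G,B,\pi)$ and $Q\equiv(Q,H,B,\pi')$ be smooth (Banach) principal bundles over the same base $B$, trivialized over a common open cover $\{U_\alpha\}_{\alpha\in I}$ of $B$, with natural local sections $\{s_\alpha\}$, $\{t_\alpha\}$ and transition functions $\{g_{\alpha\beta}\}$, $\{h_{\alpha\beta}\}$, respectively. Let $\omega$ and $\theta$ be connections on $P$ and $Q$, with local connection forms $\omega_\alpha=s_\alpha^*\omega$ and $\theta_\alpha=t_\alpha^*\theta$, and let $\varphi\colon G\to H$ be a given morphism of (Banach–)Lie groups. Then there exists a principal bundle morphism of the form $(f,\varphi,\mathrm{id}_B)$ of $P$ into $Q$ such that $\omega$ and $\theta$ are $(f,\varphi,\mathrm{id}_B)$-related if and only if there exists a family of smooth maps $\{h_\alpha\colon U_\alpha\to H\mid\alpha\in I\}$ such that $$\overline{\varphi}\,\omega_\alpha=\mathrm{Ad}(h_\alpha^{-1}).\theta_\alpha+h_\alpha^{-1}dh_\alpha\qquad\text{for all }\alpha\in I,$$ and $$h_{\alpha\beta}=h_\alpha\cdot(\varphi\circ g_{\alpha\beta})\cdot h_\beta^{-1}\quad\text{on }U_{\alpha\beta}=U_\alpha\cap U_\beta,\qquad\text{for all }\alpha,\beta\in I.$$ Here the morphism and the maps correspond to each other through $f\circ s_\alpha=t_\alpha\cdot h_\alpha$ for all $\alpha\in I$: given such an $f$, the maps $h_\alpha$ defined by this equality satisfy the two conditions; and given $\{h_\alpha\}$ satisfying the two conditions, there is such an $f$ satisfying this equality.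
   Context: All manifolds and bundles are modelled on Banach spaces and are smooth ($C^\infty$); Lie groups are Banach–Lie groups. In a principal bundle $(P,G,B,\pi)$ the structure group $G$ acts on the total space $P$ on the right; $R_g\colon P\to P$, $R_g(p)=pg$. $\mathfrak{g}=T_eG$ and $\mathfrak{h}=T_eH$ are the Lie algebras of $G$ and $H$. A principal bundle morphism $(f,\varphi,\mathrm{id}_B)\colon (P,G,B,\pi)\to(Q,H,B,\pi')$ consists of a smooth map $f\colon P\to Q$ and a morphism of (Banach–)Lie groups $\varphi\colon G\to H$ with $\pi'\circ f=\pi$ and $f(pg)=f(p)\varphi(g)$ for all $p\in P$, $g\in G$. $\overline{\varphi}=T_e\varphi\colon\mathfrak{g}\to\mathfrak{h}$ is the induced Lie algebra morphism. A connection on $P$ is (equivalently) given by a connection form: a smooth $\mathfrak{g}$-valued 1-form $\omega$ on $P$ with $\omega(X^* )=X$ for all $X\in\mathfrak{g}$, where $X^*$ is the fundamental vector field, $X^*_p=T_e(g\mapsto pg)(X)$, and $R_g^*\omega=\mathrm{Ad}(g^{-1}).\omega$ for all $g\in G$. Connections $\omega$ on $P$ and $\theta$ on $Q$ are $(f,\varphi,\mathrm{id}_B)$-related if $f^*\theta=\overline{\varphi}\omega$, i.e. $\theta_{f(p)}(T_pf(u))=\overline{\varphi}(\omega_p(u))$ for all $p\in P$, $u\in T_pP$. Given $G$-equivariant local trivializations $\Phi_\alpha\colon\pi^{-1}(U_\alpha)\to U_\alpha\times G$ of $P$, the natural local sections are $s_\alpha(x)=\Phi_\alpha^{-1}(x,e)$,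 and the transition functions $g_{\alpha\beta}\colon U_\alpha\cap U_\beta\to G$ are the smooth maps with $s_\beta=s_\alpha\cdot g_{\alpha\beta}$; similarly $t_\alpha$ and $h_{\alpha\beta}$, with $t_\beta=t_\alpha\cdot h_{\alpha\beta}$, for $Q$. The local connection forms are $\omega_\alpha=s_\alpha^*\omega$, a $\mathfrak{g}$-valued 1-form on $U_\alpha$. For a smooth map $h\colon U\to H$ ($U\subseteq B$ open), $h^{-1}dh$ is the left Maurer–Cartan (logarithmic) differential, the $\mathfrak{h}$-valued 1-form on $U$ given by $(h^{-1}dh)_x(v)=(T_{h(x)}\lambda_{h(x)^{-1}}\circ T_xh)(v)$, where $\lambda_a$ is left translation by $a\in H$. $\mathrm{Ad}(h^{-1}).\theta$ denotes the form $x\mapsto \mathrm{Ad}(h(x)^{-1})\circ\theta_x$. *)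

theory Defs
  imports "HOL-Analysis.Analysis" "HOL-Algebra.Group"
begin

section \<open>Smooth maps between open subsets of normed spaces\<close>

text \<open>
  A continuous \<open>k\<close>-linear map is represented by its values on lists of length \<open>k\<close>; a function on
  lists of all lengths therefore packages one such map for every \<open>k\<close>.
\<close>

definition bounded_multilinear ::
    "nat \<Rightarrow> ('a::real_normed_vector list \<Rightarrow> 'b::real_normed_vector) \<Rightarrow> bool" where
  "bounded_multilinear k T \<longleftrightarrow>
     (\<forall>us vs. length us + length vs + 1 = k \<longrightarrow> linear (\<lambda>v. T (us @ v # vs))) \<and>
     (\<exists>C. \<forall>vs. length vs = k \<longrightarrow> norm (T vs) \<le> C * prod_list (map norm vs))"

text \<open>
  \<open>D x [v\<^sub>1, \<dots>, v\<^sub>k]\<close> is the \<open>k\<close>-th Frechet derivative of \<open>f\<close> at \<open>x\<close> applied to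
  \<open>v\<^sub>1, \<dots>, v\<^sub>k\<close>: it starts with \<open>f\<close> at \<open>k = 0\<close>, and the last clause says that \<open>y \<mapsto> D\<^sup>kf(y)\<close> is
  Frechet differentiable at \<open>x\<close> in the operator norm of continuous \<open>k\<close>-linear maps, its derivative
  being \<open>v \<mapsto> D\<^sup>k\<^sup>+\<^sup>1f(x)(v, \<dots>)\<close>.
\<close>

definition smooth_on ::
    "'a::real_normed_vector set \<Rightarrow> ('a \<Rightarrow> 'b::real_normed_vector) \<Rightarrow> bool" where
  "smooth_on S f \<longleftrightarrow> open S \<and>
     (\<exists>D :: 'a \<Rightarrow> 'a list \<Rightarrow> 'b.
        (\<forall>x\<in>S. D x [] = f x) \<and>
        (\<forall>x\<in>S. \<forall>k. bounded_multilinear k (D x)) \<and>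
        (\<forall>x\<in>S. \<forall>k. \<forall>\<epsilon>>0. \<exists>\<delta>>0. \<forall>y\<in>S. norm (y - x) < \<delta> \<longrightarrow>
           (\<forall>vs. length vs = k \<longrightarrow>
              norm (D y vs - D x vs - D x ((y - x) # vs))
                \<le> \<epsilon> * norm (y - x) * prod_list (map norm vs))))"


section \<open>Banach manifolds\<close>

text \<open>
  A manifold is given by an atlas; its points are those covered by the charts, and its topology is
  the one for which the charts are homeomorphisms onto open sets.  Neither a separation nor a
  countability axiom is imposed.
\<close>

type_synonym ('m, 'e) chart = "'m set \<times> ('m \<Rightarrow> 'e)"
type_synonym ('m, 'e) atlas = "('m, 'e) chart set"

definition pts :: "('m, 'e) atlas \<Rightarrow> 'm set" where
  "pts A = (\<Union>(U, \<phi>)\<in>A. U)"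

definition manifold :: "('m, 'e::banach) atlas \<Rightarrow> bool" where
  "manifold A \<longleftrightarrow>
     (\<forall>(U, \<phi>)\<in>A. inj_on \<phi> U \<and> open (\<phi> ` U)) \<and>
     (\<forall>(U, \<phi>)\<in>A. \<forall>(V, \<psi>)\<in>A.
        open (\<phi> ` (U \<inter> V)) \<and> smooth_on (\<phi> ` (U \<inter> V)) (\<psi> \<circ> inv_into U \<phi>))"

definition open_in :: "('m, 'e::banach) atlas \<Rightarrow> 'm set \<Rightarrow> bool" where
  "open_in A W \<longleftrightarrow> W \<subseteq> pts A \<and> (\<forall>(U, \<phi>)\<in>A. open (\<phi> ` (U \<inter> W)))"

text \<open>
  Smoothness of a map defined on an open subset \<open>W\<close>.  Openness of the sets
  \<open>\<phi> ` (U \<inter> W \<inter> f -` V)\<close> is part of \<^const>\<open>smooth_on\<close> and says that \<open>f\<close> is continuous.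
\<close>

definition smooth_map ::
    "('m, 'e::banach) atlas \<Rightarrow> 'm set \<Rightarrow> ('n, 'f::banach) atlas \<Rightarrow> ('m \<Rightarrow> 'n) \<Rightarrow> bool" where
  "smooth_map A W B f \<longleftrightarrow> open_in A W \<and> f ` W \<subseteq> pts B \<and>
     (\<forall>(U, \<phi>)\<in>A. \<forall>(V, \<psi>)\<in>B.
        smooth_on (\<phi> ` (U \<inter> W \<inter> f -` V)) (\<psi> \<circ> f \<circ> inv_into U \<phi>))"

definition diffeo ::
    "('m, 'e::banach) atlas \<Rightarrow> 'm set \<Rightarrow> ('n, 'f::banach) atlas \<Rightarrow> 'n set \<Rightarrow> ('m \<Rightarrow> 'n) \<Rightarrow> bool" where
  "diffeo A W B W' f \<longleftrightarrow>
     bij_betw f W W' \<and> smooth_map A W B f \<and> smooth_map B W' A (inv_into W f)"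

definition prod_atlas ::
    "('m, 'e) atlas \<Rightarrow> ('n, 'f) atlas \<Rightarrow> ('m \<times> 'n, 'e \<times> 'f) atlas" where
  "prod_atlas A B = {(U \<times> V, map_prod \<phi> \<psi>) | U \<phi> V \<psi>. (U, \<phi>) \<in> A \<and> (V, \<psi>) \<in> B}"


section \<open>Tangent maps and differential forms\<close>

text \<open>
  A preferred chart is chosen around every point \<open>p\<close>, and \<open>T\<^sub>pM\<close> is identified with the model
  space \<open>'e\<close> through it.  The tangent map of \<open>f\<close> at \<open>p\<close> is then the derivative of the local
  representative of \<open>f\<close> in the preferred charts around \<open>p\<close> and \<open>f p\<close>.
\<close>

definition chart_at :: "('m, 'e) atlas \<Rightarrow> 'm \<Rightarrow> ('m, 'e) chart" where
  "chart_at A p = (SOME c. c \<in> A \<and> p \<in> fst c)"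

definition tangent_map ::
    "('m, 'e::banach) atlas \<Rightarrow> ('n, 'f::banach) atlas \<Rightarrow> ('m \<Rightarrow> 'n) \<Rightarrow> 'm \<Rightarrow> 'e \<Rightarrow> 'f" where
  "tangent_map A B f p =
     (let (U, \<phi>) = chart_at A p; (V, \<psi>) = chart_at B (f p)
      in frechet_derivative (\<psi> \<circ> f \<circ> inv_into U \<phi>) (at (\<phi> p)))"

text \<open>
  A vector-valued 1-form assigns to each point \<open>p\<close> a continuous linear map on \<open>T\<^sub>pM = 'e\<close>.  Its
  representative in a chart \<open>(U, \<phi>)\<close> is the map \<open>x \<mapsto> \<omega>\<^sub>p \<circ> T\<^sub>x(\<phi>\<^sup>-\<^sup>1)\<close>, \<open>p = \<phi>\<^sup>-\<^sup>1(x)\<close>; since \<open>T\<^sub>pM\<close> is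
  read off in the preferred chart at \<open>p\<close>, \<open>T\<^sub>x(\<phi>\<^sup>-\<^sup>1)\<close> is the derivative of the transition from
  \<open>\<phi>\<close> to that chart.
\<close>

type_synonym ('m, 'e, 'v) form = "'m \<Rightarrow> 'e \<Rightarrow>\<^sub>L 'v"

definition form_rep ::
    "('m, 'e::banach) atlas \<Rightarrow> ('m, 'e, 'v::banach) form \<Rightarrow> ('m, 'e) chart \<Rightarrow> 'e \<Rightarrow> 'e \<Rightarrow>\<^sub>L 'v" where
  "form_rep A \<omega> = (\<lambda>(U, \<phi>) x.
     let p = inv_into U \<phi> x
     in \<omega> p o\<^sub>L Blinfun (frechet_derivative (snd (chart_at A p) \<circ> inv_into U \<phi>) (at x)))"

definition smooth_form ::
    "('m, 'e::banach) atlas \<Rightarrow> ('m, 'e, 'v::banach) form \<Rightarrow> bool" where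
  "smooth_form A \<omega> \<longleftrightarrow> (\<forall>(U, \<phi>)\<in>A. smooth_on (\<phi> ` U) (form_rep A \<omega> (U, \<phi>)))"

definition pullback ::
    "('m, 'e::banach) atlas \<Rightarrow> ('n, 'f::banach) atlas \<Rightarrow> ('m \<Rightarrow> 'n) \<Rightarrow> ('n, 'f, 'v::banach) form
      \<Rightarrow> 'm \<Rightarrow> 'e \<Rightarrow> 'v" where
  "pullback A B f \<omega> p v = blinfun_apply (\<omega> (f p)) (tangent_map A B f p v)"


section \<open>Banach--Lie groups\<close>

record ('g, 'e) lie_grp = "'g monoid" +
  charts :: "('g, 'e) atlas"

definition lie_group :: "('g, 'e::banach) lie_grp \<Rightarrow> bool" where
  "lie_group G \<longleftrightarrow> group G \<and> manifold (charts G) \<and> pts (charts G) = carrier G \<and>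
     smooth_map (prod_atlas (charts G) (charts G)) (carrier G \<times> carrier G) (charts G)
       (\<lambda>(a, b). a \<otimes>\<^bsub>G\<^esub> b) \<and>
     smooth_map (charts G) (carrier G) (charts G) (\<lambda>a. inv\<^bsub>G\<^esub> a)"

definition lie_hom ::
    "('g, 'e::banach) lie_grp \<Rightarrow> ('h, 'f::banach) lie_grp \<Rightarrow> ('g \<Rightarrow> 'h) \<Rightarrow> bool" where
  "lie_hom G H \<phi> \<longleftrightarrow> \<phi> \<in> hom G H \<and> smooth_map (charts G) (carrier G) (charts H) \<phi>"

text \<open>
  The Lie algebra \<open>T\<^sub>eG\<close> is the model space \<open>'e\<close> of the group.
\<close>

definition lie_alg_hom ::
    "('g, 'e::banach) lie_grp \<Rightarrow> ('h, 'f::banach) lie_grp \<Rightarrow> ('g \<Rightarrow> 'h) \<Rightarrow> 'e \<Rightarrow> 'f" where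
  "lie_alg_hom G H \<phi> = tangent_map (charts G) (charts H) \<phi> \<one>\<^bsub>G\<^esub>"

definition Ad :: "('g, 'e::banach) lie_grp \<Rightarrow> 'g \<Rightarrow> 'e \<Rightarrow> 'e" where
  "Ad G a = tangent_map (charts G) (charts G) (\<lambda>b. a \<otimes>\<^bsub>G\<^esub> b \<otimes>\<^bsub>G\<^esub> inv\<^bsub>G\<^esub> a) \<one>\<^bsub>G\<^esub>"

definition maurer_cartan ::
    "('b, 'be::banach) atlas \<Rightarrow> ('h, 'e::banach) lie_grp \<Rightarrow> ('b \<Rightarrow> 'h) \<Rightarrow> 'b \<Rightarrow> 'be \<Rightarrow> 'e" where
  "maurer_cartan B H h x v =
     tangent_map (charts H) (charts H) (\<lambda>a. inv\<^bsub>H\<^esub> (h x) \<otimes>\<^bsub>H\<^esub> a) (h x)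
       (tangent_map B (charts H) h x v)"


section \<open>Principal bundles\<close>

record ('p, 'pe, 'g, 'ge, 'b, 'be) pbundle =
  total_space :: "('p, 'pe) atlas"
  struct_group :: "('g, 'ge) lie_grp"
  base_space :: "('b, 'be) atlas"
  projection :: "'p \<Rightarrow> 'b"
  right_action :: "'p \<Rightarrow> 'g \<Rightarrow> 'p"

definition over :: "('p, 'pe, 'g, 'ge, 'b, 'be) pbundle \<Rightarrow> 'b set \<Rightarrow> 'p set" where
  "over P U = {p \<in> pts (total_space P). projection P p \<in> U}"

definition local_trivialization ::
    "('p, 'pe::banach, 'g, 'ge::banach, 'b, 'be::banach) pbundle \<Rightarrow> 'b set \<Rightarrow> ('p \<Rightarrow> 'b \<times> 'g) \<Rightarrow> bool"
    where
  "local_trivialization P U \<Phi> \<longleftrightarrow>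
     open_in (base_space P) U \<and>
     diffeo (total_space P) (over P U)
       (prod_atlas (base_space P) (charts (struct_group P))) (U \<times> carrier (struct_group P)) \<Phi> \<and>
     (\<forall>p\<in>over P U. fst (\<Phi> p) = projection P p) \<and>
     (\<forall>p\<in>over P U. \<forall>g\<in>carrier (struct_group P).
        \<Phi> (right_action P p g) = (fst (\<Phi> p), snd (\<Phi> p) \<otimes>\<^bsub>struct_group P\<^esub> g))"

definition principal_bundle ::
    "('p, 'pe::banach, 'g, 'ge::banach, 'b, 'be::banach) pbundle \<Rightarrow> bool" where
  "principal_bundle P \<longleftrightarrow>
     manifold (total_space P) \<and> lie_group (struct_group P) \<and> manifold (base_space P) \<and>
     smooth_map (total_space P) (pts (total_space P)) (base_space P) (projection P) \<and>
     smooth_map (prod_atlas (total_space P) (charts (struct_group P)))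
       (pts (total_space P) \<times> carrier (struct_group P)) (total_space P)
       (\<lambda>(p, g). right_action P p g) \<and>
     (\<forall>p\<in>pts (total_space P). right_action P p \<one>\<^bsub>struct_group P\<^esub> = p) \<and>
     (\<forall>p\<in>pts (total_space P). \<forall>g\<in>carrier (struct_group P). \<forall>h\<in>carrier (struct_group P).
        right_action P (right_action P p g) h = right_action P p (g \<otimes>\<^bsub>struct_group P\<^esub> h)) \<and>
     (\<forall>p\<in>pts (total_space P). \<forall>g\<in>carrier (struct_group P).
        projection P (right_action P p g) = projection P p) \<and>
     (\<forall>x\<in>pts (base_space P). \<exists>U \<Phi>. x \<in> U \<and> local_trivialization P U \<Phi>)"

definition trivializing_cover ::
    "('p, 'pe::banach, 'g, 'ge::banach, 'b, 'be::banach) pbundle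
      \<Rightarrow> 'i set \<Rightarrow> ('i \<Rightarrow> 'b set) \<Rightarrow> ('i \<Rightarrow> 'p \<Rightarrow> 'b \<times> 'g) \<Rightarrow> bool" where
  "trivializing_cover P I U \<Phi> \<longleftrightarrow>
     (\<Union>\<alpha>\<in>I. U \<alpha>) = pts (base_space P) \<and> (\<forall>\<alpha>\<in>I. local_trivialization P (U \<alpha>) (\<Phi> \<alpha>))"

definition natural_section ::
    "('p, 'pe, 'g, 'ge, 'b, 'be) pbundle \<Rightarrow> 'b set \<Rightarrow> ('p \<Rightarrow> 'b \<times> 'g) \<Rightarrow> 'b \<Rightarrow> 'p" where
  "natural_section P U \<Phi> x = inv_into (over P U) \<Phi> (x, \<one>\<^bsub>struct_group P\<^esub>)"

text \<open>
  For sections \<open>s\<close>, \<open>s'\<close> this is the function \<open>g\<close> with \<open>s' = s \<cdot> g\<close>; it is meaningful where both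
  are defined.
\<close>

definition transition ::
    "('p, 'pe, 'g, 'ge, 'b, 'be) pbundle \<Rightarrow> ('b \<Rightarrow> 'p) \<Rightarrow> ('b \<Rightarrow> 'p) \<Rightarrow> 'b \<Rightarrow> 'g" where
  "transition P s s' x = (THE g. g \<in> carrier (struct_group P) \<and> s' x = right_action P (s x) g)"

text \<open>
  Morphisms of the form \<open>(f, \<phi>, id\<^sub>B)\<close>; they are used for bundles with the same base.
\<close>

definition bundle_morphism ::
    "('p, 'pe::banach, 'g, 'ge::banach, 'b, 'be::banach) pbundle
      \<Rightarrow> ('q, 'qe::banach, 'h, 'he::banach, 'b, 'be) pbundle
      \<Rightarrow> ('p \<Rightarrow> 'q) \<Rightarrow> ('g \<Rightarrow> 'h) \<Rightarrow> bool" where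
  "bundle_morphism P Q f \<phi> \<longleftrightarrow>
     smooth_map (total_space P) (pts (total_space P)) (total_space Q) f \<and>
     lie_hom (struct_group P) (struct_group Q) \<phi> \<and>
     (\<forall>p\<in>pts (total_space P). projection Q (f p) = projection P p) \<and>
     (\<forall>p\<in>pts (total_space P). \<forall>g\<in>carrier (struct_group P).
        f (right_action P p g) = right_action Q (f p) (\<phi> g))"


section \<open>Connections\<close>

definition fundamental_field ::
    "('p, 'pe::banach, 'g, 'ge::banach, 'b, 'be) pbundle \<Rightarrow> 'ge \<Rightarrow> 'p \<Rightarrow> 'pe" where
  "fundamental_field P X p =
     tangent_map (charts (struct_group P)) (total_space P) (\<lambda>g. right_action P p g)
       \<one>\<^bsub>struct_group P\<^esub> X"

definition connection_form ::
    "('p, 'pe::banach, 'g, 'ge::banach, 'b, 'be) pbundle \<Rightarrow> ('p, 'pe, 'ge) form \<Rightarrow> bool" where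
  "connection_form P \<omega> \<longleftrightarrow>
     smooth_form (total_space P) \<omega> \<and>
     (\<forall>p\<in>pts (total_space P). \<forall>X. blinfun_apply (\<omega> p) (fundamental_field P X p) = X) \<and>
     (\<forall>p\<in>pts (total_space P). \<forall>g\<in>carrier (struct_group P). \<forall>u.
        pullback (total_space P) (total_space P) (\<lambda>q. right_action P q g) \<omega> p u =
        Ad (struct_group P) (inv\<^bsub>struct_group P\<^esub> g) (blinfun_apply (\<omega> p) u))"

definition related_connections ::
    "('p, 'pe::banach, 'g, 'ge::banach, 'b, 'be::banach) pbundle
      \<Rightarrow> ('q, 'qe::banach, 'h, 'he::banach, 'b, 'be) pbundle
      \<Rightarrow> ('p \<Rightarrow> 'q) \<Rightarrow> ('g \<Rightarrow> 'h) \<Rightarrow> ('p, 'pe, 'ge) form \<Rightarrow> ('q, 'qe, 'he) form \<Rightarrow> bool" where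
  "related_connections P Q f \<phi> \<omega> \<theta> \<longleftrightarrow>
     (\<forall>p\<in>pts (total_space P). \<forall>u.
        pullback (total_space P) (total_space Q) f \<theta> p u =
        lie_alg_hom (struct_group P) (struct_group Q) \<phi> (blinfun_apply (\<omega> p) u))"

definition local_connection_form ::
    "('p, 'pe::banach, 'g, 'ge::banach, 'b, 'be::banach) pbundle \<Rightarrow> ('p, 'pe, 'ge) form
      \<Rightarrow> ('b \<Rightarrow> 'p) \<Rightarrow> 'b \<Rightarrow> 'be \<Rightarrow> 'ge" where
  "local_connection_form P \<omega> s = pullback (base_space P) (total_space P) s \<omega>"

section \<open>Families of local maps into the structure group\<close>

definition compatible_family ::
    "('b, 'be::banach) atlas \<Rightarrow> ('g, 'ge::banach) lie_grp \<Rightarrow> ('h, 'he::banach) lie_grp \<Rightarrow> ('g \<Rightarrow> 'h)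
      \<Rightarrow> 'i set \<Rightarrow> ('i \<Rightarrow> 'b set)
      \<Rightarrow> ('i \<Rightarrow> 'i \<Rightarrow> 'b \<Rightarrow> 'g) \<Rightarrow> ('i \<Rightarrow> 'i \<Rightarrow> 'b \<Rightarrow> 'h)
      \<Rightarrow> ('i \<Rightarrow> 'b \<Rightarrow> 'be \<Rightarrow> 'ge) \<Rightarrow> ('i \<Rightarrow> 'b \<Rightarrow> 'be \<Rightarrow> 'he)
      \<Rightarrow> ('i \<Rightarrow> 'b \<Rightarrow> 'h) \<Rightarrow> bool" where
  "compatible_family B G H \<phi> I U g_trans h_trans \<omega>_loc \<theta>_loc h \<longleftrightarrow>
     (\<forall>\<alpha>\<in>I. smooth_map B (U \<alpha>) (charts H) (h \<alpha>)) \<and>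
     (\<forall>\<alpha>\<in>I. \<forall>x\<in>U \<alpha>. \<forall>v.
        lie_alg_hom G H \<phi> (\<omega>_loc \<alpha> x v) =
        Ad H (inv\<^bsub>H\<^esub> (h \<alpha> x)) (\<theta>_loc \<alpha> x v) + maurer_cartan B H (h \<alpha>) x v) \<and>
     (\<forall>\<alpha>\<in>I. \<forall>\<beta>\<in>I. \<forall>x\<in>U \<alpha> \<inter> U \<beta>.
        h_trans \<alpha> \<beta> x = h \<alpha> x \<otimes>\<^bsub>H\<^esub> \<phi> (g_trans \<alpha> \<beta> x) \<otimes>\<^bsub>H\<^esub> inv\<^bsub>H\<^esub> (h \<beta> x))"

text \<open>
  The relation \<open>f \<circ> s\<^sub>\<alpha> = t\<^sub>\<alpha> \<cdot> h\<^sub>\<alpha>\<close>, with \<open>h\<^sub>\<alpha>\<close> taking values in the structure group.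
\<close>

definition corresponding ::
    "('q, 'qe, 'h, 'he, 'b, 'be) pbundle \<Rightarrow> 'i set \<Rightarrow> ('i \<Rightarrow> 'b set)
      \<Rightarrow> ('i \<Rightarrow> 'b \<Rightarrow> 'p) \<Rightarrow> ('i \<Rightarrow> 'b \<Rightarrow> 'q) \<Rightarrow> ('p \<Rightarrow> 'q) \<Rightarrow> ('i \<Rightarrow> 'b \<Rightarrow> 'h) \<Rightarrow> bool" where
  "corresponding Q I U s t f h \<longleftrightarrow>
     (\<forall>\<alpha>\<in>I. \<forall>x\<in>U \<alpha>.
        h \<alpha> x \<in> carrier (struct_group Q) \<and> f (s \<alpha> x) = right_action Q (t \<alpha> x) (h \<alpha> x))"

end

theory Submission
  imports Defs
begin

text \<open>
  The heart of the matter is the transformation formula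
  \<open>(t \<cdot> h)\<^sup>*\<theta> = Ad(h\<^sup>-\<^sup>1).t\<^sup>*\<theta> + h\<^sup>-\<^sup>1dh\<close>, valid for every connection form \<open>\<theta>\<close> and all smooth maps
  \<open>t\<close> and \<open>h\<close> of a manifold into the total space and into the structure group
  (\<open>pullback_gauge_transformation\<close>).  It follows from the Leibniz rule for the action and the two
  defining properties of a connection form.

  Let \<open>f\<close> be a morphism.  Since \<open>f \<circ> s\<^sub>\<alpha>\<close> and \<open>t\<^sub>\<alpha>\<close> are local maps into \<open>Q\<close> over the same points,
  \<open>f \<circ> s\<^sub>\<alpha> = t\<^sub>\<alpha> \<cdot> h\<^sub>\<alpha>\<close> for a unique \<open>h\<^sub>\<alpha>\<close>, which is the group coordinate of \<open>f \<circ> s\<^sub>\<alpha>\<close> in the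
  trivialization and hence smooth.  If the connections are related, then pulling \<open>f\<^sup>*\<theta>\<close> back along
  \<open>s\<^sub>\<alpha>\<close> in two ways gives the first condition.  The second one results from comparing
  \<open>f(s\<^sub>\<beta>) = f(s\<^sub>\<alpha> \<cdot> g\<^sub>\<alpha>\<^sub>\<beta>)\<close> with \<open>t\<^sub>\<beta> \<cdot> h\<^sub>\<beta> = t\<^sub>\<alpha> \<cdot> h\<^sub>\<alpha>\<^sub>\<beta> \<cdot> h\<^sub>\<beta>\<close>, as the action is free.

  Conversely, put \<open>f(s\<^sub>\<alpha>(x) \<cdot> g) = t\<^sub>\<alpha>(x) \<cdot> h\<^sub>\<alpha>(x) \<cdot> \<phi>(g)\<close>; the second condition says that these
  local definitions agree.  With \<open>c\<close> the group coordinate on \<open>P\<close>, the identity of \<open>P\<close> is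
  \<open>(s\<^sub>\<alpha> \<circ> \<pi>) \<cdot> c\<close> and \<open>f\<close> is \<open>((t\<^sub>\<alpha> \<cdot> h\<^sub>\<alpha>) \<circ> \<pi>) \<cdot> (\<phi> \<circ> c)\<close>.  The transformation formula, applied
  to both, expresses \<open>\<omega>\<close> and \<open>f\<^sup>*\<theta>\<close> through local forms and logarithmic differentials;
  they match by the first condition because the derivative of \<open>\<phi>\<close> intertwines the adjoint
  representations (\<open>Ad_lie_hom\<close>) and the logarithmic differentials (\<open>maurer_cartan_lie_hom\<close>).

  The rest is calculus on Banach manifolds.  Its main point is that smooth maps compose
  (\<open>smooth_on_compose\<close>).  For maps given by towers of multilinear derivatives this is the formula
  of Faa di Bruno for all orders; it is established for the weaker notion of a derivative tower, which
  is equivalent to smoothness because bounds on higher derivatives provide the uniformity of the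
  lower ones.
\<close>

section \<open>Derivative towers\<close>

abbreviation norm_prod :: "'a::real_normed_vector list \<Rightarrow> real" where
  "norm_prod vs \<equiv> prod_list (map norm vs)"

lemma norm_prod_nonneg: "0 \<le> norm_prod vs"
  by (induction vs) auto

text \<open>
  A tower of iterated derivatives of \<open>f\<close> on the open set \<open>S\<close>, where \<open>D [v\<^sub>1, \<dots>, v\<^sub>k] x\<close> is the
  \<open>k\<close>-th derivative at \<open>x\<close> in the directions \<open>v\<^sub>1, \<dots>, v\<^sub>k\<close>.  Compared with \<^const>\<open>smooth_on\<close>,
  multilinearity is not required, and differentiability is required for each fixed list of directions
  only; in exchange, the derivatives of every order are locally bounded.  Both notions agree
  (\<open>smooth_on_iff_tower\<close> below), and this one is the easier to verify.
\<close>

definition derivative_tower ::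
    "'a::real_normed_vector set \<Rightarrow> ('a \<Rightarrow> 'b::real_normed_vector) \<Rightarrow> ('a list \<Rightarrow> 'a \<Rightarrow> 'b) \<Rightarrow> bool"
  where
  "derivative_tower S f D \<longleftrightarrow> open S \<and> (\<forall>x\<in>S. D [] x = f x) \<and>
     (\<forall>x\<in>S. \<forall>vs. (D vs has_derivative (\<lambda>v. D (v # vs) x)) (at x)) \<and>
     (\<forall>x\<in>S. \<forall>k. \<exists>C. \<forall>\<^sub>F y in nhds x. \<forall>vs. length vs = k \<longrightarrow> norm (D vs y) \<le> C * norm_prod vs)"

lemma derivative_towerD:
  assumes "derivative_tower S f D"
  shows "open S" "x \<in> S \<Longrightarrow> D [] x = f x"
    "x \<in> S \<Longrightarrow> (D vs has_derivative (\<lambda>v. D (v # vs) x)) (at x)"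
    "x \<in> S \<Longrightarrow> \<exists>C. \<forall>\<^sub>F y in nhds x. \<forall>vs. length vs = k \<longrightarrow> norm (D vs y) \<le> C * norm_prod vs"
  using assms unfolding derivative_tower_def by blast+

text \<open>
  Linearity in the first direction is part of the notion of derivative; differentiating the identities
  \<open>D ((v + w) # vs) = D (v # vs) + D (w # vs)\<close> and \<open>D (c v # vs) = c D (v # vs)\<close> transports it to
  the later directions.
\<close>

lemma derivative_tower_linear:
  assumes D: "derivative_tower S f D" and "x \<in> S"
  shows "linear (\<lambda>v. D (us @ v # vs) x)"
  using \<open>x \<in> S\<close>
proof (induction us arbitrary: x)
  case Nil
  show ?case
    using derivative_towerD(3)[OF D Nil] by (auto dest: has_derivative_linear)
next
  case (Cons u us)
  note der = derivative_towerD(3)[OF D] and opn = derivative_towerD(1)[OF D]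
  show ?case
  proof (rule linearI)
    fix a b
    have "((\<lambda>y. D (us @ a # vs) y + D (us @ b # vs) y) has_derivative
        (\<lambda>w. D (w # us @ a # vs) x + D (w # us @ b # vs) x)) (at x)"
      by (intro has_derivative_add der Cons.prems)
    then have "(D (us @ (a + b) # vs) has_derivative
        (\<lambda>w. D (w # us @ a # vs) x + D (w # us @ b # vs) x)) (at x)"
      by (rule has_derivative_transform_within_open[OF _ opn Cons.prems])
        (simp add: linear_add[OF Cons.IH])
    from has_derivative_unique[OF der[OF Cons.prems] this]
    show "D ((u # us) @ (a + b) # vs) x = D ((u # us) @ a # vs) x + D ((u # us) @ b # vs) x"
      by (auto dest: fun_cong)
  next
    fix c :: real and a
    have "((\<lambda>y. c *\<^sub>R D (us @ a # vs) y) has_derivative (\<lambda>w. c *\<^sub>R D (w # us @ a # vs) x)) (at x)"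
      by (intro has_derivative_scaleR_right der Cons.prems)
    then have "(D (us @ (c *\<^sub>R a) # vs) has_derivative (\<lambda>w. c *\<^sub>R D (w # us @ a # vs) x)) (at x)"
      by (rule has_derivative_transform_within_open[OF _ opn Cons.prems])
        (simp add: linear_scale[OF Cons.IH])
    from has_derivative_unique[OF der[OF Cons.prems] this]
    show "D ((u # us) @ (c *\<^sub>R a) # vs) x = c *\<^sub>R D ((u # us) @ a # vs) x"
      by (auto dest: fun_cong)
  qed
qed

lemma derivative_tower_multilinear:
  assumes D: "derivative_tower S f D" and x: "x \<in> S"
  shows "bounded_multilinear k (\<lambda>vs. D vs x)"
  unfolding bounded_multilinear_def
  using derivative_tower_linear[OF D x] derivative_towerD(4)[OF D x, of k]
    eventually_nhds_x_imp_x by blast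

text \<open>
  Differentiability of the \<open>k\<close>-th derivative in the operator norm: the bound on the derivative of
  order \<open>k + 2\<close> makes the one of order \<open>k + 1\<close> Lipschitz by the mean value inequality, and a second
  application of that inequality gives the estimate.
\<close>

lemma derivative_tower_uniform:
  assumes D: "derivative_tower S f D" and x: "x \<in> S" and e: "\<epsilon> > 0"
  shows "\<forall>\<^sub>F y in nhds x. \<forall>vs. length vs = k \<longrightarrow>
    norm (D vs y - D vs x - D ((y - x) # vs) x) \<le> \<epsilon> * norm (y - x) * norm_prod vs"
proof -
  note der = derivative_towerD(3)[OF D] and opn = derivative_towerD(1)[OF D]
  obtain C where "\<forall>\<^sub>F y in nhds x. \<forall>vs. length vs = k + 2 \<longrightarrow> norm (D vs y) \<le> C * norm_prod vs"
    using derivative_towerD(4)[OF D x] by blast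
  moreover have "\<forall>\<^sub>F y in nhds x. y \<in> S"
    using opn x by (rule eventually_nhds_in_open)
  ultimately have "\<forall>\<^sub>F y in nhds x. y \<in> S \<and>
      (\<forall>vs. length vs = k + 2 \<longrightarrow> norm (D vs y) \<le> C * norm_prod vs)"
    by eventually_elim blast
  then obtain r where r: "r > 0" and rS: "\<And>y. dist y x < r \<Longrightarrow> y \<in> S"
    and rC: "\<And>y vs. dist y x < r \<Longrightarrow> length vs = k + 2 \<Longrightarrow> norm (D vs y) \<le> C * norm_prod vs"
    unfolding eventually_nhds_metric by auto
  define K where "K = \<bar>C\<bar> + 1"
  have K: "K > 0" unfolding K_def by simp
  have rK: "norm (D vs y) \<le> K * norm_prod vs" if "dist y x < r" "length vs = k + 2" for y vs
  proof -
    have "C * norm_prod vs \<le> K * norm_prod vs"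
      by (rule mult_right_mono) (auto simp: K_def norm_prod_nonneg)
    with rC[OF that] show ?thesis by linarith
  qed
  define \<rho> where "\<rho> = min r (\<epsilon> / K)"
  have \<rho>: "\<rho> > 0" "\<rho> \<le> r" "K * \<rho> \<le> \<epsilon>"
    using r e K by (auto simp: \<rho>_def field_simps min_def)
  have step1: "norm (D ws z - D ws x) \<le> K * norm_prod ws * norm (z - x)"
    if z: "z \<in> ball x r" and ws: "length ws = k + 1" for ws z
  proof (rule differentiable_bound[of "ball x r" "D ws" "\<lambda>y v. D (v # ws) y"])
    fix y assume y: "y \<in> ball x r"
    show "(D ws has_derivative (\<lambda>v. D (v # ws) y)) (at y within ball x r)"
      by (rule has_derivative_at_withinI[OF der[OF rS]]) (use y in \<open>simp add: dist_commute\<close>)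
    show "onorm (\<lambda>v. D (v # ws) y) \<le> K * norm_prod ws"
    proof (rule onorm_bound)
      show "0 \<le> K * norm_prod ws" using K norm_prod_nonneg by (intro mult_nonneg_nonneg) auto
      show "norm (D (v # ws) y) \<le> K * norm_prod ws * norm v" for v
        using rK[of y "v # ws"] y ws by (simp add: dist_commute mult_ac)
    qed
  qed (use z r in auto)
  have "norm (D vs y - D vs x - D ((y - x) # vs) x) \<le> \<epsilon> * norm (y - x) * norm_prod vs"
    if y: "dist y x < \<rho>" and vs: "length vs = k" for y vs
  proof -
    have lin: "bounded_linear (\<lambda>v. D (v # vs) x)"
      by (rule has_derivative_bounded_linear[OF der[OF x]])
    define h where "h z = D vs z - D ((z - x) # vs) x" for z
    have "norm (h y - h x) \<le> (\<epsilon> * norm_prod vs) * norm (y - x)"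
    proof (rule differentiable_bound[of "ball x \<rho>" h "\<lambda>z v. D (v # vs) z - D (v # vs) x"])
      fix z assume z: "z \<in> ball x \<rho>"
      then have zr: "z \<in> ball x r" using \<rho> by auto
      have zS: "z \<in> S" using zr rS by (simp add: dist_commute)
      have "((\<lambda>z. z - x) has_derivative (\<lambda>v. v)) (at z within ball x \<rho>)"
        by (auto intro!: derivative_eq_intros)
      from bounded_linear.has_derivative[OF lin this]
      show "(h has_derivative (\<lambda>v. D (v # vs) z - D (v # vs) x)) (at z within ball x \<rho>)"
        unfolding h_def by (intro has_derivative_diff has_derivative_at_withinI[OF der[OF zS]])
      show "onorm (\<lambda>v. D (v # vs) z - D (v # vs) x) \<le> \<epsilon> * norm_prod vs"
      proof (rule onorm_bound)
        show "0 \<le> \<epsilon> * norm_prod vs" using e norm_prod_nonneg by (intro mult_nonneg_nonneg) auto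
        fix v
        have "norm (D (v # vs) z - D (v # vs) x) \<le> (norm v * norm_prod vs) * (K * norm (z - x))"
          using step1[OF zr, of "v # vs"] vs by (simp add: mult_ac)
        also have "\<dots> \<le> (norm v * norm_prod vs) * \<epsilon>"
        proof (rule mult_left_mono)
          have "K * norm (z - x) \<le> K * \<rho>"
            using z K by (intro mult_left_mono) (auto simp: dist_norm norm_minus_commute)
          then show "K * norm (z - x) \<le> \<epsilon>" using \<rho> by linarith
        qed (simp add: norm_prod_nonneg)
        finally show "norm (D (v # vs) z - D (v # vs) x) \<le> \<epsilon> * norm_prod vs * norm v"
          by (simp add: mult_ac)
      qed
    qed (use y \<rho> in \<open>auto simp: dist_commute\<close>)
    moreover have "h x = D vs x"
      unfolding h_def using linear_0[OF bounded_linear.linear[OF lin]] by simp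
    ultimately show ?thesis by (simp add: h_def algebra_simps)
  qed
  then show ?thesis
    unfolding eventually_nhds_metric using \<rho> by blast
qed

lemma smooth_on_if_tower:
  assumes D: "derivative_tower S f D"
  shows "smooth_on S f"
  unfolding smooth_on_def
proof (intro conjI exI[of _ "\<lambda>x vs. D vs x"] ballI allI impI)
  fix x k and \<epsilon> :: real assume "x \<in> S" "0 < \<epsilon>"
  from derivative_tower_uniform[OF D this, of k]
  show "\<exists>\<delta>>0. \<forall>y\<in>S. norm (y - x) < \<delta> \<longrightarrow> (\<forall>vs. length vs = k \<longrightarrow>
      norm (D vs y - D vs x - D ((y - x) # vs) x) \<le> \<epsilon> * norm (y - x) * norm_prod vs)"
    unfolding eventually_nhds_metric dist_norm by blast
qed (use derivative_towerD[OF D] derivative_tower_multilinear[OF D] in auto)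

lemma bounded_linear_multilinear:
  assumes "bounded_multilinear (Suc k) T" "length vs = k"
  shows "bounded_linear (\<lambda>v. T (v # vs))"
proof -
  obtain C where C: "\<And>ws. length ws = Suc k \<Longrightarrow> norm (T ws) \<le> C * norm_prod ws"
    using assms(1) unfolding bounded_multilinear_def by blast
  have "\<forall>us ws. length us + length ws + 1 = Suc k \<longrightarrow> linear (\<lambda>v. T (us @ v # ws))"
    using assms(1) unfolding bounded_multilinear_def by (rule conjunct1)
  from this[rule_format, of "[]" vs] assms(2) have lin: "linear (\<lambda>v. T (v # vs))"
    by simp
  show ?thesis
  proof (rule bounded_linear_intro[where K = "C * norm_prod vs"])
    show "norm (T (v # vs)) \<le> norm v * (C * norm_prod vs)" for v
      using C[of "v # vs"] assms(2) by (simp add: mult_ac)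
  qed (use linear_add[OF lin] linear_scale[OF lin] in auto)
qed

lemma tower_if_smooth_on:
  assumes "smooth_on S f"
  obtains D where "derivative_tower S f D"
proof -
  have opn: "open S" using assms unfolding smooth_on_def by (rule conjunct1)
  obtain D where D: "(\<forall>x\<in>S. D x [] = f x) \<and> (\<forall>x\<in>S. \<forall>k. bounded_multilinear k (D x)) \<and>
      (\<forall>x\<in>S. \<forall>k. \<forall>\<epsilon>>0. \<exists>\<delta>>0. \<forall>y\<in>S. norm (y - x) < \<delta> \<longrightarrow> (\<forall>vs. length vs = k \<longrightarrow>
        norm (D y vs - D x vs - D x ((y - x) # vs)) \<le> \<epsilon> * norm (y - x) * norm_prod vs))"
    using assms unfolding smooth_on_def by (elim conjE exE) (rule that, intro conjI)
  note D0 = D[THEN conjunct1, rule_format]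
    and Dm = D[THEN conjunct2, THEN conjunct1, rule_format]
    and Du = D[THEN conjunct2, THEN conjunct2, rule_format]
  have "((\<lambda>y. D y vs) has_derivative (\<lambda>v. D x (v # vs))) (at x)" if x: "x \<in> S" for x vs
  proof -
    have "((\<lambda>y. D y vs) has_derivative (\<lambda>v. D x (v # vs))) (at x within S)"
      unfolding has_derivative_within_alt
    proof (intro conjI allI impI)
      show "bounded_linear (\<lambda>v. D x (v # vs))"
        by (rule bounded_linear_multilinear[OF Dm[OF x]]) simp
      fix e :: real assume e: "e > 0"
      define \<epsilon> where "\<epsilon> = e / (norm_prod vs + 1)"
      have p: "norm_prod vs + 1 > 0" using norm_prod_nonneg[of vs] by linarith
      then have \<epsilon>: "\<epsilon> > 0" "\<epsilon> * norm_prod vs \<le> e"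
        using e by (auto simp: \<epsilon>_def field_simps)
      obtain \<delta> where \<delta>: "\<delta> > 0" "\<And>y. y \<in> S \<Longrightarrow> norm (y - x) < \<delta> \<Longrightarrow>
          norm (D y vs - D x vs - D x ((y - x) # vs)) \<le> \<epsilon> * norm (y - x) * norm_prod vs"
        using Du[OF x \<epsilon>(1), of "length vs"] by metis
      show "\<exists>d>0. \<forall>y\<in>S. norm (y - x) < d \<longrightarrow>
          norm (D y vs - D x vs - D x ((y - x) # vs)) \<le> e * norm (y - x)"
      proof (intro exI[of _ \<delta>] conjI ballI impI)
        fix y assume "y \<in> S" "norm (y - x) < \<delta>"
        from \<delta>(2)[OF this]
        have "norm (D y vs - D x vs - D x ((y - x) # vs)) \<le> (\<epsilon> * norm_prod vs) * norm (y - x)"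
          by (simp add: mult_ac)
        also have "\<dots> \<le> e * norm (y - x)" using \<epsilon> by (intro mult_right_mono) auto
        finally show "norm (D y vs - D x vs - D x ((y - x) # vs)) \<le> e * norm (y - x)" .
      qed (rule \<delta>)
    qed
    then show ?thesis using at_within_open[OF x opn] by simp
  qed
  moreover have "\<exists>C. \<forall>\<^sub>F y in nhds x. \<forall>vs. length vs = k \<longrightarrow> norm (D y vs) \<le> C * norm_prod vs"
    if x: "x \<in> S" for x k
  proof -
    \<comment> \<open>Near \<open>x\<close> the value at \<open>y\<close> is estimated by its first-order expansion at \<open>x\<close>.\<close>
    obtain A where A: "\<And>vs. length vs = k \<Longrightarrow> norm (D x vs) \<le> A * norm_prod vs"
      using Dm[OF x, of k] unfolding bounded_multilinear_def by blast
    obtain A' where A': "\<And>vs. length vs = Suc k \<Longrightarrow> norm (D x vs) \<le> A' * norm_prod vs"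
      using Dm[OF x, of "Suc k"] unfolding bounded_multilinear_def by blast
    obtain \<delta> where \<delta>: "\<delta> > 0" "\<And>y vs. y \<in> S \<Longrightarrow> norm (y - x) < \<delta> \<Longrightarrow> length vs = k \<Longrightarrow>
        norm (D y vs - D x vs - D x ((y - x) # vs)) \<le> 1 * norm (y - x) * norm_prod vs"
      using Du[OF x zero_less_one, of k] by metis
    have "\<forall>\<^sub>F y in nhds x. y \<in> S" using opn x by (rule eventually_nhds_in_open)
    moreover have "\<forall>\<^sub>F y in nhds x. norm (y - x) < \<delta>"
      using \<delta>(1) unfolding eventually_nhds_metric dist_norm by blast
    ultimately have "\<forall>\<^sub>F y in nhds x. \<forall>vs. length vs = k \<longrightarrow>
        norm (D y vs) \<le> (A + (\<bar>A'\<bar> + 1) * \<delta>) * norm_prod vs"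
    proof eventually_elim
      case (elim y)
      show ?case
      proof (intro allI impI)
        fix vs :: "'a list" assume vs: "length vs = k"
        have "norm (D x ((y - x) # vs)) \<le> A' * (norm (y - x) * norm_prod vs)"
          using A'[of "(y - x) # vs"] vs by simp
        also have "\<dots> \<le> \<bar>A'\<bar> * (norm (y - x) * norm_prod vs)"
          by (intro mult_right_mono mult_nonneg_nonneg) (auto simp: norm_prod_nonneg)
        finally have "norm (D x ((y - x) # vs)) + norm (D y vs - D x vs - D x ((y - x) # vs)) \<le>
            (\<bar>A'\<bar> + 1) * (norm (y - x) * norm_prod vs)"
          using \<delta>(2)[OF elim vs] by (simp add: algebra_simps)
        also have "\<dots> \<le> (\<bar>A'\<bar> + 1) * (\<delta> * norm_prod vs)"
          using elim by (intro mult_left_mono mult_right_mono) (auto simp: norm_prod_nonneg)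
        finally have "norm (D x ((y - x) # vs)) + norm (D y vs - D x vs - D x ((y - x) # vs)) \<le>
            (\<bar>A'\<bar> + 1) * (\<delta> * norm_prod vs)" .
        moreover have "norm (D y vs) \<le> norm (D x vs) +
            (norm (D x ((y - x) # vs)) + norm (D y vs - D x vs - D x ((y - x) # vs)))"
          by norm
        ultimately show "norm (D y vs) \<le> (A + (\<bar>A'\<bar> + 1) * \<delta>) * norm_prod vs"
          using A[OF vs] by (simp add: algebra_simps)
      qed
    qed
    then show ?thesis by blast
  qed
  ultimately have "derivative_tower S f (\<lambda>vs y. D y vs)"
    unfolding derivative_tower_def using opn D0 by blast
  then show ?thesis by (rule that)
qed

text \<open>
  The iterated derivatives, without any assumption on their existence.  Since they depend only on the
  germ of the function, smoothness expressed through them is visibly a local property.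
\<close>

primrec iter_deriv :: "('a::real_normed_vector \<Rightarrow> 'b::real_normed_vector) \<Rightarrow> 'a list \<Rightarrow> 'a \<Rightarrow> 'b" where
  "iter_deriv f [] = f"
| "iter_deriv f (v # vs) = (\<lambda>x. frechet_derivative (iter_deriv f vs) (at x) v)"

lemma derivative_tower_unique:
  assumes D: "derivative_tower S f D"
  shows "x \<in> S \<Longrightarrow> iter_deriv f vs x = D vs x"
proof (induction vs arbitrary: x)
  case Nil
  then show ?case by (simp add: derivative_towerD(2)[OF D])
next
  case (Cons v vs)
  have "(iter_deriv f vs has_derivative (\<lambda>v. D (v # vs) x)) (at x)"
    by (rule has_derivative_transform_within_open[OF derivative_towerD(3)[OF D Cons.prems]
          derivative_towerD(1)[OF D] Cons.prems]) (simp add: Cons.IH)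
  from frechet_derivative_at[OF this, symmetric] show ?case by simp
qed

lemma smooth_on_iff_tower: "smooth_on S f \<longleftrightarrow> derivative_tower S f (iter_deriv f)"
proof
  assume "smooth_on S f"
  then obtain D where D: "derivative_tower S f D" by (rule tower_if_smooth_on)
  note eq = derivative_tower_unique[OF D] and opn = derivative_towerD(1)[OF D]
  show "derivative_tower S f (iter_deriv f)"
    unfolding derivative_tower_def
  proof (intro conjI ballI allI)
    fix x vs assume x: "x \<in> S"
    have "(iter_deriv f vs has_derivative (\<lambda>v. D (v # vs) x)) (at x)"
      by (rule has_derivative_transform_within_open[OF derivative_towerD(3)[OF D x] opn x])
        (simp add: eq)
    then show "(iter_deriv f vs has_derivative (\<lambda>v. iter_deriv f (v # vs) x)) (at x)"
      by (simp add: eq[OF x] del: iter_deriv.simps)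
  next
    fix x k assume x: "x \<in> S"
    obtain C where "\<forall>\<^sub>F y in nhds x. \<forall>vs. length vs = k \<longrightarrow> norm (D vs y) \<le> C * norm_prod vs"
      using derivative_towerD(4)[OF D x] by blast
    moreover have "\<forall>\<^sub>F y in nhds x. y \<in> S" using opn x by (rule eventually_nhds_in_open)
    ultimately have "\<forall>\<^sub>F y in nhds x. \<forall>vs. length vs = k \<longrightarrow>
        norm (iter_deriv f vs y) \<le> C * norm_prod vs"
      by eventually_elim (simp add: eq)
    then show "\<exists>C. \<forall>\<^sub>F y in nhds x. \<forall>vs. length vs = k \<longrightarrow>
        norm (iter_deriv f vs y) \<le> C * norm_prod vs" by blast
  qed (auto simp: opn)
qed (rule smooth_on_if_tower)

lemma smooth_on_open: "smooth_on S f \<Longrightarrow> open S"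
  unfolding smooth_on_def by blast

lemma smooth_on_differentiable: "smooth_on S f \<Longrightarrow> x \<in> S \<Longrightarrow> f differentiable (at x)"
  unfolding smooth_on_iff_tower
  by (metis derivative_towerD(3) differentiableI iter_deriv.simps(1))

lemma smooth_on_continuous: "smooth_on S f \<Longrightarrow> continuous_on S f"
  by (meson continuous_at_imp_continuous_on differentiable_imp_continuous_within
      smooth_on_differentiable)

lemma smooth_on_local:
  assumes "\<And>x. x \<in> S \<Longrightarrow> \<exists>N. x \<in> N \<and> N \<subseteq> S \<and> smooth_on N f"
  shows "smooth_on S f"
proof -
  have "open S"
    by (subst open_subopen) (meson assms smooth_on_open)
  moreover have "derivative_tower {} f (iter_deriv f)" by (simp add: derivative_tower_def)
  ultimately show ?thesis
    using assms unfolding smooth_on_iff_tower derivative_tower_def by blast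
qed

lemma smooth_on_subset: "smooth_on S f \<Longrightarrow> open T \<Longrightarrow> T \<subseteq> S \<Longrightarrow> smooth_on T f"
  unfolding smooth_on_iff_tower derivative_tower_def by blast

lemma smooth_on_cong:
  assumes f: "smooth_on S f" and eq: "\<And>x. x \<in> S \<Longrightarrow> f x = g x"
  shows "smooth_on S g"
proof -
  obtain D where "derivative_tower S f D" using tower_if_smooth_on[OF f] .
  then have "derivative_tower S g D" unfolding derivative_tower_def by (simp add: eq)
  then show ?thesis by (rule smooth_on_if_tower)
qed

lemma smooth_on_Pair:
  assumes "smooth_on S f" "smooth_on S g"
  shows "smooth_on S (\<lambda>x. (f x, g x))"
proof -
  obtain D where D: "derivative_tower S f D" using tower_if_smooth_on[OF assms(1)] .
  obtain E where E: "derivative_tower S g E" using tower_if_smooth_on[OF assms(2)] .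
  have "derivative_tower S (\<lambda>x. (f x, g x)) (\<lambda>vs x. (D vs x, E vs x))"
    unfolding derivative_tower_def
  proof (intro conjI ballI allI)
    fix x k assume x: "x \<in> S"
    obtain A where "\<forall>\<^sub>F y in nhds x. \<forall>vs. length vs = k \<longrightarrow> norm (D vs y) \<le> A * norm_prod vs"
      using derivative_towerD(4)[OF D x] by blast
    moreover obtain B where
      "\<forall>\<^sub>F y in nhds x. \<forall>vs. length vs = k \<longrightarrow> norm (E vs y) \<le> B * norm_prod vs"
      using derivative_towerD(4)[OF E x] by blast
    ultimately have "\<forall>\<^sub>F y in nhds x. \<forall>vs. length vs = k \<longrightarrow>
        norm (D vs y, E vs y) \<le> (A + B) * norm_prod vs"
    proof eventually_elim
      case (elim y)
      show ?case
      proof (intro allI impI)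
        fix vs :: "'a list" assume "length vs = k"
        with elim have "norm (D vs y) \<le> A * norm_prod vs" "norm (E vs y) \<le> B * norm_prod vs"
          by auto
        then show "norm (D vs y, E vs y) \<le> (A + B) * norm_prod vs"
          using norm_Pair_le[of "D vs y" "E vs y"] by (simp add: algebra_simps)
      qed
    qed
    then show "\<exists>C. \<forall>\<^sub>F y in nhds x. \<forall>vs. length vs = k \<longrightarrow>
        norm (D vs y, E vs y) \<le> C * norm_prod vs" by blast
  qed (use derivative_towerD[OF D] derivative_towerD[OF E] in
      \<open>auto intro!: has_derivative_Pair\<close>)
  then show ?thesis by (rule smooth_on_if_tower)
qed

lemma smooth_on_const:
  assumes "open S"
  shows "smooth_on S (\<lambda>x. c)"
proof -
  have "derivative_tower S (\<lambda>x. c) (\<lambda>vs x. if vs = [] then c else 0)"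
    unfolding derivative_tower_def
  proof (intro conjI ballI allI)
    fix x :: 'a and k :: nat
    have "norm (if vs = [] then c else 0) \<le> norm c * norm_prod vs" for vs :: "'a list"
      by (simp add: norm_prod_nonneg)
    then show "\<exists>C. \<forall>\<^sub>F y in nhds x. \<forall>vs :: 'a list. length vs = k \<longrightarrow>
        norm (if vs = [] then c else 0) \<le> C * norm_prod vs"
      by (intro exI[of _ "norm c"] always_eventually allI impI)
  qed (use assms in auto)
  then show ?thesis by (rule smooth_on_if_tower)
qed

lemma smooth_on_bounded_linear:
  assumes "open S" and L: "bounded_linear L"
  shows "smooth_on S L"
proof -
  define D where "D vs x = (case vs of [] \<Rightarrow> L x | [v] \<Rightarrow> L v | _ \<Rightarrow> 0)" for vs and x :: 'a
  have D_simps: "D [] = L" "D [v] = (\<lambda>x. L v)" "D (v # w # ws) = (\<lambda>x. 0)" for v w ws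
    by (auto simp: D_def)
  obtain K where K: "\<And>x. norm (L x) \<le> norm x * K"
    using bounded_linear.bounded[OF L] by blast
  have "derivative_tower S L D"
    unfolding derivative_tower_def
  proof (intro conjI ballI allI)
    fix x vs
    show "(D vs has_derivative (\<lambda>v. D (v # vs) x)) (at x)"
      by (cases vs rule: remdups_adj.cases)
        (auto simp: D_simps intro: bounded_linear_imp_has_derivative L)
  next
    fix x :: 'a and k :: nat
    have "\<forall>\<^sub>F y in nhds x. norm y < norm x + 1"
      by (rule order_tendstoD(2)[OF tendsto_norm[OF filterlim_ident]]) simp
    then have "\<forall>\<^sub>F y in nhds x. \<forall>vs. length vs = k \<longrightarrow>
        norm (D vs y) \<le> (\<bar>K\<bar> * (norm x + 2)) * norm_prod vs"
    proof eventually_elim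
      case (elim y)
      show ?case
      proof (intro allI impI)
        fix vs :: "'a list"
        have K': "norm (L z) \<le> \<bar>K\<bar> * norm z" for z
          by (rule order_trans[OF K]) (simp add: mult.commute mult_right_mono)
        consider "vs = []" | v where "vs = [v]" | v w ws where "vs = v # w # ws"
          by (cases vs rule: remdups_adj.cases) auto
        then show "norm (D vs y) \<le> (\<bar>K\<bar> * (norm x + 2)) * norm_prod vs"
        proof cases
          case 1
          have "\<bar>K\<bar> * norm y \<le> \<bar>K\<bar> * (norm x + 2)" using elim by (intro mult_left_mono) auto
          with K'[of y] 1 show ?thesis by (simp add: D_simps)
        next
          case 2
          have "\<bar>K\<bar> * norm v * 1 \<le> \<bar>K\<bar> * norm v * (norm x + 2)"
            by (intro mult_left_mono) auto
          with K'[of v] 2 show ?thesis by (simp add: D_simps mult_ac)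
        next
          case 3
          then show ?thesis by (simp add: D_simps norm_prod_nonneg)
        qed
      qed
    qed
    then show "\<exists>C. \<forall>\<^sub>F y in nhds x. \<forall>vs. length vs = k \<longrightarrow> norm (D vs y) \<le> C * norm_prod vs"
      by blast
  qed (use assms in \<open>auto simp: D_simps\<close>)
  then show ?thesis by (rule smooth_on_if_tower)
qed

section \<open>Composition of smooth maps\<close>

text \<open>
  A family \<open>T y\<close> of maps of \<open>n\<close> vectors, multilinear and bounded at \<open>y = x\<close>, is differentiable at \<open>x\<close>
  in the operator norm of \<open>n\<close>-linear maps with derivative \<open>u \<mapsto> T' u\<close>.
\<close>

definition multi_differentiable ::
    "nat \<Rightarrow> ('a::real_normed_vector \<Rightarrow> 'b::real_normed_vector list \<Rightarrow> 'c::real_normed_vector)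
      \<Rightarrow> ('a \<Rightarrow> 'b list \<Rightarrow> 'c) \<Rightarrow> 'a \<Rightarrow> bool" where
  "multi_differentiable n T T' x \<longleftrightarrow>
     bounded_multilinear n (T x) \<and> (\<forall>u. bounded_multilinear n (T' u)) \<and>
     (\<forall>ws. length ws = n \<longrightarrow> linear (\<lambda>u. T' u ws)) \<and>
     (\<exists>K. \<forall>u ws. length ws = n \<longrightarrow> norm (T' u ws) \<le> K * norm u * norm_prod ws) \<and>
     (\<forall>\<epsilon>>0. \<forall>\<^sub>F y in nhds x. \<forall>ws. length ws = n \<longrightarrow>
        norm (T y ws - T x ws - T' (y - x) ws) \<le> \<epsilon> * norm (y - x) * norm_prod ws)"

lemma bounded_multilinear_linear:
  "bounded_multilinear n T \<Longrightarrow> length us + length vs + 1 = n \<Longrightarrow> linear (\<lambda>v. T (us @ v # vs))"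
  unfolding bounded_multilinear_def by (drule conjunct1) simp

lemma bounded_multilinear_bound:
  assumes "bounded_multilinear n T"
  obtains C where "C \<ge> 0" "\<And>vs. length vs = n \<Longrightarrow> norm (T vs) \<le> C * norm_prod vs"
proof -
  obtain C where C: "\<And>vs. length vs = n \<Longrightarrow> norm (T vs) \<le> C * norm_prod vs"
    using assms unfolding bounded_multilinear_def by auto
  have "norm (T vs) \<le> \<bar>C\<bar> * norm_prod vs" if "length vs = n" for vs
    by (rule order_trans[OF C[OF that]]) (auto intro: mult_right_mono norm_prod_nonneg)
  then show ?thesis using that[of "\<bar>C\<bar>"] by auto
qed

lemma bounded_multilinear_Cons:
  assumes T: "bounded_multilinear (Suc n) T"
  shows "bounded_multilinear n (\<lambda>vs. T (w # vs))"
proof -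
  obtain C where "C \<ge> 0" and C: "\<And>vs. length vs = Suc n \<Longrightarrow> norm (T vs) \<le> C * norm_prod vs"
    using bounded_multilinear_bound[OF T] by blast
  have "linear (\<lambda>v. T (w # us @ v # vs))" if "length us + length vs + 1 = n" for us vs
    using bounded_multilinear_linear[OF T, of "w # us" vs] that by simp
  moreover have "norm (T (w # vs)) \<le> (C * norm w) * norm_prod vs" if "length vs = n" for vs
    using C[of "w # vs"] that by (simp add: mult_ac)
  ultimately show ?thesis unfolding bounded_multilinear_def by auto
qed

lemma bounded_multilinear_add:
  assumes "bounded_multilinear n S" "bounded_multilinear n T"
  shows "bounded_multilinear n (\<lambda>vs. S vs + T vs)"
proof -
  obtain A where A: "\<And>vs. length vs = n \<Longrightarrow> norm (S vs) \<le> A * norm_prod vs"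
    using bounded_multilinear_bound[OF assms(1)] by blast
  obtain B where B: "\<And>vs. length vs = n \<Longrightarrow> norm (T vs) \<le> B * norm_prod vs"
    using bounded_multilinear_bound[OF assms(2)] by blast
  have "norm (S vs + T vs) \<le> (A + B) * norm_prod vs" if "length vs = n" for vs
    using norm_triangle_ineq[of "S vs" "T vs"] A[OF that] B[OF that] by (simp add: algebra_simps)
  then show ?thesis
    using bounded_multilinear_linear[OF assms(1)] bounded_multilinear_linear[OF assms(2)]
    unfolding bounded_multilinear_def by (auto intro!: linear_compose_add)
qed

text \<open>
  The product rule for the evaluation of a multilinear map depending on \<open>y\<close> at a vector depending on
  \<open>y\<close>; evaluating one argument at a time, it yields the product rule for all arguments.
\<close>

lemma multi_differentiable_Cons:
  assumes T: "multi_differentiable (Suc n) T T' x"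
    and w: "(w has_derivative w') (at x)"
  shows "multi_differentiable n (\<lambda>y vs. T y (w y # vs))
           (\<lambda>u vs. T' u (w x # vs) + T x (w' u # vs)) x"
proof -
  have Tm: "bounded_multilinear (Suc n) (T x)" and Tm': "\<And>u. bounded_multilinear (Suc n) (T' u)"
    and Tl: "\<And>ws. length ws = Suc n \<Longrightarrow> linear (\<lambda>u. T' u ws)"
    and Tu: "\<And>\<epsilon>. \<epsilon> > 0 \<Longrightarrow> \<forall>\<^sub>F y in nhds x. \<forall>ws. length ws = Suc n \<longrightarrow>
        norm (T y ws - T x ws - T' (y - x) ws) \<le> \<epsilon> * norm (y - x) * norm_prod ws"
    using T unfolding multi_differentiable_def by auto
  obtain K where K: "\<And>u ws. length ws = Suc n \<Longrightarrow> norm (T' u ws) \<le> K * norm u * norm_prod ws"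
    using T unfolding multi_differentiable_def by auto
  obtain C where C0: "C \<ge> 0" and C: "\<And>vs. length vs = Suc n \<Longrightarrow> norm (T x vs) \<le> C * norm_prod vs"
    using bounded_multilinear_bound[OF Tm] by blast
  have w'lin: "linear w'" by (rule has_derivative_linear[OF w])
  obtain W where W0: "W > 0" and W: "\<And>u. norm (w' u) \<le> norm u * W"
    using bounded_linear.pos_bounded[OF has_derivative_bounded_linear[OF w]] by blast
  have Tm_lin: "linear (\<lambda>v. T x (v # vs))" if "length vs = n" for vs
    using bounded_multilinear_linear[OF Tm, of "[]" vs] that by simp
  have Tm'_lin: "linear (\<lambda>v. T' u (v # vs))" if "length vs = n" for vs u
    using bounded_multilinear_linear[OF Tm', of "[]" vs] that by simp
  show ?thesis
    unfolding multi_differentiable_def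
  proof (intro conjI allI impI)
    show "bounded_multilinear n (\<lambda>vs. T x (w x # vs))" by (rule bounded_multilinear_Cons[OF Tm])
    show "bounded_multilinear n (\<lambda>vs. T' u (w x # vs) + T x (w' u # vs))" for u
      by (intro bounded_multilinear_add bounded_multilinear_Cons Tm Tm')
  next
    fix ws :: "'b list" assume ws: "length ws = n"
    show "linear (\<lambda>u. T' u (w x # ws) + T x (w' u # ws))"
      using linear_compose_add[OF Tl[of "w x # ws"] linear_compose[OF w'lin Tm_lin[OF ws]]] ws
      by (simp add: o_def)
  next
    have "norm (T' u (w x # ws) + T x (w' u # ws)) \<le> (K * norm (w x) + C * W) * norm u * norm_prod ws"
      if ws: "length ws = n" for u ws
    proof -
      have "norm (T x (w' u # ws)) \<le> C * (norm (w' u) * norm_prod ws)"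
        using C[of "w' u # ws"] ws by simp
      also have "\<dots> \<le> C * ((norm u * W) * norm_prod ws)"
        by (intro mult_left_mono mult_right_mono W C0 norm_prod_nonneg)
      finally show ?thesis
        using norm_triangle_ineq[of "T' u (w x # ws)" "T x (w' u # ws)"] K[of "w x # ws" u] ws
        by (simp add: algebra_simps)
    qed
    then show "\<exists>K. \<forall>u ws. length ws = n \<longrightarrow>
        norm (T' u (w x # ws) + T x (w' u # ws)) \<le> K * norm u * norm_prod ws" by blast
  next
    fix \<epsilon> :: real assume \<epsilon>: "\<epsilon> > 0"
    \<comment> \<open>The error splits into three terms; \<open>a\<close>, \<open>b\<close> and \<open>c\<close> are chosen to make each at most
      a third of the permitted one.\<close>
    define M where "M = norm (w x) + 1"
    have M: "M > 0" unfolding M_def by (rule add_nonneg_pos) auto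
    define a where "a = \<epsilon> / (3 * M)"
    define b where "b = min 1 (\<epsilon> / (3 * (\<bar>K\<bar> + 1)))"
    define c where "c = \<epsilon> / (3 * (C + 1))"
    have pos: "a > 0" "b > 0" "c > 0" using \<epsilon> M C0 by (auto simp: a_def b_def c_def)
    have aM: "a * M = \<epsilon> / 3" using M by (simp add: a_def)
    have Kb: "\<bar>K\<bar> * b \<le> \<epsilon> / 3"
    proof -
      have "(\<bar>K\<bar> + 1) * b \<le> (\<bar>K\<bar> + 1) * (\<epsilon> / (3 * (\<bar>K\<bar> + 1)))"
        by (rule mult_left_mono) (auto simp: b_def)
      also have "\<dots> = \<epsilon> / 3" by (simp add: field_simps add_nonneg_eq_0_iff)
      finally show ?thesis using pos by (simp add: algebra_simps)
    qed
    have Cc: "C * c \<le> \<epsilon> / 3"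
      using C0 \<epsilon> by (simp add: c_def field_simps)
    have "(w \<longlongrightarrow> w x) (nhds x)"
      using has_derivative_continuous[OF w] by (simp add: continuous_within tendsto_at_iff_tendsto_nhds)
    then have e1: "\<forall>\<^sub>F y in nhds x. dist (w y) (w x) < b"
      using pos by (simp add: tendsto_iff)
    have e2: "\<forall>\<^sub>F y in nhds x. norm (w y - w x - w' (y - x)) \<le> c * norm (y - x)"
      using w pos(3) unfolding has_derivative_at_alt eventually_nhds_metric dist_norm by blast
    show "\<forall>\<^sub>F y in nhds x. \<forall>ws. length ws = n \<longrightarrow>
        norm (T y (w y # ws) - T x (w x # ws) - (T' (y - x) (w x # ws) + T x (w' (y - x) # ws)))
          \<le> \<epsilon> * norm (y - x) * norm_prod ws"
      using e1 e2 Tu[OF pos(1)]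
    proof eventually_elim
      case (elim y)
      show ?case
      proof (intro allI impI)
        fix ws :: "'b list" assume ws: "length ws = n"
        let ?u = "y - x"
        let ?N = "norm ?u * norm_prod ws"
        have N: "0 \<le> ?N" by (intro mult_nonneg_nonneg norm_prod_nonneg) simp
        have "norm (w y) \<le> norm (w x) + norm (w y - w x)" by norm
        also have "\<dots> \<le> M" using elim(1) by (simp add: M_def dist_norm b_def)
        finally have wy: "norm (w y) \<le> M" .
        have "norm (T y (w y # ws) - T x (w y # ws) - T' ?u (w y # ws)) \<le> (a * norm (w y)) * ?N"
          using elim(3)[rule_format, of "w y # ws"] ws by (simp add: mult_ac)
        also have "\<dots> \<le> (a * M) * ?N"
          using pos wy by (intro mult_right_mono mult_left_mono N) auto
        finally have t1: "norm (T y (w y # ws) - T x (w y # ws) - T' ?u (w y # ws)) \<le> (\<epsilon> / 3) * ?N"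
          using aM by simp
        have "norm (T' ?u ((w y - w x) # ws)) \<le> (K * norm (w y - w x)) * ?N"
          using K[of "(w y - w x) # ws" ?u] ws by (simp add: mult_ac)
        also have "\<dots> \<le> (\<bar>K\<bar> * b) * ?N"
          using elim(1) by (intro mult_right_mono mult_mono N) (auto simp: dist_norm)
        also have "\<dots> \<le> (\<epsilon> / 3) * ?N" by (intro mult_right_mono Kb N)
        finally have t2: "norm (T' ?u ((w y - w x) # ws)) \<le> (\<epsilon> / 3) * ?N" .
        have "norm (T x ((w y - w x - w' ?u) # ws)) \<le> C * (norm (w y - w x - w' ?u) * norm_prod ws)"
          using C[of "(w y - w x - w' ?u) # ws"] ws by simp
        also have "\<dots> \<le> C * ((c * norm ?u) * norm_prod ws)"
          by (intro mult_left_mono mult_right_mono elim(2) C0 norm_prod_nonneg)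
        also have "\<dots> = (C * c) * ?N" by simp
        also have "\<dots> \<le> (\<epsilon> / 3) * ?N" by (intro mult_right_mono Cc N)
        finally have t3: "norm (T x ((w y - w x - w' ?u) # ws)) \<le> (\<epsilon> / 3) * ?N" .
        have "T y (w y # ws) - T x (w x # ws) - (T' ?u (w x # ws) + T x (w' ?u # ws)) =
            (T y (w y # ws) - T x (w y # ws) - T' ?u (w y # ws)) +
            T' ?u ((w y - w x) # ws) + T x ((w y - w x - w' ?u) # ws)"
          by (simp add: linear_diff[OF Tm_lin[OF ws]] linear_diff[OF Tm'_lin[OF ws]])
        also have "norm \<dots> \<le> (\<epsilon> / 3) * ?N + (\<epsilon> / 3) * ?N + (\<epsilon> / 3) * ?N"
          by (intro norm_triangle_mono t1 t2 t3)
        finally show "norm (T y (w y # ws) - T x (w x # ws) -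
            (T' ?u (w x # ws) + T x (w' ?u # ws))) \<le> \<epsilon> * norm ?u * norm_prod ws"
          by (simp add: mult_ac)
      qed
    qed
  qed
qed

text \<open>
  All ways of adding \<open>v\<close> to one of the blocks of \<open>p\<close>, as its first element.
\<close>

primrec add_to_blocks :: "'a \<Rightarrow> 'a list list \<Rightarrow> 'a list list list" where
  "add_to_blocks v [] = []"
| "add_to_blocks v (b # p) = ((v # b) # p) # map ((#) b) (add_to_blocks v p)"

text \<open>
  The set partitions of the positions of a list, each given by the list of the sublists in its blocks.
  A new head either forms a block of its own or joins an existing block, exactly as a further
  derivative of \<open>D\<^sup>mg(f x)(D\<^sup>kf(x)(\<dots>), \<dots>)\<close> hits either \<open>D\<^sup>mg(f x)\<close> or one of the arguments.
\<close>

primrec partitions :: "'a list \<Rightarrow> 'a list list list" where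
  "partitions [] = [[]]"
| "partitions (v # vs) = concat (map (\<lambda>p. ([v] # p) # add_to_blocks v p) (partitions vs))"

text \<open>
  The last sum runs over the arguments hit by the derivative, since prefixing \<open>v\<close> to a block \<open>b\<close>
  differentiates \<open>F b\<close>.
\<close>

lemma has_derivative_multi:
  assumes "multi_differentiable (length p) T T' x"
    and F: "\<And>b. (F b has_derivative (\<lambda>v. F (v # b) x)) (at x)"
  shows "((\<lambda>y. T y (map (\<lambda>b. F b y) p)) has_derivative
     (\<lambda>v. T' v (map (\<lambda>b. F b x) p) +
       (\<Sum>q\<leftarrow>add_to_blocks v p. T x (map (\<lambda>b. F b x) q)))) (at x)"
  using assms(1)
proof (induction p arbitrary: T T')
  case Nil
  have l: "linear (\<lambda>u. T' u [])" and "\<exists>K. \<forall>u. norm (T' u []) \<le> K * norm u"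
    and u: "\<And>\<epsilon>. \<epsilon> > 0 \<Longrightarrow>
      \<forall>\<^sub>F y in nhds x. norm (T y [] - T x [] - T' (y - x) []) \<le> \<epsilon> * norm (y - x)"
    using Nil unfolding multi_differentiable_def by auto
  then obtain K where K: "\<And>u. norm (T' u []) \<le> norm u * K" by (auto simp: mult.commute)
  have "((\<lambda>y. T y []) has_derivative (\<lambda>v. T' v [])) (at x)"
    unfolding has_derivative_at_alt
    using u K linear_add[OF l] linear_scale[OF l]
    by (auto simp: eventually_nhds_metric dist_norm intro!: bounded_linear_intro[where K = K])
  then show ?case by simp
next
  case (Cons b p)
  from Cons.prems have "multi_differentiable (Suc (length p)) T T' x" by simp
  from Cons.IH[OF multi_differentiable_Cons[OF this F[of b]]]
  show ?case by (simp add: o_def add.assoc)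
qed

lemma norm_sum_list_le: "norm (\<Sum>x\<leftarrow>xs. f x) \<le> (\<Sum>x\<leftarrow>xs. norm (f x))"
  by (induction xs) (auto intro: norm_triangle_mono)

lemma has_derivative_sum_list:
  "(\<And>p. (f p has_derivative f' p) F) \<Longrightarrow>
    ((\<lambda>x. \<Sum>p\<leftarrow>ps. f p x) has_derivative (\<lambda>v. \<Sum>p\<leftarrow>ps. f' p v)) F"
  by (induction ps) (auto intro: has_derivative_add)

lemma add_to_blocks_length: "length (add_to_blocks v p) = length p"
  by (induction p) auto

lemma add_to_blocksD:
  "q \<in> set (add_to_blocks v p) \<Longrightarrow> \<exists>p1 b p2. p = p1 @ b # p2 \<and> q = p1 @ (v # b) # p2"
proof (induction p arbitrary: q)
  case (Cons c p)
  then consider "q = (v # c) # p" | q' where "q' \<in> set (add_to_blocks v p)" "q = c # q'"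
    by auto
  then show ?case
  proof cases
    case 1
    then show ?thesis by (intro exI[of _ "[]"] exI[of _ c] exI[of _ p]) auto
  next
    case 2
    from Cons.IH[OF 2(1)] obtain p1 b p2 where "p = p1 @ b # p2" "q' = p1 @ (v # b) # p2"
      by blast
    with 2 have "c # p = (c # p1) @ b # p2" "q = (c # p1) @ (v # b) # p2" by auto
    then show ?thesis by blast
  qed
qed simp

lemma partitions_ConsE:
  assumes "p \<in> set (partitions (v # vs))"
  obtains (new) p' where "p' \<in> set (partitions vs)" "p = [v] # p'"
    | (old) p1 b p2 where "p1 @ b # p2 \<in> set (partitions vs)" "p = p1 @ (v # b) # p2"
proof -
  from assms obtain p' where p': "p' \<in> set (partitions vs)"
    and "p = [v] # p' \<or> p \<in> set (add_to_blocks v p')" by auto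
  then show ?thesis using new old add_to_blocksD[of p v p'] by blast
qed

lemma length_partition: "p \<in> set (partitions vs) \<Longrightarrow> length p \<le> length vs"
proof (induction vs arbitrary: p)
  case (Cons v vs)
  from Cons.prems show ?case by (rule partitions_ConsE) (auto dest: Cons.IH)
qed simp

lemma length_block: "p \<in> set (partitions vs) \<Longrightarrow> b \<in> set p \<Longrightarrow> length b \<le> length vs"
proof (induction vs arbitrary: p b)
  case (Cons v vs)
  from Cons.prems(1) show ?case
  proof (cases rule: partitions_ConsE)
    case (new p')
    then show ?thesis using Cons.prems(2) Cons.IH[OF new(1), of b] by auto
  next
    case (old p1 c p2)
    then show ?thesis
      using Cons.prems(2) Cons.IH[OF old(1), of b] Cons.IH[OF old(1), of c] by auto
  qed
qed simp

lemma norm_prod_partition: "p \<in> set (partitions vs) \<Longrightarrow> (\<Prod>b\<leftarrow>p. norm_prod b) = norm_prod vs"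
proof (induction vs arbitrary: p)
  case (Cons v vs)
  from Cons.prems show ?case
    by (rule partitions_ConsE) (auto dest!: Cons.IH simp flip: Cons.IH)
qed simp

lemma length_partitions: "length (partitions vs) \<le> fact (length vs)"
proof (induction vs)
  case (Cons v vs)
  have "length (partitions (v # vs)) = (\<Sum>p\<leftarrow>partitions vs. Suc (length p))"
    by (simp add: length_concat o_def add_to_blocks_length)
  also have "\<dots> \<le> (\<Sum>p\<leftarrow>partitions vs. Suc (length vs))"
    by (rule sum_list_mono) (simp add: length_partition)
  also have "\<dots> = length (partitions vs) * Suc (length vs)" by (simp add: sum_list_triv)
  also have "\<dots> \<le> fact (length vs) * Suc (length vs)" by (rule mult_right_mono[OF Cons.IH]) simp
  also have "\<dots> = fact (length (v # vs))" by (simp add: mult.commute)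
  finally show ?case .
qed simp

lemma tower_bound_upto:
  assumes D: "derivative_tower S f D" and x: "x \<in> S"
  shows "\<exists>C\<ge>1. \<forall>\<^sub>F y in nhds x. \<forall>vs. length vs \<le> k \<longrightarrow> norm (D vs y) \<le> C * norm_prod vs"
proof (induction k)
  case 0
  obtain C where "\<forall>\<^sub>F y in nhds x. \<forall>vs. length vs = 0 \<longrightarrow> norm (D vs y) \<le> C * norm_prod vs"
    using derivative_towerD(4)[OF D x] by blast
  then have "\<forall>\<^sub>F y in nhds x. \<forall>vs. length vs \<le> 0 \<longrightarrow> norm (D vs y) \<le> max C 1 * norm_prod vs"
    by eventually_elim auto
  then show ?case by (intro exI[of _ "max C 1"]) auto
next
  case (Suc k)
  obtain A where A: "A \<ge> 1"
    "\<forall>\<^sub>F y in nhds x. \<forall>vs. length vs \<le> k \<longrightarrow> norm (D vs y) \<le> A * norm_prod vs"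
    using Suc.IH by blast
  obtain B where B: "\<forall>\<^sub>F y in nhds x. \<forall>vs. length vs = Suc k \<longrightarrow> norm (D vs y) \<le> B * norm_prod vs"
    using derivative_towerD(4)[OF D x] by blast
  have "\<forall>\<^sub>F y in nhds x. \<forall>vs. length vs \<le> Suc k \<longrightarrow> norm (D vs y) \<le> max A B * norm_prod vs"
    using A(2) B
  proof eventually_elim
    case (elim y)
    show ?case
    proof (intro allI impI)
      fix vs :: "'a list" assume "length vs \<le> Suc k"
      then have "norm (D vs y) \<le> A * norm_prod vs \<or> norm (D vs y) \<le> B * norm_prod vs"
        using elim by (auto simp: le_Suc_eq)
      moreover have "A * norm_prod vs \<le> max A B * norm_prod vs" "B * norm_prod vs \<le> max A B * norm_prod vs"
        by (intro mult_right_mono norm_prod_nonneg; simp)+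
      ultimately show "norm (D vs y) \<le> max A B * norm_prod vs" by linarith
    qed
  qed
  then show ?case using A(1) by (intro exI[of _ "max A B"]) auto
qed

lemma norm_prod_map_le:
  assumes "\<And>b. b \<in> set p \<Longrightarrow> norm (F b) \<le> A * norm_prod b"
  shows "norm_prod (map F p) \<le> A ^ length p * (\<Prod>b\<leftarrow>p. norm_prod b)"
  using assms
proof (induction p)
  case (Cons b p)
  have b: "norm (F b) \<le> A * norm_prod b" by (rule Cons.prems) simp
  have "norm (F b) * norm_prod (map F p) \<le>
      (A * norm_prod b) * (A ^ length p * (\<Prod>b\<leftarrow>p. norm_prod b))"
  proof (rule mult_mono[OF b])
    show "norm_prod (map F p) \<le> A ^ length p * (\<Prod>b\<leftarrow>p. norm_prod b)"
      by (rule Cons.IH) (simp add: Cons.prems)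
    show "0 \<le> A * norm_prod b" using b norm_ge_zero order_trans by blast
  qed (rule norm_prod_nonneg)
  then show ?case by (simp add: mult_ac)
qed simp

text \<open>
  The iterated derivatives of \<open>g \<circ> f\<close> are given by the formula of Faa di Bruno, as sums over
  set partitions.
\<close>

lemma smooth_on_compose:
  assumes f: "smooth_on S f" and g: "smooth_on R g" and fS: "f ` S \<subseteq> R"
  shows "smooth_on S (\<lambda>x. g (f x))"
proof -
  obtain D where D: "derivative_tower S f D" using tower_if_smooth_on[OF f] .
  obtain E where E: "derivative_tower R g E" using tower_if_smooth_on[OF g] .
  note der = derivative_towerD(3)[OF D] and opn = derivative_towerD(1)[OF D]
  define F where "F vs x = (\<Sum>p\<leftarrow>partitions vs. E (map (\<lambda>b. D b x) p) (f x))" for vs x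
  have fder: "(f has_derivative (\<lambda>v. D [v] x)) (at x)" if x: "x \<in> S" for x
    by (rule has_derivative_transform_within_open[OF der[OF x, of "[]"] opn x])
      (simp add: derivative_towerD(2)[OF D])
  have flim: "(f \<longlongrightarrow> f x) (nhds x)" if x: "x \<in> S" for x
    using has_derivative_continuous[OF fder[OF x]]
    by (simp add: continuous_within tendsto_at_iff_tendsto_nhds)
  \<comment> \<open>The chain rule for \<open>y \<mapsto> D\<^sup>ng(f y)\<close>, in the operator norm.\<close>
  have outer: "multi_differentiable n (\<lambda>y ws. E ws (f y)) (\<lambda>u ws. E (D [u] x # ws) (f x)) x"
    if x: "x \<in> S" for x n
  proof -
    have fx: "f x \<in> R" using x fS by blast
    have Em: "bounded_multilinear k (\<lambda>ws. E ws (f x))" for k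
      by (rule derivative_tower_multilinear[OF E fx])
    have Dl: "linear (\<lambda>u. D [u] x)" by (rule has_derivative_linear[OF fder[OF x]])
    obtain W where W0: "W > 0" and W: "\<And>u. norm (D [u] x) \<le> norm u * W"
      using bounded_linear.pos_bounded[OF has_derivative_bounded_linear[OF fder[OF x]]] by blast
    obtain C where C0: "C \<ge> 0"
      and C: "\<And>vs. length vs = Suc n \<Longrightarrow> norm (E vs (f x)) \<le> C * norm_prod vs"
      using bounded_multilinear_bound[OF Em] by blast
    have Elin: "linear (\<lambda>z. E (z # ws) (f x))" for ws
      using derivative_tower_linear[OF E fx, of "[]"] by simp
    show ?thesis
      unfolding multi_differentiable_def
    proof (intro conjI allI impI)
      show "bounded_multilinear n (\<lambda>ws. E (D [u] x # ws) (f x))" for u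
        by (rule bounded_multilinear_Cons[OF Em])
      show "linear (\<lambda>u. E (D [u] x # ws) (f x))" for ws
        using linear_compose[OF Dl Elin] by (simp add: o_def)
      have "norm (E (D [u] x # ws) (f x)) \<le> (C * W) * norm u * norm_prod ws" if "length ws = n" for u ws
      proof -
        have "norm (E (D [u] x # ws) (f x)) \<le> C * (norm (D [u] x) * norm_prod ws)"
          using C[of "D [u] x # ws"] that by simp
        also have "\<dots> \<le> C * ((norm u * W) * norm_prod ws)"
          by (intro mult_left_mono mult_right_mono W C0 norm_prod_nonneg)
        finally show ?thesis by (simp add: mult_ac)
      qed
      then show "\<exists>K. \<forall>u ws. length ws = n \<longrightarrow>
          norm (E (D [u] x # ws) (f x)) \<le> K * norm u * norm_prod ws" by blast
    next
      fix \<epsilon> :: real assume \<epsilon>: "\<epsilon> > 0"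
      define a where "a = \<epsilon> / (2 * (W + 1))"
      define c where "c = min 1 (\<epsilon> / (2 * (C + 1)))"
      have pos: "a > 0" "c > 0" using \<epsilon> W0 C0 by (auto simp: a_def c_def)
      have aW: "a * (W + 1) = \<epsilon> / 2" using W0 by (simp add: a_def field_simps)
      have Cc: "C * c \<le> \<epsilon> / 2"
      proof -
        have "C * c \<le> C * (\<epsilon> / (2 * (C + 1)))" using C0 by (intro mult_left_mono) (auto simp: c_def)
        also have "\<dots> \<le> \<epsilon> / 2" using C0 \<epsilon> by (simp add: field_simps)
        finally show ?thesis .
      qed
      have e1: "\<forall>\<^sub>F y in nhds x. norm (f y - f x - D [y - x] x) \<le> c * norm (y - x)"
        using fder[OF x] pos(2) unfolding has_derivative_at_alt eventually_nhds_metric dist_norm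
        by blast
      have e2: "\<forall>\<^sub>F y in nhds x. \<forall>ws. length ws = n \<longrightarrow>
          norm (E ws (f y) - E ws (f x) - E ((f y - f x) # ws) (f x))
            \<le> a * norm (f y - f x) * norm_prod ws"
        using eventually_compose_filterlim[OF derivative_tower_uniform[OF E fx pos(1)] flim[OF x]] .
      show "\<forall>\<^sub>F y in nhds x. \<forall>ws. length ws = n \<longrightarrow>
          norm (E ws (f y) - E ws (f x) - E (D [y - x] x # ws) (f x))
            \<le> \<epsilon> * norm (y - x) * norm_prod ws"
        using e1 e2
      proof eventually_elim
        case (elim y)
        show ?case
        proof (intro allI impI)
          fix ws :: "'b list" assume ws: "length ws = n"
          let ?u = "y - x"
          let ?N = "norm ?u * norm_prod ws"
          have N: "0 \<le> ?N" by (intro mult_nonneg_nonneg norm_prod_nonneg) simp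
          have "c * norm ?u \<le> 1 * norm ?u" by (intro mult_right_mono) (auto simp: c_def)
          moreover have "norm (f y - f x) \<le> norm (f y - f x - D [?u] x) + norm (D [?u] x)" by norm
          ultimately have "norm (f y - f x) \<le> (W + 1) * norm ?u"
            using elim(1) W[of ?u] by (simp add: algebra_simps)
          then have "a * norm (f y - f x) * norm_prod ws \<le> a * ((W + 1) * norm ?u) * norm_prod ws"
            using pos by (intro mult_left_mono mult_right_mono norm_prod_nonneg) auto
          also have "\<dots> = (a * (W + 1)) * ?N" by (simp add: mult_ac)
          finally have t1: "norm (E ws (f y) - E ws (f x) - E ((f y - f x) # ws) (f x)) \<le> \<epsilon> / 2 * ?N"
            using elim(2)[rule_format, OF ws] aW by simp
          have "norm (E ((f y - f x - D [?u] x) # ws) (f x)) \<le>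
              C * (norm (f y - f x - D [?u] x) * norm_prod ws)"
            using C[of "(f y - f x - D [?u] x) # ws"] ws by simp
          also have "\<dots> \<le> C * ((c * norm ?u) * norm_prod ws)"
            by (intro mult_left_mono mult_right_mono elim(1) C0 norm_prod_nonneg)
          also have "\<dots> = (C * c) * ?N" by simp
          also have "\<dots> \<le> \<epsilon> / 2 * ?N" by (intro mult_right_mono Cc N)
          finally have t2: "norm (E ((f y - f x - D [?u] x) # ws) (f x)) \<le> \<epsilon> / 2 * ?N" .
          have "E ws (f y) - E ws (f x) - E (D [?u] x # ws) (f x) =
              (E ws (f y) - E ws (f x) - E ((f y - f x) # ws) (f x)) +
              E ((f y - f x - D [?u] x) # ws) (f x)"
            by (simp add: linear_diff[OF Elin])
          also have "norm \<dots> \<le> \<epsilon> / 2 * ?N + \<epsilon> / 2 * ?N"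
            by (intro norm_triangle_mono t1 t2)
          finally show "norm (E ws (f y) - E ws (f x) - E (D [?u] x # ws) (f x))
              \<le> \<epsilon> * norm ?u * norm_prod ws" by (simp add: mult_ac)
        qed
      qed
    qed (rule Em)
  qed
  have "derivative_tower S (\<lambda>x. g (f x)) F"
    unfolding derivative_tower_def
  proof (intro conjI ballI allI)
    show "F [] x = g (f x)" if "x \<in> S" for x
      using that fS derivative_towerD(2)[OF E, of "f x"] by (auto simp: F_def)
  next
    fix x vs assume x: "x \<in> S"
    have "(F vs has_derivative (\<lambda>v. \<Sum>p\<leftarrow>partitions vs. E (D [v] x # map (\<lambda>b. D b x) p) (f x) +
        (\<Sum>q\<leftarrow>add_to_blocks v p. E (map (\<lambda>b. D b x) q) (f x)))) (at x)"
      unfolding F_def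
      by (rule has_derivative_sum_list[OF has_derivative_multi[OF outer[OF x] der[OF x]]])
    \<comment> \<open>Regrouping the terms gives the recursion defining \<open>partitions\<close>.\<close>
    moreover have "(\<Sum>p\<leftarrow>ps. E (D [v] x # map (\<lambda>b. D b x) p) (f x) +
        (\<Sum>q\<leftarrow>add_to_blocks v p. E (map (\<lambda>b. D b x) q) (f x))) =
        (\<Sum>p\<leftarrow>concat (map (\<lambda>p. ([v] # p) # add_to_blocks v p) ps). E (map (\<lambda>b. D b x) p) (f x))"
      for ps v by (induction ps) (auto simp: add.assoc)
    ultimately show "(F vs has_derivative (\<lambda>v. F (v # vs) x)) (at x)"
      by (simp add: F_def)
  next
    fix x k assume x: "x \<in> S"
    have fx: "f x \<in> R" using x fS by blast
    obtain A where A: "A \<ge> 1"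
      "\<forall>\<^sub>F y in nhds x. \<forall>vs. length vs \<le> k \<longrightarrow> norm (D vs y) \<le> A * norm_prod vs"
      using tower_bound_upto[OF D x] by blast
    obtain B where B: "B \<ge> 1"
      "\<forall>\<^sub>F z in nhds (f x). \<forall>vs. length vs \<le> k \<longrightarrow> norm (E vs z) \<le> B * norm_prod vs"
      using tower_bound_upto[OF E fx] by blast
    from eventually_compose_filterlim[OF B(2) flim[OF x]] A(2)
    have "\<forall>\<^sub>F y in nhds x. \<forall>vs. length vs = k \<longrightarrow> norm (F vs y) \<le> (fact k * (B * A ^ k)) * norm_prod vs"
    proof eventually_elim
      case (elim y)
      show ?case
      proof (intro allI impI)
        fix vs :: "'a list" assume vs: "length vs = k"
        have "norm (E (map (\<lambda>b. D b y) p) (f y)) \<le> B * A ^ k * norm_prod vs"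
          if p: "p \<in> set (partitions vs)" for p
        proof -
          have lp: "length p \<le> k" using length_partition[OF p] vs by simp
          have "norm_prod (map (\<lambda>b. D b y) p) \<le> A ^ length p * (\<Prod>b\<leftarrow>p. norm_prod b)"
          proof (rule norm_prod_map_le)
            fix b assume "b \<in> set p"
            from length_block[OF p this] elim(2) vs show "norm (D b y) \<le> A * norm_prod b" by blast
          qed
          also have "\<dots> \<le> A ^ k * norm_prod vs"
            unfolding norm_prod_partition[OF p]
            using A(1) lp by (intro mult_right_mono power_increasing norm_prod_nonneg) auto
          finally have "B * norm_prod (map (\<lambda>b. D b y) p) \<le> B * (A ^ k * norm_prod vs)"
            using B(1) by (intro mult_left_mono) auto
          moreover have "norm (E (map (\<lambda>b. D b y) p) (f y)) \<le> B * norm_prod (map (\<lambda>b. D b y) p)"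
            using elim(1)[rule_format, of "map (\<lambda>b. D b y) p"] lp by simp
          ultimately show ?thesis by simp
        qed
        then have "norm (F vs y) \<le> (\<Sum>p\<leftarrow>partitions vs. B * A ^ k * norm_prod vs)"
          unfolding F_def
          by (intro order_trans[OF norm_sum_list_le] sum_list_mono)
        also have "\<dots> = of_nat (length (partitions vs)) * (B * A ^ k * norm_prod vs)"
          by (simp add: sum_list_triv)
        also have "\<dots> \<le> fact k * (B * A ^ k * norm_prod vs)"
        proof (rule mult_right_mono)
          show "real (length (partitions vs)) \<le> fact k"
            using length_partitions[of vs] vs by (metis of_nat_fact of_nat_le_iff)
          show "0 \<le> B * A ^ k * norm_prod vs"
            using A B by (intro mult_nonneg_nonneg norm_prod_nonneg) auto
        qed
        finally show "norm (F vs y) \<le> (fact k * (B * A ^ k)) * norm_prod vs" by (simp add: mult_ac)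
      qed
    qed
    then show "\<exists>C. \<forall>\<^sub>F y in nhds x. \<forall>vs. length vs = k \<longrightarrow> norm (F vs y) \<le> C * norm_prod vs" by blast
  qed (rule opn)
  then show ?thesis by (rule smooth_on_if_tower)
qed

section \<open>Smooth maps of manifolds\<close>

lemma smooth_on_open_preimage:
  "smooth_on S f \<Longrightarrow> open T \<Longrightarrow> open (S \<inter> f -` T)"
  by (metis continuous_open_preimage smooth_on_continuous smooth_on_open)

lemma manifoldD:
  assumes "manifold A" "(U, \<phi>) \<in> A"
  shows "inj_on \<phi> U" "open (\<phi> ` U)"
    "(V, \<psi>) \<in> A \<Longrightarrow> smooth_on (\<phi> ` (U \<inter> V)) (\<lambda>z. \<psi> (inv_into U \<phi> z))"
  using assms unfolding manifold_def by (fastforce simp: o_def)+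

lemma ptsE:
  assumes "p \<in> pts A"
  obtains U \<phi> where "(U, \<phi>) \<in> A" "p \<in> U"
  using assms unfolding pts_def by auto

lemma ptsI: "(U, \<phi>) \<in> A \<Longrightarrow> p \<in> U \<Longrightarrow> p \<in> pts A"
  unfolding pts_def by auto

lemma open_inD: "open_in A W \<Longrightarrow> (U, \<phi>) \<in> A \<Longrightarrow> open (\<phi> ` (U \<inter> W))"
  unfolding open_in_def by auto

lemma open_in_pts: "manifold A \<Longrightarrow> open_in A (pts A)"
proof -
  have "U \<inter> pts A = U" if "(U, \<phi>) \<in> A" for U \<phi> using that unfolding pts_def by auto
  then show "manifold A \<Longrightarrow> open_in A (pts A)"
    unfolding open_in_def using manifoldD(2) by fastforce
qed

text \<open>
  The representative of \<open>f\<close> in the charts \<open>(U, \<phi>)\<close> and \<open>(V, \<psi>)\<close> is defined and smooth on a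
  neighbourhood of \<open>\<phi> p\<close>.
\<close>

definition smooth_in_charts ::
    "'m set \<Rightarrow> ('m \<Rightarrow> 'e::banach) \<Rightarrow> 'n set \<Rightarrow> ('n \<Rightarrow> 'f::banach) \<Rightarrow> ('m \<Rightarrow> 'n) \<Rightarrow> 'm \<Rightarrow> bool" where
  "smooth_in_charts U \<phi> V \<psi> f p \<longleftrightarrow> p \<in> U \<and>
     (\<exists>N. \<phi> p \<in> N \<and> N \<subseteq> \<phi> ` U \<and> (\<forall>z\<in>N. f (inv_into U \<phi> z) \<in> V) \<and>
       smooth_on N (\<lambda>z. \<psi> (f (inv_into U \<phi> z))))"

text \<open>
  Smoothness of \<open>f\<close> near \<open>p\<close>, tested in one pair of charts; by \<open>smooth_in_charts_change\<close> the
  choice of charts around \<open>p\<close> and \<open>f p\<close> is immaterial.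
\<close>

definition smooth_map_at ::
    "('m, 'e::banach) atlas \<Rightarrow> ('n, 'f::banach) atlas \<Rightarrow> ('m \<Rightarrow> 'n) \<Rightarrow> 'm \<Rightarrow> bool" where
  "smooth_map_at A B f p \<longleftrightarrow>
     (\<exists>U \<phi> V \<psi>. (U, \<phi>) \<in> A \<and> (V, \<psi>) \<in> B \<and> smooth_in_charts U \<phi> V \<psi> f p)"

lemma smooth_in_charts_change:
  assumes mA: "manifold A" and mB: "manifold B"
    and ch: "(U, \<phi>) \<in> A" "(U', \<phi>') \<in> A" "(V, \<psi>) \<in> B" "(V', \<psi>') \<in> B"
    and f: "smooth_in_charts U \<phi> V \<psi> f p" and p: "p \<in> U'" and fp: "f p \<in> V'"
  shows "smooth_in_charts U' \<phi>' V' \<psi>' f p"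
proof -
  note injs = manifoldD(1)[OF mA ch(1)] manifoldD(1)[OF mA ch(2)]
    manifoldD(1)[OF mB ch(3)] manifoldD(1)[OF mB ch(4)]
  obtain N where N: "\<phi> p \<in> N" "N \<subseteq> \<phi> ` U" "\<And>z. z \<in> N \<Longrightarrow> f (inv_into U \<phi> z) \<in> V"
    and sN: "smooth_on N (\<lambda>z. \<psi> (f (inv_into U \<phi> z)))" and pU: "p \<in> U"
    using f unfolding smooth_in_charts_def by blast
  define \<tau> where "\<tau> z = \<phi> (inv_into U' \<phi>' z)" for z
  define M where "M = \<phi>' ` (U' \<inter> U)"
  have s\<tau>: "smooth_on M \<tau>"
    unfolding M_def \<tau>_def by (rule manifoldD(3)[OF mA ch(2,1)])
  have inv\<tau>: "inv_into U \<phi> (\<tau> z) = inv_into U' \<phi>' z" "inv_into U' \<phi>' z \<in> U" if "z \<in> M" for z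
    using that injs unfolding M_def \<tau>_def by auto
  define N1 where "N1 = M \<inter> \<tau> -` N"
  have oN1: "open N1"
    unfolding N1_def by (rule smooth_on_open_preimage[OF s\<tau> smooth_on_open[OF sN]])
  define k where "k z = \<psi> (f (inv_into U \<phi> (\<tau> z)))" for z
  have sk: "smooth_on N1 k"
    unfolding k_def
    by (rule smooth_on_compose[OF smooth_on_subset[OF s\<tau> oN1] sN]) (auto simp: N1_def)
  define L where "L = \<psi> ` (V \<inter> V')"
  have s\<sigma>: "smooth_on L (\<lambda>z. \<psi>' (inv_into V \<psi> z))"
    unfolding L_def by (rule manifoldD(3)[OF mB ch(3,4)])
  define N2 where "N2 = N1 \<inter> k -` L"
  have oN2: "open N2"
    unfolding N2_def by (rule smooth_on_open_preimage[OF sk smooth_on_open[OF s\<sigma>]])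
  have inV: "f (inv_into U' \<phi>' z) \<in> V \<and> f (inv_into U' \<phi>' z) \<in> V'" if "z \<in> N2" for z
  proof -
    have zM: "z \<in> M" and "\<tau> z \<in> N" and kz: "k z \<in> L" using that by (auto simp: N2_def N1_def)
    then have v: "f (inv_into U' \<phi>' z) \<in> V" using N(3) inv\<tau> by metis
    from kz obtain w where w: "w \<in> V" "w \<in> V'" "\<psi> (f (inv_into U' \<phi>' z)) = \<psi> w"
      unfolding L_def k_def inv\<tau>[OF zM] by auto
    with v have "f (inv_into U' \<phi>' z) = w" using injs(3) by (auto dest: inj_onD)
    with v w show ?thesis by simp
  qed
  have "smooth_on N2 (\<lambda>z. \<psi>' (inv_into V \<psi> (k z)))"
    by (rule smooth_on_compose[OF smooth_on_subset[OF sk oN2] s\<sigma>]) (auto simp: N2_def)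
  then have "smooth_on N2 (\<lambda>z. \<psi>' (f (inv_into U' \<phi>' z)))"
  proof (rule smooth_on_cong)
    fix z assume z: "z \<in> N2"
    then have "z \<in> M" by (auto simp: N2_def N1_def)
    then show "\<psi>' (inv_into V \<psi> (k z)) = \<psi>' (f (inv_into U' \<phi>' z))"
      using inV[OF z] injs(3) by (simp add: k_def inv\<tau>)
  qed
  moreover have "\<phi>' p \<in> N2"
  proof -
    have M: "\<phi>' p \<in> M" using pU p unfolding M_def by blast
    have \<tau>p: "\<tau> (\<phi>' p) = \<phi> p" using p injs by (simp add: \<tau>_def)
    have "k (\<phi>' p) = \<psi> (f p)" using p injs inv\<tau>(1)[OF M] by (simp add: k_def)
    moreover have "f p \<in> V" using N(3)[OF N(1)] pU injs by simp
    ultimately have "k (\<phi>' p) \<in> L" using fp by (auto simp: L_def)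
    with M \<tau>p N(1) show ?thesis by (simp add: N2_def N1_def)
  qed
  moreover have "N2 \<subseteq> \<phi>' ` U'" by (auto simp: N2_def N1_def M_def)
  ultimately show ?thesis
    unfolding smooth_in_charts_def using p inV by blast
qed

lemma smooth_map_at_in_charts:
  assumes "manifold A" "manifold B" "smooth_map_at A B f p"
    and "(U, \<phi>) \<in> A" "p \<in> U" "(V, \<psi>) \<in> B" "f p \<in> V"
  shows "smooth_in_charts U \<phi> V \<psi> f p"
proof -
  obtain U' \<phi>' V' \<psi>' where "(U', \<phi>') \<in> A" "(V', \<psi>') \<in> B" "smooth_in_charts U' \<phi>' V' \<psi>' f p"
    using assms(3) unfolding smooth_map_at_def by blast
  from smooth_in_charts_change[OF assms(1,2) this(1) assms(4) this(2) assms(6) this(3) assms(5,7)]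
  show ?thesis .
qed

lemma smooth_map_atD:
  assumes "manifold A" "smooth_map_at A B f p"
  shows "p \<in> pts A" "f p \<in> pts B"
proof -
  obtain U \<phi> V \<psi> N where *: "(U, \<phi>) \<in> A" "(V, \<psi>) \<in> B" "p \<in> U" "\<phi> p \<in> N"
    "\<forall>z\<in>N. f (inv_into U \<phi> z) \<in> V"
    using assms(2) unfolding smooth_map_at_def smooth_in_charts_def by blast
  then have "f p \<in> V" using manifoldD(1)[OF assms(1) *(1)] by force
  then show "p \<in> pts A" "f p \<in> pts B" using * by (auto intro: ptsI)
qed

lemma smooth_map_iff:
  assumes mA: "manifold A" and mB: "manifold B"
  shows "smooth_map A W B f \<longleftrightarrow> open_in A W \<and> (\<forall>p\<in>W. smooth_map_at A B f p)"
proof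
  assume f: "smooth_map A W B f"
  then have W: "open_in A W" and img: "f ` W \<subseteq> pts B"
    and sm: "\<And>U \<phi> V \<psi>. (U, \<phi>) \<in> A \<Longrightarrow> (V, \<psi>) \<in> B \<Longrightarrow>
        smooth_on (\<phi> ` (U \<inter> W \<inter> f -` V)) (\<lambda>z. \<psi> (f (inv_into U \<phi> z)))"
    unfolding smooth_map_def by (auto simp: o_def split: prod.splits)
  have "smooth_map_at A B f p" if p: "p \<in> W" for p
  proof -
    have "p \<in> pts A" "f p \<in> pts B" using W p img unfolding open_in_def by auto
    then obtain U \<phi> V \<psi> where U: "(U, \<phi>) \<in> A" "p \<in> U" and V: "(V, \<psi>) \<in> B" "f p \<in> V"
      by (elim ptsE)
    have "\<forall>z\<in>\<phi> ` (U \<inter> W \<inter> f -` V). f (inv_into U \<phi> z) \<in> V"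
      using manifoldD(1)[OF mA U(1)] by auto
    then have "smooth_in_charts U \<phi> V \<psi> f p"
      unfolding smooth_in_charts_def using sm[OF U(1) V(1)] U V p
      by (intro conjI exI[of _ "\<phi> ` (U \<inter> W \<inter> f -` V)"]) auto
    then show ?thesis unfolding smooth_map_at_def using U V by blast
  qed
  with W show "open_in A W \<and> (\<forall>p\<in>W. smooth_map_at A B f p)" by blast
next
  assume *: "open_in A W \<and> (\<forall>p\<in>W. smooth_map_at A B f p)"
  then have W: "open_in A W" and at: "\<And>p. p \<in> W \<Longrightarrow> smooth_map_at A B f p" by auto
  have "smooth_on (\<phi> ` (U \<inter> W \<inter> f -` V)) (\<lambda>z. \<psi> (f (inv_into U \<phi> z)))"
    if U: "(U, \<phi>) \<in> A" and V: "(V, \<psi>) \<in> B" for U \<phi> V \<psi>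
  proof (rule smooth_on_local)
    note inj = manifoldD(1)[OF mA U]
    fix z assume "z \<in> \<phi> ` (U \<inter> W \<inter> f -` V)"
    then obtain p where p: "p \<in> U" "p \<in> W" "f p \<in> V" "z = \<phi> p" by blast
    obtain N where N: "\<phi> p \<in> N" "N \<subseteq> \<phi> ` U" "\<forall>z\<in>N. f (inv_into U \<phi> z) \<in> V"
      "smooth_on N (\<lambda>z. \<psi> (f (inv_into U \<phi> z)))"
      using smooth_map_at_in_charts[OF mA mB at[OF p(2)] U p(1) V p(3)]
      unfolding smooth_in_charts_def by blast
    have "N \<inter> \<phi> ` (U \<inter> W) \<subseteq> \<phi> ` (U \<inter> W \<inter> f -` V)"
      using N(3) inj by auto
    moreover have "smooth_on (N \<inter> \<phi> ` (U \<inter> W)) (\<lambda>z. \<psi> (f (inv_into U \<phi> z)))"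
      by (rule smooth_on_subset[OF N(4)]) (use smooth_on_open[OF N(4)] open_inD[OF W U] in auto)
    moreover have "z \<in> N \<inter> \<phi> ` (U \<inter> W)" using N(1) p by auto
    ultimately show "\<exists>M. z \<in> M \<and> M \<subseteq> \<phi> ` (U \<inter> W \<inter> f -` V) \<and>
        smooth_on M (\<lambda>z. \<psi> (f (inv_into U \<phi> z)))"
      by (intro exI[of _ "N \<inter> \<phi> ` (U \<inter> W)"] conjI)
  qed
  moreover have "f ` W \<subseteq> pts B" using smooth_map_atD(2)[OF mA at] by auto
  ultimately show "smooth_map A W B f"
    unfolding smooth_map_def using W by (auto simp: o_def)
qed

lemma smooth_map_at_cong:
  assumes mA: "manifold A" and f: "smooth_map_at A B f p"
    and W: "open_in A W" "p \<in> W" and eq: "\<And>q. q \<in> W \<Longrightarrow> f q = g q"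
  shows "smooth_map_at A B g p"
proof -
  obtain U \<phi> V \<psi> N where ch: "(U, \<phi>) \<in> A" "(V, \<psi>) \<in> B" "p \<in> U"
    and N: "\<phi> p \<in> N" "N \<subseteq> \<phi> ` U" "\<forall>z\<in>N. f (inv_into U \<phi> z) \<in> V"
      "smooth_on N (\<lambda>z. \<psi> (f (inv_into U \<phi> z)))"
    using f unfolding smooth_map_at_def smooth_in_charts_def by blast
  note inj = manifoldD(1)[OF mA ch(1)]
  let ?N = "N \<inter> \<phi> ` (U \<inter> W)"
  have eq': "f (inv_into U \<phi> z) = g (inv_into U \<phi> z)" if "z \<in> ?N" for z
    using that inj by (auto intro: eq)
  have "smooth_on ?N (\<lambda>z. \<psi> (f (inv_into U \<phi> z)))"
    by (rule smooth_on_subset[OF N(4)]) (use smooth_on_open[OF N(4)] open_inD[OF W(1) ch(1)] in auto)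
  then have "smooth_on ?N (\<lambda>z. \<psi> (g (inv_into U \<phi> z)))"
    by (rule smooth_on_cong) (simp only: eq')
  moreover have "\<forall>z\<in>?N. g (inv_into U \<phi> z) \<in> V"
  proof
    fix z assume "z \<in> ?N"
    with N(3) eq'[OF this] show "g (inv_into U \<phi> z) \<in> V" by (metis IntD1)
  qed
  moreover have "\<phi> p \<in> ?N" "?N \<subseteq> \<phi> ` U" using N W ch by auto
  ultimately have "smooth_in_charts U \<phi> V \<psi> g p"
    unfolding smooth_in_charts_def using ch(3) by (intro conjI exI[of _ ?N])
  then show ?thesis unfolding smooth_map_at_def using ch by blast
qed

lemma smooth_in_charts_id:
  assumes "manifold A" "(U, \<phi>) \<in> A" "p \<in> U"
  shows "smooth_in_charts U \<phi> U \<phi> (\<lambda>x. x) p"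
proof -
  have "smooth_on (\<phi> ` U) (\<lambda>z. \<phi> (inv_into U \<phi> z))"
    using manifoldD(3)[OF assms(1,2,2)] by simp
  then show ?thesis
    unfolding smooth_in_charts_def using assms(3)
    by (intro conjI exI[of _ "\<phi> ` U"] ballI inv_into_into imageI order_refl)
qed

lemma smooth_map_at_id: "manifold A \<Longrightarrow> p \<in> pts A \<Longrightarrow> smooth_map_at A A (\<lambda>x. x) p"
  by (erule ptsE) (unfold smooth_map_at_def, intro exI conjI, assumption+, rule smooth_in_charts_id)

lemma smooth_map_at_const:
  assumes "manifold A" "p \<in> pts A" "c \<in> pts B"
  shows "smooth_map_at A B (\<lambda>x. c) p"
proof -
  obtain U \<phi> where U: "(U, \<phi>) \<in> A" "p \<in> U" using assms(2) by (rule ptsE)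
  obtain V \<psi> where V: "(V, \<psi>) \<in> B" "c \<in> V" using assms(3) by (rule ptsE)
  have "smooth_on (\<phi> ` U) (\<lambda>z. \<psi> c)" by (rule smooth_on_const[OF manifoldD(2)[OF assms(1) U(1)]])
  then have "smooth_in_charts U \<phi> V \<psi> (\<lambda>x. c) p"
    unfolding smooth_in_charts_def using U(2) V(2) by (intro conjI exI[of _ "\<phi> ` U"]) auto
  then show ?thesis unfolding smooth_map_at_def using U V by blast
qed

lemma smooth_map_at_compose:
  assumes mA: "manifold A" and mB: "manifold B" and mC: "manifold C"
    and f: "smooth_map_at A B f p" and g: "smooth_map_at B C g (f p)"
  shows "smooth_map_at A C (\<lambda>x. g (f x)) p"
proof -
  obtain U \<phi> V \<psi> N where ch: "(U, \<phi>) \<in> A" "(V, \<psi>) \<in> B" "p \<in> U"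
    and N: "\<phi> p \<in> N" "N \<subseteq> \<phi> ` U" "\<forall>z\<in>N. f (inv_into U \<phi> z) \<in> V"
      "smooth_on N (\<lambda>z. \<psi> (f (inv_into U \<phi> z)))"
    using f unfolding smooth_map_at_def smooth_in_charts_def by blast
  note injA = manifoldD(1)[OF mA ch(1)] and injB = manifoldD(1)[OF mB ch(2)]
  have fp: "f p \<in> V" using N(1,3) ch(3) injA by force
  obtain X \<xi> where X: "(X, \<xi>) \<in> C" "g (f p) \<in> X"
    using smooth_map_atD(2)[OF mB g] by (rule ptsE)
  obtain M where M: "\<psi> (f p) \<in> M" "M \<subseteq> \<psi> ` V" "\<forall>z\<in>M. g (inv_into V \<psi> z) \<in> X"
      "smooth_on M (\<lambda>z. \<xi> (g (inv_into V \<psi> z)))"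
    using smooth_map_at_in_charts[OF mB mC g ch(2) fp X] unfolding smooth_in_charts_def by blast
  define k where "k z = \<psi> (f (inv_into U \<phi> z))" for z
  have sk: "smooth_on N k" unfolding k_def by (rule N)
  let ?N = "N \<inter> k -` M"
  have oN: "open ?N" by (rule smooth_on_open_preimage[OF sk smooth_on_open[OF M(4)]])
  have eq: "inv_into V \<psi> (k z) = f (inv_into U \<phi> z)" if "z \<in> ?N" for z
    using that N(3) injB by (auto simp: k_def)
  have "smooth_on ?N (\<lambda>z. \<xi> (g (inv_into V \<psi> (k z))))"
    by (rule smooth_on_compose[OF smooth_on_subset[OF sk oN] M(4)]) auto
  then have "smooth_on ?N (\<lambda>z. \<xi> (g (f (inv_into U \<phi> z))))"
    by (rule smooth_on_cong) (simp only: eq)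
  moreover have "\<forall>z\<in>?N. g (f (inv_into U \<phi> z)) \<in> X"
  proof
    fix z assume z: "z \<in> ?N"
    then have "g (inv_into V \<psi> (k z)) \<in> X" using M(3) by auto
    then show "g (f (inv_into U \<phi> z)) \<in> X" by (simp only: eq[OF z])
  qed
  moreover have "\<phi> p \<in> ?N" using N(1) M(1) ch(3) injA by (auto simp: k_def)
  ultimately have "smooth_in_charts U \<phi> X \<xi> (\<lambda>x. g (f x)) p"
    unfolding smooth_in_charts_def using ch(3) N(2) by (intro conjI exI[of _ ?N]) auto
  then show ?thesis unfolding smooth_map_at_def using ch X by blast
qed

section \<open>Products of manifolds\<close>

lemma prod_atlasI: "(U, \<phi>) \<in> A \<Longrightarrow> (V, \<psi>) \<in> B \<Longrightarrow> (U \<times> V, map_prod \<phi> \<psi>) \<in> prod_atlas A B"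
  unfolding prod_atlas_def by blast

lemma prod_atlasE:
  assumes "(W, \<kappa>) \<in> prod_atlas A B"
  obtains U \<phi> V \<psi> where "(U, \<phi>) \<in> A" "(V, \<psi>) \<in> B" "W = U \<times> V" "\<kappa> = map_prod \<phi> \<psi>"
  using assms unfolding prod_atlas_def by blast

lemma pts_prod: "pts (prod_atlas A B) = pts A \<times> pts B"
proof (intro equalityI subsetI)
  fix z assume "z \<in> pts (prod_atlas A B)"
  then obtain W \<kappa> where "(W, \<kappa>) \<in> prod_atlas A B" "z \<in> W" by (rule ptsE)
  then show "z \<in> pts A \<times> pts B" by (auto elim!: prod_atlasE intro: ptsI)
next
  fix z assume "z \<in> pts A \<times> pts B"
  then have "fst z \<in> pts A" "snd z \<in> pts B" by auto
  then obtain U \<phi> V \<psi> where "(U, \<phi>) \<in> A" "(V, \<psi>) \<in> B" "fst z \<in> U" "snd z \<in> V"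
    by (elim ptsE)
  then show "z \<in> pts (prod_atlas A B)"
    by (intro ptsI[OF prod_atlasI]) (auto simp: mem_Times_iff)
qed

lemma map_prod_Times: "map_prod f g ` (U \<times> V) = f ` U \<times> g ` V"
  by force

lemma inv_into_map_prod:
  assumes "inj_on \<phi> U" "inj_on \<psi> V" "z \<in> \<phi> ` U \<times> \<psi> ` V"
  shows "inv_into (U \<times> V) (map_prod \<phi> \<psi>) z = (inv_into U \<phi> (fst z), inv_into V \<psi> (snd z))"
  using assms by (intro inv_into_f_eq map_prod_inj_on) (auto simp: f_inv_into_f inv_into_into)

lemma manifold_prod:
  assumes mA: "manifold A" and mB: "manifold B"
  shows "manifold (prod_atlas A B)"
proof -
  have "inj_on \<kappa> W \<and> open (\<kappa> ` W)" if ch: "(W, \<kappa>) \<in> prod_atlas A B" for W \<kappa>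
  proof -
    from ch obtain U \<phi> V \<psi> where W: "(U, \<phi>) \<in> A" "(V, \<psi>) \<in> B" "W = U \<times> V" "\<kappa> = map_prod \<phi> \<psi>"
      by (rule prod_atlasE)
    show ?thesis
      unfolding W(3,4) map_prod_Times
      by (intro conjI open_Times map_prod_inj_on manifoldD(1)[OF mA W(1)] manifoldD(1)[OF mB W(2)]
          manifoldD(2)[OF mA W(1)] manifoldD(2)[OF mB W(2)])
  qed
  moreover have tr: "smooth_on (\<kappa> ` (W \<inter> W')) (\<lambda>z. \<kappa>' (inv_into W \<kappa> z))"
    if ch: "(W, \<kappa>) \<in> prod_atlas A B" and ch': "(W', \<kappa>') \<in> prod_atlas A B" for W \<kappa> W' \<kappa>'
  proof -
    from ch obtain U \<phi> V \<psi> where W: "(U, \<phi>) \<in> A" "(V, \<psi>) \<in> B" "W = U \<times> V" "\<kappa> = map_prod \<phi> \<psi>"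
      by (rule prod_atlasE)
    from ch' obtain U' \<phi>' V' \<psi>' where W': "(U', \<phi>') \<in> A" "(V', \<psi>') \<in> B"
      "W' = U' \<times> V'" "\<kappa>' = map_prod \<phi>' \<psi>'"
      by (rule prod_atlasE)
    note sA = manifoldD(3)[OF mA W(1) W'(1)] and sB = manifoldD(3)[OF mB W(2) W'(2)]
    let ?S = "\<phi> ` (U \<inter> U') \<times> \<psi> ` (V \<inter> V')"
    have img: "\<kappa> ` (W \<inter> W') = ?S" unfolding W W' Times_Int_Times map_prod_Times ..
    have oS: "open ?S" by (intro open_Times smooth_on_open[OF sA] smooth_on_open[OF sB])
    have "smooth_on ?S (\<lambda>z. \<phi>' (inv_into U \<phi> (fst z)))"
      by (rule smooth_on_compose[OF smooth_on_bounded_linear[OF oS bounded_linear_fst] sA]) auto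
    moreover have "smooth_on ?S (\<lambda>z. \<psi>' (inv_into V \<psi> (snd z)))"
      by (rule smooth_on_compose[OF smooth_on_bounded_linear[OF oS bounded_linear_snd] sB]) auto
    ultimately have "smooth_on ?S (\<lambda>z. (\<phi>' (inv_into U \<phi> (fst z)), \<psi>' (inv_into V \<psi> (snd z))))"
      by (rule smooth_on_Pair)
    then show ?thesis
      unfolding img
    proof (rule smooth_on_cong)
      fix z assume "z \<in> ?S"
      then have "z \<in> \<phi> ` U \<times> \<psi> ` V" by auto
      from inv_into_map_prod[OF manifoldD(1)[OF mA W(1)] manifoldD(1)[OF mB W(2)] this]
      show "(\<phi>' (inv_into U \<phi> (fst z)), \<psi>' (inv_into V \<psi> (snd z))) = \<kappa>' (inv_into W \<kappa> z)"
        by (simp add: W W')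
    qed
  qed
  moreover have "open (\<kappa> ` (W \<inter> W'))"
    if "(W, \<kappa>) \<in> prod_atlas A B" "(W', \<kappa>') \<in> prod_atlas A B" for W \<kappa> W' \<kappa>'
    by (rule smooth_on_open[OF tr[OF that]])
  ultimately show ?thesis
    unfolding manifold_def by (auto simp: o_def)
qed

lemma smooth_map_at_Pair:
  assumes mA: "manifold A" and mB: "manifold B" and mC: "manifold C"
    and f: "smooth_map_at A B f p" and g: "smooth_map_at A C g p"
  shows "smooth_map_at A (prod_atlas B C) (\<lambda>x. (f x, g x)) p"
proof -
  obtain U \<phi> where U: "(U, \<phi>) \<in> A" "p \<in> U" using smooth_map_atD(1)[OF mA f] by (rule ptsE)
  obtain V \<psi> where V: "(V, \<psi>) \<in> B" "f p \<in> V" using smooth_map_atD(2)[OF mA f] by (rule ptsE)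
  obtain X \<xi> where X: "(X, \<xi>) \<in> C" "g p \<in> X" using smooth_map_atD(2)[OF mA g] by (rule ptsE)
  obtain N where N: "\<phi> p \<in> N" "N \<subseteq> \<phi> ` U" "\<forall>z\<in>N. f (inv_into U \<phi> z) \<in> V"
      "smooth_on N (\<lambda>z. \<psi> (f (inv_into U \<phi> z)))"
    using smooth_map_at_in_charts[OF mA mB f U V] unfolding smooth_in_charts_def by blast
  obtain M where M: "\<phi> p \<in> M" "M \<subseteq> \<phi> ` U" "\<forall>z\<in>M. g (inv_into U \<phi> z) \<in> X"
      "smooth_on M (\<lambda>z. \<xi> (g (inv_into U \<phi> z)))"
    using smooth_map_at_in_charts[OF mA mC g U X] unfolding smooth_in_charts_def by blast
  have o: "open (N \<inter> M)" by (intro open_Int smooth_on_open[OF N(4)] smooth_on_open[OF M(4)])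
  have "smooth_on (N \<inter> M) (\<lambda>z. (\<psi> (f (inv_into U \<phi> z)), \<xi> (g (inv_into U \<phi> z))))"
    by (intro smooth_on_Pair smooth_on_subset[OF N(4) o] smooth_on_subset[OF M(4) o]) auto
  then have "smooth_in_charts U \<phi> (V \<times> X) (map_prod \<psi> \<xi>) (\<lambda>x. (f x, g x)) p"
    unfolding smooth_in_charts_def using U(2) N(1-3) M(1-3) by (auto intro!: exI[of _ "N \<inter> M"])
  then show ?thesis unfolding smooth_map_at_def using U prod_atlasI[OF V(1) X(1)] by blast
qed

lemma smooth_map_at_snd:
  assumes mA: "manifold A" and mB: "manifold B" and p: "p \<in> pts A \<times> pts B"
  shows "smooth_map_at (prod_atlas A B) B snd p"
proof -
  obtain U \<phi> where U: "(U, \<phi>) \<in> A" "fst p \<in> U" using p by (auto elim: ptsE)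
  obtain V \<psi> where V: "(V, \<psi>) \<in> B" "snd p \<in> V" using p by (auto elim: ptsE)
  note injs = manifoldD(1)[OF mA U(1)] manifoldD(1)[OF mB V(1)]
  let ?S = "\<phi> ` U \<times> \<psi> ` V"
  have o: "open ?S" by (intro open_Times manifoldD(2)[OF mA U(1)] manifoldD(2)[OF mB V(1)])
  note inv = inv_into_map_prod[OF injs]
  have "smooth_on ?S (\<lambda>z. \<psi> (snd (inv_into (U \<times> V) (map_prod \<phi> \<psi>) z)))"
    by (rule smooth_on_cong[OF smooth_on_bounded_linear[OF o bounded_linear_snd]])
      (auto simp: inv injs)
  moreover have "p \<in> U \<times> V" "map_prod \<phi> \<psi> p \<in> ?S" using U V by (auto simp: mem_Times_iff)
  moreover have "\<forall>z\<in>?S. snd (inv_into (U \<times> V) (map_prod \<phi> \<psi>) z) \<in> V"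
    using injs by (auto simp: inv)
  ultimately have "smooth_in_charts (U \<times> V) (map_prod \<phi> \<psi>) V \<psi> snd p"
    unfolding smooth_in_charts_def map_prod_Times by (intro conjI exI[of _ ?S]; simp)
  then show "smooth_map_at (prod_atlas A B) B snd p"
    unfolding smooth_map_at_def using prod_atlasI[OF U(1) V(1)] V by blast
qed

section \<open>Tangent maps\<close>

lemma chart_at_mem:
  assumes "p \<in> pts A" "chart_at A p = (U, \<phi>)"
  shows "(U, \<phi>) \<in> A" "p \<in> U"
proof -
  obtain V \<psi> where "(V, \<psi>) \<in> A \<and> p \<in> fst (V, \<psi>)" using assms(1) by (auto elim: ptsE)
  then have "chart_at A p \<in> A \<and> p \<in> fst (chart_at A p)"
    unfolding chart_at_def by (rule someI)
  with assms(2) show "(U, \<phi>) \<in> A" "p \<in> U" by auto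
qed

lemma smooth_in_charts_differentiable:
  assumes "smooth_in_charts U \<phi> V \<psi> f p"
  shows "(\<lambda>z. \<psi> (f (inv_into U \<phi> z))) differentiable (at (\<phi> p))"
  using assms smooth_on_differentiable unfolding smooth_in_charts_def by blast

lemma tangent_map_has_derivative:
  assumes mA: "manifold A" and mB: "manifold B" and f: "smooth_map_at A B f p"
    and U: "chart_at A p = (U, \<phi>)" and V: "chart_at B (f p) = (V, \<psi>)"
  shows "((\<lambda>z. \<psi> (f (inv_into U \<phi> z))) has_derivative tangent_map A B f p) (at (\<phi> p))"
proof -
  have "smooth_in_charts U \<phi> V \<psi> f p"
    using smooth_map_at_in_charts[OF mA mB f] chart_at_mem U V smooth_map_atD[OF mA f] by metis
  from smooth_in_charts_differentiable[OF this]
  show ?thesis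
    unfolding tangent_map_def U V by (simp add: o_def frechet_derivative_works)
qed

lemma tangent_map_unique:
  assumes "chart_at A p = (U, \<phi>)" and "chart_at B (f p) = (V, \<psi>)"
    and "((\<lambda>z. \<psi> (f (inv_into U \<phi> z))) has_derivative D) (at (\<phi> p))"
  shows "tangent_map A B f p = D"
  using frechet_derivative_at[OF assms(3)] unfolding tangent_map_def assms(1,2) by (simp add: o_def)

lemma tangent_map_linear:
  assumes "manifold A" "manifold B" "smooth_map_at A B f p"
  shows "linear (tangent_map A B f p)"
  by (metis assms has_derivative_linear surj_pair tangent_map_has_derivative)

lemma tangent_map_cong:
  assumes mA: "manifold A" and mB: "manifold B" and f: "smooth_map_at A B f p"
    and W: "open_in A W" "p \<in> W" and eq: "\<And>q. q \<in> W \<Longrightarrow> f q = g q"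
  shows "tangent_map A B g p = tangent_map A B f p"
proof -
  obtain U \<phi> where U: "chart_at A p = (U, \<phi>)" by fastforce
  obtain V \<psi> where V: "chart_at B (f p) = (V, \<psi>)" by fastforce
  note chU = chart_at_mem[OF smooth_map_atD(1)[OF mA f] U]
  show ?thesis
  proof (rule tangent_map_unique[where U = U and \<phi> = \<phi> and V = V and \<psi> = \<psi>, OF U])
    show "chart_at B (g p) = (V, \<psi>)" using V eq[OF W(2)] by simp
    show "((\<lambda>z. \<psi> (g (inv_into U \<phi> z))) has_derivative tangent_map A B f p) (at (\<phi> p))"
    proof (rule has_derivative_transform_within_open[OF
          tangent_map_has_derivative[OF mA mB f U V] open_inD[OF W(1) chU(1)]])
      show "\<phi> p \<in> \<phi> ` (U \<inter> W)" using chU(2) W(2) by blast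
      show "\<psi> (f (inv_into U \<phi> z)) = \<psi> (g (inv_into U \<phi> z))" if "z \<in> \<phi> ` (U \<inter> W)" for z
        using that manifoldD(1)[OF mA chU(1)] eq by auto
    qed
  qed
qed

lemma tangent_map_id:
  assumes mA: "manifold A" and p: "p \<in> pts A"
  shows "tangent_map A A (\<lambda>x. x) p v = v"
proof -
  obtain U \<phi> where U: "chart_at A p = (U, \<phi>)" by fastforce
  note chU = chart_at_mem[OF p U]
  have "((\<lambda>z. \<phi> (inv_into U \<phi> z)) has_derivative (\<lambda>v. v)) (at (\<phi> p))"
    by (rule has_derivative_transform_within_open[OF has_derivative_ident
          manifoldD(2)[OF mA chU(1)]]) (use chU in \<open>auto simp: f_inv_into_f\<close>)
  from tangent_map_unique[OF U U this] show ?thesis by simp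
qed

lemma tangent_map_compose:
  assumes mA: "manifold A" and mB: "manifold B" and mC: "manifold C"
    and f: "smooth_map_at A B f p" and g: "smooth_map_at B C g (f p)"
  shows "tangent_map A C (\<lambda>x. g (f x)) p v = tangent_map B C g (f p) (tangent_map A B f p v)"
proof -
  obtain U \<phi> where U: "chart_at A p = (U, \<phi>)" by fastforce
  obtain V \<psi> where V: "chart_at B (f p) = (V, \<psi>)" by fastforce
  obtain X \<xi> where X: "chart_at C (g (f p)) = (X, \<xi>)" by fastforce
  note chU = chart_at_mem[OF smooth_map_atD(1)[OF mA f] U]
    and chV = chart_at_mem[OF smooth_map_atD(2)[OF mA f] V]
  note injA = manifoldD(1)[OF mA chU(1)] and injB = manifoldD(1)[OF mB chV(1)]
  obtain N where N: "\<phi> p \<in> N" "N \<subseteq> \<phi> ` U" "\<forall>z\<in>N. f (inv_into U \<phi> z) \<in> V"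
      "smooth_on N (\<lambda>z. \<psi> (f (inv_into U \<phi> z)))"
    using smooth_map_at_in_charts[OF mA mB f chU chV] unfolding smooth_in_charts_def by blast
  have "((\<lambda>z. \<xi> (g (inv_into V \<psi> z))) has_derivative tangent_map B C g (f p))
      (at (\<psi> (f (inv_into U \<phi> (\<phi> p)))))"
    using tangent_map_has_derivative[OF mB mC g V X] chU injA by simp
  from has_derivative_compose[OF tangent_map_has_derivative[OF mA mB f U V] this]
  have "((\<lambda>z. \<xi> (g (inv_into V \<psi> (\<psi> (f (inv_into U \<phi> z)))))) has_derivative
      (\<lambda>v. tangent_map B C g (f p) (tangent_map A B f p v))) (at (\<phi> p))" .
  then have "((\<lambda>z. \<xi> (g (f (inv_into U \<phi> z)))) has_derivative
      (\<lambda>v. tangent_map B C g (f p) (tangent_map A B f p v))) (at (\<phi> p))"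
    by (rule has_derivative_transform_within_open[OF _ smooth_on_open[OF N(4)] N(1)])
      (use N(3) injB in simp)
  from tangent_map_unique[OF U X this] show ?thesis by simp
qed

text \<open>
  The preferred chart of the product at \<open>(f p, g p)\<close> need not be the product of the preferred
  charts of the factors, but it is a product of charts, which suffices to separate the two components.
\<close>

lemma tangent_map_Pair:
  assumes mA: "manifold A" and mB: "manifold B" and mC: "manifold C"
    and f: "smooth_map_at A B f p" and g: "smooth_map_at A C g p"
  shows "tangent_map A (prod_atlas B C) (\<lambda>x. (f x, g x)) p v =
    tangent_map A (prod_atlas B C) (\<lambda>x. (f x, g p)) p v +
    tangent_map A (prod_atlas B C) (\<lambda>x. (f p, g x)) p v"
proof -
  obtain U \<phi> where U: "chart_at A p = (U, \<phi>)" by fastforce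
  obtain W \<kappa> where W: "chart_at (prod_atlas B C) (f p, g p) = (W, \<kappa>)" by fastforce
  have "(f p, g p) \<in> pts (prod_atlas B C)"
    using smooth_map_atD(2)[OF mA f] smooth_map_atD(2)[OF mA g] by (simp add: pts_prod)
  note chW = chart_at_mem[OF this W] and chU = chart_at_mem[OF smooth_map_atD(1)[OF mA f] U]
  from chW(1) obtain V \<psi> X \<xi> where
    V: "(V, \<psi>) \<in> B" and X: "(X, \<xi>) \<in> C" and eqs: "W = V \<times> X" "\<kappa> = map_prod \<psi> \<xi>"
    by (rule prod_atlasE)
  obtain a where a: "((\<lambda>z. \<psi> (f (inv_into U \<phi> z))) has_derivative a) (at (\<phi> p))"
    using smooth_in_charts_differentiable[OF smooth_map_at_in_charts[OF mA mB f chU V]] chW eqs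
    by (auto simp: differentiable_def)
  obtain b where b: "((\<lambda>z. \<xi> (g (inv_into U \<phi> z))) has_derivative b) (at (\<phi> p))"
    using smooth_in_charts_differentiable[OF smooth_map_at_in_charts[OF mA mC g chU X]] chW eqs
    by (auto simp: differentiable_def)
  have "tangent_map A (prod_atlas B C) (\<lambda>x. (f x, g x)) p = (\<lambda>v. (a v, b v))"
    by (rule tangent_map_unique[where f = "\<lambda>x. (f x, g x)", OF U W]) (auto simp: eqs intro!: has_derivative_Pair a b)
  moreover have "tangent_map A (prod_atlas B C) (\<lambda>x. (f x, g p)) p = (\<lambda>v. (a v, 0))"
    by (rule tangent_map_unique[where f = "\<lambda>x. (f x, g p)", OF U W]) (auto simp: eqs intro!: has_derivative_Pair a)
  moreover have "tangent_map A (prod_atlas B C) (\<lambda>x. (f p, g x)) p = (\<lambda>v. (0, b v))"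
    by (rule tangent_map_unique[where f = "\<lambda>x. (f p, g x)", OF U W]) (auto simp: eqs intro!: has_derivative_Pair b)
  ultimately show ?thesis by simp
qed

lemma tangent_map_Leibniz:
  assumes mA: "manifold A" and mB: "manifold B" and mC: "manifold C" and mE: "manifold E"
    and f: "smooth_map_at A B f p" and g: "smooth_map_at A C g p"
    and F: "smooth_map_at (prod_atlas B C) E F (f p, g p)"
  shows "tangent_map A E (\<lambda>x. F (f x, g x)) p v =
    tangent_map A E (\<lambda>x. F (f x, g p)) p v + tangent_map A E (\<lambda>x. F (f p, g x)) p v"
proof -
  note mBC = manifold_prod[OF mB mC]
  note cf = smooth_map_at_const[OF mA smooth_map_atD(1)[OF mA f] smooth_map_atD(2)[OF mA f]]
    and cg = smooth_map_at_const[OF mA smooth_map_atD(1)[OF mA g] smooth_map_atD(2)[OF mA g]]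
  note Pair = smooth_map_at_Pair[OF mA mB mC]
  show ?thesis
    using tangent_map_compose[OF mA mBC mE Pair[OF f g] F, of v]
      tangent_map_compose[OF mA mBC mE Pair[OF f cg], of F v]
      tangent_map_compose[OF mA mBC mE Pair[OF cf g], of F v] F
    by (simp add: tangent_map_Pair[OF mA mB mC f g, of v]
        linear_add[OF tangent_map_linear[OF mBC mE F]])
qed

section \<open>Lie groups\<close>

lemma lie_groupD:
  assumes "lie_group G"
  shows "group G" "manifold (charts G)" "pts (charts G) = carrier G"
    "a \<in> carrier G \<Longrightarrow> b \<in> carrier G \<Longrightarrow>
      smooth_map_at (prod_atlas (charts G) (charts G)) (charts G) (\<lambda>(a, b). a \<otimes>\<^bsub>G\<^esub> b) (a, b)"
proof -
  show "group G" and m: "manifold (charts G)" and "pts (charts G) = carrier G"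
    using assms unfolding lie_group_def by blast+
  have "smooth_map (prod_atlas (charts G) (charts G)) (carrier G \<times> carrier G) (charts G)
       (\<lambda>(a, b). a \<otimes>\<^bsub>G\<^esub> b)"
    using assms unfolding lie_group_def by blast
  then show "a \<in> carrier G \<Longrightarrow> b \<in> carrier G \<Longrightarrow>
      smooth_map_at (prod_atlas (charts G) (charts G)) (charts G) (\<lambda>(a, b). a \<otimes>\<^bsub>G\<^esub> b) (a, b)"
    unfolding smooth_map_iff[OF manifold_prod[OF m m] m] by blast
qed

lemma smooth_map_at_mult:
  assumes G: "lie_group G" and mA: "manifold A"
    and f: "smooth_map_at A (charts G) f p" and g: "smooth_map_at A (charts G) g p"
  shows "smooth_map_at A (charts G) (\<lambda>x. f x \<otimes>\<^bsub>G\<^esub> g x) p"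
proof -
  note m = lie_groupD(2)[OF G]
  have "f p \<in> carrier G" "g p \<in> carrier G"
    using smooth_map_atD(2)[OF mA f] smooth_map_atD(2)[OF mA g] lie_groupD(3)[OF G] by auto
  from smooth_map_at_compose[OF mA manifold_prod[OF m m] m smooth_map_at_Pair[OF mA m m f g]
      lie_groupD(4)[OF G this]]
  show ?thesis by simp
qed

lemma lie_group_smooth_id:
  assumes "lie_group G" "a \<in> carrier G"
  shows "smooth_map_at (charts G) (charts G) (\<lambda>b. b) a"
  by (rule smooth_map_at_id) (simp_all add: lie_groupD[OF assms(1)] assms(2))

lemma lie_group_smooth_const:
  assumes "lie_group G" "a \<in> carrier G" "b \<in> carrier G"
  shows "smooth_map_at (charts G) (charts G) (\<lambda>x. b) a"
  by (rule smooth_map_at_const) (simp_all add: lie_groupD[OF assms(1)] assms(2,3))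

lemma smooth_left_translation:
  assumes "lie_group G" "a \<in> carrier G" "b \<in> carrier G"
  shows "smooth_map_at (charts G) (charts G) (\<lambda>x. a \<otimes>\<^bsub>G\<^esub> x) b"
  using assms by (intro smooth_map_at_mult lie_groupD(2) lie_group_smooth_const lie_group_smooth_id)

lemma smooth_conjugation:
  assumes "lie_group G" "a \<in> carrier G" "b \<in> carrier G"
  shows "smooth_map_at (charts G) (charts G) (\<lambda>x. a \<otimes>\<^bsub>G\<^esub> x \<otimes>\<^bsub>G\<^esub> inv\<^bsub>G\<^esub> a) b"
  using assms
  by (intro smooth_map_at_mult lie_groupD(2) lie_group_smooth_const smooth_left_translation
      group.inv_closed[OF lie_groupD(1)])

lemma lie_homD:
  assumes "lie_hom G H \<phi>" "lie_group G" "lie_group H"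
  shows "\<phi> \<in> hom G H" "a \<in> carrier G \<Longrightarrow> \<phi> a \<in> carrier H"
    "a \<in> carrier G \<Longrightarrow> b \<in> carrier G \<Longrightarrow> \<phi> (a \<otimes>\<^bsub>G\<^esub> b) = \<phi> a \<otimes>\<^bsub>H\<^esub> \<phi> b"
    "\<phi> \<one>\<^bsub>G\<^esub> = \<one>\<^bsub>H\<^esub>"
    "a \<in> carrier G \<Longrightarrow> \<phi> (inv\<^bsub>G\<^esub> a) = inv\<^bsub>H\<^esub> (\<phi> a)"
    "a \<in> carrier G \<Longrightarrow> smooth_map_at (charts G) (charts H) \<phi> a"
proof -
  show h: "\<phi> \<in> hom G H" using assms(1) unfolding lie_hom_def by blast
  interpret group_hom G H \<phi>
    using h lie_groupD(1)[OF assms(2)] lie_groupD(1)[OF assms(3)]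
    by (simp add: group_hom_def group_hom_axioms_def)
  show "a \<in> carrier G \<Longrightarrow> \<phi> a \<in> carrier H"
    "a \<in> carrier G \<Longrightarrow> b \<in> carrier G \<Longrightarrow> \<phi> (a \<otimes>\<^bsub>G\<^esub> b) = \<phi> a \<otimes>\<^bsub>H\<^esub> \<phi> b"
    "\<phi> \<one>\<^bsub>G\<^esub> = \<one>\<^bsub>H\<^esub>" "a \<in> carrier G \<Longrightarrow> \<phi> (inv\<^bsub>G\<^esub> a) = inv\<^bsub>H\<^esub> (\<phi> a)"
    by auto
  show "a \<in> carrier G \<Longrightarrow> smooth_map_at (charts G) (charts H) \<phi> a"
    using assms(1) unfolding lie_hom_def
      smooth_map_iff[OF lie_groupD(2)[OF assms(2)] lie_groupD(2)[OF assms(3)]] by blast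
qed

lemma lie_group_open: "lie_group G \<Longrightarrow> open_in (charts G) (carrier G)"
  using open_in_pts lie_groupD by metis

text \<open>
  The derivative at the identity of \<open>\<phi> (a x a\<^sup>-\<^sup>1) = \<phi>(a) \<phi>(x) \<phi>(a)\<^sup>-\<^sup>1\<close>.
\<close>

lemma Ad_lie_hom:
  assumes G: "lie_group G" and H: "lie_group H" and \<phi>: "lie_hom G H \<phi>" and a: "a \<in> carrier G"
  shows "Ad H (\<phi> a) (lie_alg_hom G H \<phi> X) = lie_alg_hom G H \<phi> (Ad G a X)"
proof -
  interpret G: group G by (rule lie_groupD(1)[OF G])
  interpret H: group H by (rule lie_groupD(1)[OF H])
  note mG = lie_groupD(2)[OF G] and mH = lie_groupD(2)[OF H] and hom = lie_homD[OF \<phi> G H]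
  have cG: "smooth_map_at (charts G) (charts G) (\<lambda>x. a \<otimes>\<^bsub>G\<^esub> x \<otimes>\<^bsub>G\<^esub> inv\<^bsub>G\<^esub> a) \<one>\<^bsub>G\<^esub>"
    by (rule smooth_conjugation[OF G a]) simp
  have cH: "smooth_map_at (charts H) (charts H)
      (\<lambda>x. \<phi> a \<otimes>\<^bsub>H\<^esub> x \<otimes>\<^bsub>H\<^esub> inv\<^bsub>H\<^esub> (\<phi> a)) (\<phi> \<one>\<^bsub>G\<^esub>)"
    by (rule smooth_conjugation[OF H]) (simp_all add: hom a)
  have \<phi>1: "smooth_map_at (charts G) (charts H) \<phi> \<one>\<^bsub>G\<^esub>"
    and \<phi>2: "smooth_map_at (charts G) (charts H) \<phi> (a \<otimes>\<^bsub>G\<^esub> \<one>\<^bsub>G\<^esub> \<otimes>\<^bsub>G\<^esub> inv\<^bsub>G\<^esub> a)"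
    by (simp_all add: hom a)
  have "tangent_map (charts G) (charts H) (\<lambda>x. \<phi> (a \<otimes>\<^bsub>G\<^esub> x \<otimes>\<^bsub>G\<^esub> inv\<^bsub>G\<^esub> a)) \<one>\<^bsub>G\<^esub> =
      tangent_map (charts G) (charts H) (\<lambda>x. \<phi> a \<otimes>\<^bsub>H\<^esub> \<phi> x \<otimes>\<^bsub>H\<^esub> inv\<^bsub>H\<^esub> (\<phi> a)) \<one>\<^bsub>G\<^esub>"
    by (rule tangent_map_cong[OF mG mH smooth_map_at_compose[OF mG mH mH \<phi>1 cH] lie_group_open[OF G]])
      (simp_all add: hom a)
  with tangent_map_compose[OF mG mH mH \<phi>1 cH, of X] tangent_map_compose[OF mG mG mH cG \<phi>2, of X]
  show ?thesis
    unfolding Ad_def lie_alg_hom_def by (simp add: hom a)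
qed

text \<open>
  The derivative at \<open>c p\<close> of \<open>\<phi> (c(p)\<^sup>-\<^sup>1 x) = \<phi>(c(p))\<^sup>-\<^sup>1 \<phi>(x)\<close>, applied to the tangent map of \<open>c\<close>.
\<close>

lemma maurer_cartan_lie_hom:
  assumes G: "lie_group G" and H: "lie_group H" and \<phi>: "lie_hom G H \<phi>" and mA: "manifold A"
    and c: "smooth_map_at A (charts G) c p"
  shows "maurer_cartan A H (\<lambda>x. \<phi> (c x)) p v = lie_alg_hom G H \<phi> (maurer_cartan A G c p v)"
proof -
  interpret G: group G by (rule lie_groupD(1)[OF G])
  interpret H: group H by (rule lie_groupD(1)[OF H])
  note mG = lie_groupD(2)[OF G] and mH = lie_groupD(2)[OF H] and hom = lie_homD[OF \<phi> G H]
  have cp: "c p \<in> carrier G" using smooth_map_atD(2)[OF mA c] lie_groupD(3)[OF G] by simp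
  note \<phi>c = hom(6)[OF cp]
  have lG: "smooth_map_at (charts G) (charts G) (\<lambda>x. inv\<^bsub>G\<^esub> (c p) \<otimes>\<^bsub>G\<^esub> x) (c p)"
    by (rule smooth_left_translation[OF G]) (simp_all add: cp)
  have lH: "smooth_map_at (charts H) (charts H) (\<lambda>x. inv\<^bsub>H\<^esub> (\<phi> (c p)) \<otimes>\<^bsub>H\<^esub> x) (\<phi> (c p))"
    by (rule smooth_left_translation[OF H]) (simp_all add: cp hom)
  have \<phi>1: "smooth_map_at (charts G) (charts H) \<phi> (inv\<^bsub>G\<^esub> (c p) \<otimes>\<^bsub>G\<^esub> c p)"
    by (simp add: cp hom)
  have eq: "tangent_map (charts G) (charts H) (\<lambda>x. \<phi> (inv\<^bsub>G\<^esub> (c p) \<otimes>\<^bsub>G\<^esub> x)) (c p) =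
      tangent_map (charts G) (charts H) (\<lambda>x. inv\<^bsub>H\<^esub> (\<phi> (c p)) \<otimes>\<^bsub>H\<^esub> \<phi> x) (c p)"
    by (rule tangent_map_cong[OF mG mH smooth_map_at_compose[OF mG mH mH \<phi>c lH] lie_group_open[OF G] cp])
      (simp add: hom cp)
  show ?thesis
    using fun_cong[OF eq, of "tangent_map A (charts G) c p v"]
      tangent_map_compose[OF mG mH mH \<phi>c lH] tangent_map_compose[OF mG mG mH lG \<phi>1]
      tangent_map_compose[OF mA mG mH c \<phi>c, of v]
    unfolding maurer_cartan_def lie_alg_hom_def by (simp add: hom cp)
qed

section \<open>Principal bundles and connection forms\<close>

lemma pullback_compose:
  assumes "manifold A" "manifold B" "manifold C" "smooth_map_at A B f p" "smooth_map_at B C g (f p)"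
  shows "pullback A C (\<lambda>x. g (f x)) \<theta> p v = pullback B C g \<theta> (f p) (tangent_map A B f p v)"
  unfolding pullback_def by (simp add: tangent_map_compose[OF assms])

lemma pullback_cong:
  assumes "manifold A" "manifold B" "smooth_map_at A B f p"
    and "open_in A W" "p \<in> W" "\<And>q. q \<in> W \<Longrightarrow> f q = g q"
  shows "pullback A B g \<theta> p v = pullback A B f \<theta> p v"
  unfolding pullback_def by (simp add: tangent_map_cong[OF assms] assms)

lemma principal_bundleD:
  assumes "principal_bundle P"
  shows "manifold (total_space P)" "lie_group (struct_group P)" "manifold (base_space P)"
    "p \<in> pts (total_space P) \<Longrightarrow> smooth_map_at (total_space P) (base_space P) (projection P) p"
    "p \<in> pts (total_space P) \<Longrightarrow> g \<in> carrier (struct_group P) \<Longrightarrow>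
      smooth_map_at (prod_atlas (total_space P) (charts (struct_group P))) (total_space P)
        (\<lambda>(p, g). right_action P p g) (p, g)"
    "p \<in> pts (total_space P) \<Longrightarrow> right_action P p \<one>\<^bsub>struct_group P\<^esub> = p"
    "p \<in> pts (total_space P) \<Longrightarrow> g \<in> carrier (struct_group P) \<Longrightarrow> h \<in> carrier (struct_group P) \<Longrightarrow>
      right_action P (right_action P p g) h = right_action P p (g \<otimes>\<^bsub>struct_group P\<^esub> h)"
    "p \<in> pts (total_space P) \<Longrightarrow> g \<in> carrier (struct_group P) \<Longrightarrow>
      projection P (right_action P p g) = projection P p"
    "p \<in> pts (total_space P) \<Longrightarrow> g \<in> carrier (struct_group P) \<Longrightarrow>
      right_action P p g \<in> pts (total_space P)"
proof -
  show mP: "manifold (total_space P)" and G: "lie_group (struct_group P)"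
    and mB: "manifold (base_space P)"
    using assms unfolding principal_bundle_def by blast+
  note mG = lie_groupD(2)[OF G]
  have "smooth_map (total_space P) (pts (total_space P)) (base_space P) (projection P)"
    using assms unfolding principal_bundle_def by blast
  then show "p \<in> pts (total_space P) \<Longrightarrow>
      smooth_map_at (total_space P) (base_space P) (projection P) p"
    unfolding smooth_map_iff[OF mP mB] by blast
  have "smooth_map (prod_atlas (total_space P) (charts (struct_group P)))
       (pts (total_space P) \<times> carrier (struct_group P)) (total_space P)
       (\<lambda>(p, g). right_action P p g)"
    using assms unfolding principal_bundle_def by blast
  then show act: "smooth_map_at (prod_atlas (total_space P) (charts (struct_group P))) (total_space P)
        (\<lambda>(p, g). right_action P p g) (p, g)"
    if "p \<in> pts (total_space P)" "g \<in> carrier (struct_group P)"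
    using that unfolding smooth_map_iff[OF manifold_prod[OF mP mG] mP] by blast
  show "right_action P p g \<in> pts (total_space P)"
    if "p \<in> pts (total_space P)" "g \<in> carrier (struct_group P)"
    using smooth_map_atD(2)[OF manifold_prod[OF mP mG] act[OF that]] by simp
qed (use assms in \<open>simp_all add: principal_bundle_def\<close>)

lemma smooth_map_at_action:
  assumes P: "principal_bundle P" and mA: "manifold A"
    and t: "smooth_map_at A (total_space P) t p"
    and h: "smooth_map_at A (charts (struct_group P)) h p"
  shows "smooth_map_at A (total_space P) (\<lambda>x. right_action P (t x) (h x)) p"
proof -
  note mP = principal_bundleD(1)[OF P] and G = principal_bundleD(2)[OF P]
  note mG = lie_groupD(2)[OF G]
  have "t p \<in> pts (total_space P)" "h p \<in> carrier (struct_group P)"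
    using smooth_map_atD(2)[OF mA t] smooth_map_atD(2)[OF mA h] lie_groupD(3)[OF G] by auto
  from smooth_map_at_compose[OF mA manifold_prod[OF mP mG] mP smooth_map_at_Pair[OF mA mP mG t h]
      principal_bundleD(5)[OF P this]]
  show ?thesis by simp
qed

text \<open>
  The orbit map of \<open>q\<close> is \<open>g \<mapsto> (q a) (a\<^sup>-\<^sup>1 g)\<close>, so that its tangent map at \<open>a\<close> factors through the
  tangent map at the identity of the orbit map of \<open>q a\<close>, that is, through fundamental fields.
\<close>

lemma tangent_map_orbit:
  assumes P: "principal_bundle P" and q: "q \<in> pts (total_space P)"
    and a: "a \<in> carrier (struct_group P)"
  shows "tangent_map (charts (struct_group P)) (total_space P) (\<lambda>g. right_action P q g) a w =
    fundamental_field P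
      (tangent_map (charts (struct_group P)) (charts (struct_group P))
        (\<lambda>b. inv\<^bsub>struct_group P\<^esub> a \<otimes>\<^bsub>struct_group P\<^esub> b) a w)
      (right_action P q a)"
proof -
  let ?G = "struct_group P" and ?M = "total_space P"
  note mP = principal_bundleD(1)[OF P] and G = principal_bundleD(2)[OF P]
  note mG = lie_groupD(2)[OF G]
  interpret G: group ?G by (rule lie_groupD(1)[OF G])
  have orbit: "smooth_map_at (charts ?G) ?M (\<lambda>g. right_action P p g) b"
    if "p \<in> pts ?M" "b \<in> carrier ?G" for p b
    using that lie_groupD(3)[OF G]
    by (intro smooth_map_at_action[OF P mG] smooth_map_at_const[OF mG] lie_group_smooth_id[OF G]) auto
  have qa: "right_action P q a \<in> pts ?M" by (rule principal_bundleD(9)[OF P q a])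
  have l: "smooth_map_at (charts ?G) (charts ?G) (\<lambda>b. inv\<^bsub>?G\<^esub> a \<otimes>\<^bsub>?G\<^esub> b) a"
    by (rule smooth_left_translation[OF G]) (simp_all add: a)
  have o: "smooth_map_at (charts ?G) ?M (\<lambda>g. right_action P (right_action P q a) g)
      (inv\<^bsub>?G\<^esub> a \<otimes>\<^bsub>?G\<^esub> a)"
    by (rule orbit[OF qa]) (simp add: a)
  have "tangent_map (charts ?G) ?M (\<lambda>g. right_action P q g) a =
      tangent_map (charts ?G) ?M
        (\<lambda>g. right_action P (right_action P q a) (inv\<^bsub>?G\<^esub> a \<otimes>\<^bsub>?G\<^esub> g)) a"
  proof (rule tangent_map_cong[OF mG mP smooth_map_at_compose[OF mG mG mP l o] lie_group_open[OF G] a])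
    fix g assume g: "g \<in> carrier ?G"
    then have "a \<otimes>\<^bsub>?G\<^esub> (inv\<^bsub>?G\<^esub> a \<otimes>\<^bsub>?G\<^esub> g) = g"
      using a by (simp add: G.m_assoc[symmetric])
    then show "right_action P (right_action P q a) (inv\<^bsub>?G\<^esub> a \<otimes>\<^bsub>?G\<^esub> g) = right_action P q g"
      using principal_bundleD(7)[OF P q a, of "inv\<^bsub>?G\<^esub> a \<otimes>\<^bsub>?G\<^esub> g"] a g by simp
  qed
  with tangent_map_compose[OF mG mG mP l o, of w] show ?thesis
    by (simp add: fundamental_field_def a)
qed

lemma connection_formD:
  assumes "connection_form P \<omega>" "p \<in> pts (total_space P)"
  shows "blinfun_apply (\<omega> p) (fundamental_field P X p) = X"
    "g \<in> carrier (struct_group P) \<Longrightarrow>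
      pullback (total_space P) (total_space P) (\<lambda>q. right_action P q g) \<omega> p u =
      Ad (struct_group P) (inv\<^bsub>struct_group P\<^esub> g) (blinfun_apply (\<omega> p) u)"
  using assms unfolding connection_form_def by blast+

text \<open>
  The formula \<open>(t \<cdot> h)\<^sup>*\<omega> = Ad(h\<^sup>-\<^sup>1).t\<^sup>*\<omega> + h\<^sup>-\<^sup>1dh\<close>, for smooth maps \<open>t\<close> and \<open>h\<close> of an arbitrary
  manifold into the total space and into the group.  By the Leibniz rule the tangent map of \<open>t \<cdot> h\<close>
  is the sum of a term from right translation by \<open>h p\<close>, on which \<open>\<omega>\<close> is governed by its equivariance,
  and a fundamental vector, which \<open>\<omega>\<close> returns unchanged.
\<close>

lemma pullback_gauge_transformation:
  assumes P: "principal_bundle P" and \<omega>: "connection_form P \<omega>" and mA: "manifold A"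
    and t: "smooth_map_at A (total_space P) t p"
    and h: "smooth_map_at A (charts (struct_group P)) h p"
  shows "pullback A (total_space P) (\<lambda>x. right_action P (t x) (h x)) \<omega> p v =
    Ad (struct_group P) (inv\<^bsub>struct_group P\<^esub> (h p)) (pullback A (total_space P) t \<omega> p v) +
    maurer_cartan A (struct_group P) h p v"
proof -
  let ?G = "struct_group P" and ?M = "total_space P"
  note mP = principal_bundleD(1)[OF P] and G = principal_bundleD(2)[OF P]
  note mG = lie_groupD(2)[OF G]
  have tp: "t p \<in> pts ?M" and hp: "h p \<in> carrier ?G"
    using smooth_map_atD(2)[OF mA t] smooth_map_atD(2)[OF mA h] lie_groupD(3)[OF G] by auto
  have q: "right_action P (t p) (h p) \<in> pts ?M" by (rule principal_bundleD(9)[OF P tp hp])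
  have R: "smooth_map_at ?M ?M (\<lambda>q. right_action P q (h p)) (t p)"
    using hp lie_groupD(3)[OF G]
    by (intro smooth_map_at_action[OF P mP] smooth_map_at_id[OF mP] smooth_map_at_const[OF mP] tp) simp
  have O: "smooth_map_at (charts ?G) ?M (\<lambda>g. right_action P (t p) g) (h p)"
    using hp tp lie_groupD(3)[OF G]
    by (intro smooth_map_at_action[OF P mG] smooth_map_at_const[OF mG] lie_group_smooth_id[OF G]) auto
  have "tangent_map A ?M (\<lambda>x. right_action P (t x) (h x)) p v =
      tangent_map A ?M (\<lambda>x. right_action P (t x) (h p)) p v +
      tangent_map A ?M (\<lambda>x. right_action P (t p) (h x)) p v"
    using tangent_map_Leibniz[OF mA mP mG mP t h principal_bundleD(5)[OF P tp hp], of v] by simp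
  also have "tangent_map A ?M (\<lambda>x. right_action P (t x) (h p)) p v =
      tangent_map ?M ?M (\<lambda>q. right_action P q (h p)) (t p) (tangent_map A ?M t p v)"
    by (rule tangent_map_compose[OF mA mP mP t R])
  also have "tangent_map A ?M (\<lambda>x. right_action P (t p) (h x)) p v =
      fundamental_field P (maurer_cartan A ?G h p v) (right_action P (t p) (h p))"
    unfolding tangent_map_compose[OF mA mG mP h O] tangent_map_orbit[OF P tp hp] maurer_cartan_def ..
  finally show ?thesis
    using connection_formD(2)[OF \<omega> tp hp, of "tangent_map A ?M t p v"]
    by (simp add: pullback_def blinfun.add_right connection_formD(1)[OF \<omega> q])
qed

text \<open>
  The section \<open>s\<close> of a local trivialization and the group coordinate \<open>c = snd \<circ> \<Phi>\<close> are smooth, and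
  every point over \<open>U\<close> is \<open>p = s(\<pi>(p)) \<cdot> c(p)\<close>.
\<close>

lemma local_trivializationD:
  assumes P: "principal_bundle P" and triv: "local_trivialization P U \<Phi>"
  shows "open_in (base_space P) U" "open_in (total_space P) (over P U)"
    "p \<in> over P U \<Longrightarrow> smooth_map_at (total_space P) (charts (struct_group P)) (\<lambda>p. snd (\<Phi> p)) p"
    "p \<in> over P U \<Longrightarrow> snd (\<Phi> p) \<in> carrier (struct_group P)"
    "x \<in> U \<Longrightarrow> smooth_map_at (base_space P) (total_space P) (natural_section P U \<Phi>) x"
    "x \<in> U \<Longrightarrow> natural_section P U \<Phi> x \<in> pts (total_space P)"
    "x \<in> U \<Longrightarrow> projection P (natural_section P U \<Phi> x) = x"
    "p \<in> over P U \<Longrightarrow> right_action P (natural_section P U \<Phi> (projection P p)) (snd (\<Phi> p)) = p"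
    "x \<in> U \<Longrightarrow> g \<in> carrier (struct_group P) \<Longrightarrow>
      snd (\<Phi> (right_action P (natural_section P U \<Phi> x) g)) = g"
proof -
  let ?G = "struct_group P" and ?M = "total_space P" and ?B = "base_space P"
  let ?s = "natural_section P U \<Phi>"
  note mP = principal_bundleD(1)[OF P] and G = principal_bundleD(2)[OF P]
    and mB = principal_bundleD(3)[OF P]
  note mG = lie_groupD(2)[OF G]
  note mBG = manifold_prod[OF mB mG]
  interpret G: group ?G by (rule lie_groupD(1)[OF G])
  show U: "open_in ?B U" using triv unfolding local_trivialization_def by blast
  have bij: "bij_betw \<Phi> (over P U) (U \<times> carrier ?G)"
    and sm: "smooth_map ?M (over P U) (prod_atlas ?B (charts ?G)) \<Phi>"
    and sm': "smooth_map (prod_atlas ?B (charts ?G)) (U \<times> carrier ?G) ?M (inv_into (over P U) \<Phi>)"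
    and fst: "\<And>p. p \<in> over P U \<Longrightarrow> fst (\<Phi> p) = projection P p"
    and equi: "\<And>p g. p \<in> over P U \<Longrightarrow> g \<in> carrier ?G \<Longrightarrow>
        \<Phi> (right_action P p g) = (fst (\<Phi> p), snd (\<Phi> p) \<otimes>\<^bsub>?G\<^esub> g)"
    using triv unfolding local_trivialization_def diffeo_def by blast+
  show "open_in ?M (over P U)" using sm unfolding smooth_map_iff[OF mP mBG] by blast
  have mem: "\<Phi> p \<in> U \<times> carrier ?G" if "p \<in> over P U" for p
    using bij that by (auto simp: bij_betw_def)
  show snd: "snd (\<Phi> p) \<in> carrier ?G" if "p \<in> over P U" for p
    using mem[OF that] by (simp add: mem_Times_iff)
  have U_pts: "x \<in> pts ?B" if "x \<in> U" for x using U that unfolding open_in_def by blast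
  have over_pts: "p \<in> pts ?M" "projection P p \<in> U" if "p \<in> over P U" for p
    using that unfolding over_def by auto
  show "smooth_map_at ?M (charts ?G) (\<lambda>p. snd (\<Phi> p)) p" if p: "p \<in> over P U" for p
  proof (rule smooth_map_at_compose[OF mP mBG mG])
    show "smooth_map_at ?M (prod_atlas ?B (charts ?G)) \<Phi> p"
      using sm p unfolding smooth_map_iff[OF mP mBG] by blast
    show "smooth_map_at (prod_atlas ?B (charts ?G)) (charts ?G) snd (\<Phi> p)"
      using mem[OF p] by (intro smooth_map_at_snd[OF mB mG])
        (auto simp: mem_Times_iff lie_groupD(3)[OF G] U_pts)
  qed
  show "smooth_map_at ?B ?M ?s x" if x: "x \<in> U" for x
    unfolding natural_section_def[abs_def]
  proof (rule smooth_map_at_compose[OF mB mBG mP])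
    show "smooth_map_at ?B (prod_atlas ?B (charts ?G)) (\<lambda>x. (x, \<one>\<^bsub>?G\<^esub>)) x"
      by (intro smooth_map_at_Pair[OF mB mB mG] smooth_map_at_id[OF mB] smooth_map_at_const[OF mB]
          U_pts x) (simp add: lie_groupD(3)[OF G])
    show "smooth_map_at (prod_atlas ?B (charts ?G)) ?M (inv_into (over P U) \<Phi>) (x, \<one>\<^bsub>?G\<^esub>)"
      using sm' x unfolding smooth_map_iff[OF mBG mP] by simp
  qed
  have s: "?s x \<in> over P U" "\<Phi> (?s x) = (x, \<one>\<^bsub>?G\<^esub>)" if "x \<in> U" for x
  proof -
    have "(x, \<one>\<^bsub>?G\<^esub>) \<in> \<Phi> ` over P U" using that bij by (simp add: bij_betw_def)
    then show "?s x \<in> over P U" "\<Phi> (?s x) = (x, \<one>\<^bsub>?G\<^esub>)"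
      unfolding natural_section_def by (rule inv_into_into, rule f_inv_into_f)
  qed
  show "?s x \<in> pts ?M" if "x \<in> U" for x using over_pts(1)[OF s(1)[OF that]] .
  show "projection P (?s x) = x" if "x \<in> U" for x
    using fst[OF s(1)[OF that]] s(2)[OF that] by simp
  show act: "snd (\<Phi> (right_action P (?s x) g)) = g" if "x \<in> U" "g \<in> carrier ?G" for x g
    using equi[OF s(1)[OF that(1)] that(2)] s(2)[OF that(1)] that(2) by simp
  show "right_action P (?s (projection P p)) (snd (\<Phi> p)) = p" if p: "p \<in> over P U" for p
  proof -
    note x = over_pts(2)[OF p]
    let ?p' = "right_action P (?s (projection P p)) (snd (\<Phi> p))"
    have "?p' \<in> over P U"
      using principal_bundleD(8,9)[OF P over_pts(1)[OF s(1)[OF x]] snd[OF p]]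
        over_pts(2)[OF s(1)[OF x]] by (simp add: over_def)
    moreover have "\<Phi> ?p' = \<Phi> p"
      using equi[OF s(1)[OF x] snd[OF p]] s(2)[OF x] snd[OF p] fst[OF p]
      by (simp add: prod_eq_iff)
    ultimately show ?thesis
      using p bij by (auto simp: bij_betw_def dest: inj_onD)
  qed
qed

lemma over_iff: "p \<in> over P U \<longleftrightarrow> p \<in> pts (total_space P) \<and> projection P p \<in> U"
  by (simp add: over_def)

lemma natural_section_action_inj:
  assumes P: "principal_bundle P" and triv: "local_trivialization P U \<Phi>" and x: "x \<in> U"
    and g: "g \<in> carrier (struct_group P)" "g' \<in> carrier (struct_group P)"
    and eq: "right_action P (natural_section P U \<Phi> x) g = right_action P (natural_section P U \<Phi> x) g'"
  shows "g = g'"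
  by (rule box_equals[OF arg_cong[OF eq, of "\<lambda>q. snd (\<Phi> q)"]])
    (rule local_trivializationD(9)[OF P triv x] g)+

lemma transition_natural_section:
  assumes P: "principal_bundle P" and triv: "local_trivialization P U \<Phi>"
    and triv': "local_trivialization P V \<Psi>" and x: "x \<in> U" "x \<in> V"
  shows "transition P (natural_section P U \<Phi>) (natural_section P V \<Psi>) x \<in> carrier (struct_group P)"
    "right_action P (natural_section P U \<Phi> x)
      (transition P (natural_section P U \<Phi>) (natural_section P V \<Psi>) x) = natural_section P V \<Psi> x"
proof -
  let ?s = "natural_section P U \<Phi>" and ?s' = "natural_section P V \<Psi>"
  note D = local_trivializationD[OF P triv] and D' = local_trivializationD[OF P triv']
  have o: "?s' x \<in> over P U" using D'(6,7)[OF x(2)] x(1) by (simp add: over_iff)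
  let ?g = "snd (\<Phi> (?s' x))"
  have "?g \<in> carrier (struct_group P) \<and> ?s' x = right_action P (?s x) ?g"
    using D(4)[OF o] D(8)[OF o] D'(7)[OF x(2)] by simp
  then have "transition P ?s ?s' x \<in> carrier (struct_group P) \<and>
      ?s' x = right_action P (?s x) (transition P ?s ?s' x)"
    unfolding transition_def
  proof (rule theI)
    fix g assume "g \<in> carrier (struct_group P) \<and> ?s' x = right_action P (?s x) g"
    with D(9)[OF x(1), of g] show "g = ?g" by simp
  qed
  then show "transition P ?s ?s' x \<in> carrier (struct_group P)"
    "right_action P (?s x) (transition P ?s ?s' x) = ?s' x" by auto
qed

section \<open>Morphisms over a common trivializing set\<close>

context
  fixes P :: "('p, 'pe::banach, 'g, 'ge::banach, 'b, 'be::banach) pbundle"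
    and Q :: "('q, 'qe::banach, 'h, 'he::banach, 'b, 'be) pbundle"
    and \<phi> :: "'g \<Rightarrow> 'h" and U :: "'b set" and \<Phi> :: "'p \<Rightarrow> 'b \<times> 'g" and \<Psi> :: "'q \<Rightarrow> 'b \<times> 'h"
  assumes P: "principal_bundle P" and Q: "principal_bundle Q"
    and base: "base_space Q = base_space P"
    and hom: "lie_hom (struct_group P) (struct_group Q) \<phi>"
    and \<Phi>: "local_trivialization P U \<Phi>" and \<Psi>: "local_trivialization Q U \<Psi>"
begin

lemma local_map_of_morphism:
  assumes f: "bundle_morphism P Q f \<phi>" and x: "x \<in> U"
  defines "h \<equiv> \<lambda>x. snd (\<Psi> (f (natural_section P U \<Phi> x)))"
  shows "h x \<in> carrier (struct_group Q)"
    "f (natural_section P U \<Phi> x) = right_action Q (natural_section Q U \<Psi> x) (h x)"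
    "smooth_map_at (base_space P) (charts (struct_group Q)) h x"
proof -
  let ?s = "natural_section P U \<Phi>"
  note D = local_trivializationD[OF P \<Phi>] and E = local_trivializationD[OF Q \<Psi>]
  note mP = principal_bundleD(1)[OF P] and mQ = principal_bundleD(1)[OF Q]
    and mB = principal_bundleD(3)[OF P] and mH = lie_groupD(2)[OF principal_bundleD(2)[OF Q]]
  have "smooth_map (total_space P) (pts (total_space P)) (total_space Q) f"
    and proj: "projection Q (f (?s x)) = x"
    using f D(6,7)[OF x] unfolding bundle_morphism_def by auto
  then have sf: "smooth_map_at (total_space P) (total_space Q) f (?s x)"
    unfolding smooth_map_iff[OF mP mQ] using D(6)[OF x] by blast
  have o: "f (?s x) \<in> over Q U"
    using smooth_map_atD(2)[OF mP sf] proj x by (simp add: over_iff)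
  show "h x \<in> carrier (struct_group Q)" unfolding h_def by (rule E(4)[OF o])
  show "f (?s x) = right_action Q (natural_section Q U \<Psi> x) (h x)"
    using E(8)[OF o] unfolding h_def proj by simp
  show "smooth_map_at (base_space P) (charts (struct_group Q)) h x"
    unfolding h_def
    by (rule smooth_map_at_compose[OF mB mQ mH
          smooth_map_at_compose[OF mB mP mQ D(5)[OF x] sf] E(3)[OF o]])
qed

lemma local_equation_if_related:
  assumes f: "bundle_morphism P Q f \<phi>" and \<theta>: "connection_form Q \<theta>"
    and rel: "related_connections P Q f \<phi> \<omega> \<theta>"
    and h: "\<And>x. x \<in> U \<Longrightarrow> smooth_map_at (base_space P) (charts (struct_group Q)) h x"
    and fs: "\<And>x. x \<in> U \<Longrightarrow>
      f (natural_section P U \<Phi> x) = right_action Q (natural_section Q U \<Psi> x) (h x)"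
    and x: "x \<in> U"
  shows "lie_alg_hom (struct_group P) (struct_group Q) \<phi>
      (local_connection_form P \<omega> (natural_section P U \<Phi>) x v) =
    Ad (struct_group Q) (inv\<^bsub>struct_group Q\<^esub> (h x))
      (local_connection_form Q \<theta> (natural_section Q U \<Psi>) x v) +
    maurer_cartan (base_space P) (struct_group Q) h x v"
proof -
  let ?s = "natural_section P U \<Phi>" and ?t = "natural_section Q U \<Psi>"
  let ?B = "base_space P" and ?M = "total_space P" and ?N = "total_space Q"
  note D = local_trivializationD[OF P \<Phi>] and E = local_trivializationD[OF Q \<Psi>, unfolded base]
  note mP = principal_bundleD(1)[OF P] and mQ = principal_bundleD(1)[OF Q]
    and mB = principal_bundleD(3)[OF P]
  have "smooth_map ?M (pts ?M) ?N f" using f unfolding bundle_morphism_def by blast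
  then have sf: "smooth_map_at ?M ?N f (?s x)"
    unfolding smooth_map_iff[OF mP mQ] using D(6)[OF x] by blast
  have "lie_alg_hom (struct_group P) (struct_group Q) \<phi> (local_connection_form P \<omega> ?s x v) =
      pullback ?M ?N f \<theta> (?s x) (tangent_map ?B ?M ?s x v)"
    using rel D(6)[OF x] unfolding related_connections_def local_connection_form_def
    by (simp add: pullback_def)
  also have "\<dots> = pullback ?B ?N (\<lambda>x. f (?s x)) \<theta> x v"
    by (rule pullback_compose[OF mB mP mQ D(5)[OF x] sf, symmetric])
  also have "\<dots> = pullback ?B ?N (\<lambda>x. right_action Q (?t x) (h x)) \<theta> x v"
    by (rule pullback_cong[OF mB mQ smooth_map_at_action[OF Q mB E(5)[OF x] h[OF x]] D(1) x])
      (simp add: fs)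
  also have "\<dots> = Ad (struct_group Q) (inv\<^bsub>struct_group Q\<^esub> (h x)) (local_connection_form Q \<theta> ?t x v) +
      maurer_cartan ?B (struct_group Q) h x v"
    unfolding local_connection_form_def base
    by (rule pullback_gauge_transformation[OF Q \<theta> mB E(5)[OF x] h[OF x]])
  finally show ?thesis .
qed

text \<open>
  The map \<open>s(x) \<cdot> g \<mapsto> t(x) \<cdot> h(x) \<cdot> \<phi>(g)\<close> over \<open>U\<close> determined by a map \<open>h\<close> into the structure
  group of \<open>Q\<close>; outside the part of \<open>P\<close> over \<open>U\<close> its values have no meaning.
\<close>

definition local_morphism :: "('b \<Rightarrow> 'h) \<Rightarrow> 'p \<Rightarrow> 'q" where
  "local_morphism h p =
     right_action Q (right_action Q (natural_section Q U \<Psi> (projection P p)) (h (projection P p)))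
       (\<phi> (snd (\<Phi> p)))"

lemma local_morphism_smooth:
  assumes h: "\<And>x. x \<in> U \<Longrightarrow> smooth_map_at (base_space P) (charts (struct_group Q)) h x"
    and p: "p \<in> over P U"
  shows "smooth_map_at (total_space P) (total_space Q)
      (\<lambda>p. right_action Q (natural_section Q U \<Psi> (projection P p)) (h (projection P p))) p"
    "smooth_map_at (total_space P) (charts (struct_group Q)) (\<lambda>p. \<phi> (snd (\<Phi> p))) p"
    "smooth_map_at (total_space P) (total_space Q) (local_morphism h) p"
proof -
  note D = local_trivializationD[OF P \<Phi>] and E = local_trivializationD[OF Q \<Psi>, unfolded base]
  note mP = principal_bundleD(1)[OF P] and mQ = principal_bundleD(1)[OF Q]
    and mB = principal_bundleD(3)[OF P]
    and G = principal_bundleD(2)[OF P] and H = principal_bundleD(2)[OF Q]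
  note mG = lie_groupD(2)[OF G] and mH = lie_groupD(2)[OF H]
  have x: "projection P p \<in> U" and pp: "p \<in> pts (total_space P)" using p by (auto simp: over_iff)
  note \<pi> = principal_bundleD(4)[OF P pp]
  show 1: "smooth_map_at (total_space P) (total_space Q)
      (\<lambda>p. right_action Q (natural_section Q U \<Psi> (projection P p)) (h (projection P p))) p"
    by (intro smooth_map_at_action[OF Q mP] smooth_map_at_compose[OF mP mB mQ \<pi>]
        smooth_map_at_compose[OF mP mB mH \<pi>] E(5) h x)
  show 2: "smooth_map_at (total_space P) (charts (struct_group Q)) (\<lambda>p. \<phi> (snd (\<Phi> p))) p"
    by (rule smooth_map_at_compose[OF mP mG mH D(3)[OF p] lie_homD(6)[OF hom G H D(4)[OF p]]])
  show "smooth_map_at (total_space P) (total_space Q) (local_morphism h) p"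
    unfolding local_morphism_def[abs_def] by (rule smooth_map_at_action[OF Q mP 1 2])
qed

lemma local_morphism_section:
  assumes x: "x \<in> U" and h: "h x \<in> carrier (struct_group Q)" and g: "g \<in> carrier (struct_group P)"
  shows "local_morphism h (right_action P (natural_section P U \<Phi> x) g) =
    right_action Q (right_action Q (natural_section Q U \<Psi> x) (h x)) (\<phi> g)"
  using principal_bundleD(8)[OF P local_trivializationD(6)[OF P \<Phi> x] g]
    local_trivializationD(7,9)[OF P \<Phi> x] g
  by (simp add: local_morphism_def)

text \<open>
  Both \<open>p = s(\<pi>(p)) \<cdot> c(p)\<close> and the local morphism \<open>p \<mapsto> (t \<cdot> h)(\<pi>(p)) \<cdot> \<phi>(c(p))\<close> are products of a
  map into the total space and a map into the group, both defined on the part of the total space of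
  \<open>P\<close> over \<open>U\<close>.  Hence \<open>pullback_gauge_transformation\<close> computes both sides at an arbitrary tangent
  vector, without splitting it into a horizontal and a vertical part.
\<close>

lemma local_morphism_related:
  assumes \<omega>: "connection_form P \<omega>" and \<theta>: "connection_form Q \<theta>"
    and h: "\<And>x. x \<in> U \<Longrightarrow> smooth_map_at (base_space P) (charts (struct_group Q)) h x"
    and eq: "\<And>x v. x \<in> U \<Longrightarrow> lie_alg_hom (struct_group P) (struct_group Q) \<phi>
        (local_connection_form P \<omega> (natural_section P U \<Phi>) x v) =
      Ad (struct_group Q) (inv\<^bsub>struct_group Q\<^esub> (h x))
        (local_connection_form Q \<theta> (natural_section Q U \<Psi>) x v) +
      maurer_cartan (base_space P) (struct_group Q) h x v"
    and p: "p \<in> over P U"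
  shows "pullback (total_space P) (total_space Q) (local_morphism h) \<theta> p u =
    lie_alg_hom (struct_group P) (struct_group Q) \<phi> (blinfun_apply (\<omega> p) u)"
proof -
  let ?s = "natural_section P U \<Phi>" and ?t = "natural_section Q U \<Psi>"
  let ?B = "base_space P" and ?M = "total_space P" and ?N = "total_space Q"
  let ?G = "struct_group P" and ?H = "struct_group Q" and ?\<pi> = "projection P"
  let ?c = "\<lambda>q. snd (\<Phi> q)" and ?\<phi>' = "lie_alg_hom ?G ?H \<phi>"
  note D = local_trivializationD[OF P \<Phi>] and E = local_trivializationD[OF Q \<Psi>, unfolded base]
  note mP = principal_bundleD(1)[OF P] and mQ = principal_bundleD(1)[OF Q]
    and mB = principal_bundleD(3)[OF P]
    and G = principal_bundleD(2)[OF P] and H = principal_bundleD(2)[OF Q]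
  interpret G: group ?G by (rule lie_groupD(1)[OF G])
  have x: "?\<pi> p \<in> U" and pp: "p \<in> pts ?M" using p by (auto simp: over_iff)
  note \<pi> = principal_bundleD(4)[OF P pp] and sm = local_morphism_smooth[of h, OF h p]
    and c = D(3)[OF p] and cG = D(4)[OF p]
  have s\<pi>: "smooth_map_at ?M ?M (\<lambda>q. ?s (?\<pi> q)) p"
    by (rule smooth_map_at_compose[OF mP mB mP \<pi> D(5)[OF x]])
  have "pullback ?M ?N (\<lambda>q. right_action Q (?t (?\<pi> q)) (h (?\<pi> q))) \<theta> p u =
      pullback ?B ?N (\<lambda>x. right_action Q (?t x) (h x)) \<theta> (?\<pi> p) (tangent_map ?M ?B ?\<pi> p u)"
    by (rule pullback_compose[OF mP mB mQ \<pi> smooth_map_at_action[OF Q mB E(5)[OF x] h[OF x]]])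
  also have "\<dots> = ?\<phi>' (pullback ?B ?M ?s \<omega> (?\<pi> p) (tangent_map ?M ?B ?\<pi> p u))"
    using pullback_gauge_transformation[OF Q \<theta> mB E(5)[OF x] h[OF x]] eq[OF x]
    by (simp add: local_connection_form_def base)
  also have "\<dots> = ?\<phi>' (pullback ?M ?M (\<lambda>q. ?s (?\<pi> q)) \<omega> p u)"
    by (simp add: pullback_compose[OF mP mB mP \<pi> D(5)[OF x]])
  finally have horizontal: "pullback ?M ?N (\<lambda>q. right_action Q (?t (?\<pi> q)) (h (?\<pi> q))) \<theta> p u =
      ?\<phi>' (pullback ?M ?M (\<lambda>q. ?s (?\<pi> q)) \<omega> p u)" .
  have "pullback ?M ?N (local_morphism h) \<theta> p u =
      Ad ?H (inv\<^bsub>?H\<^esub> (\<phi> (?c p)))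
        (pullback ?M ?N (\<lambda>q. right_action Q (?t (?\<pi> q)) (h (?\<pi> q))) \<theta> p u) +
      maurer_cartan ?M ?H (\<lambda>q. \<phi> (?c q)) p u"
    unfolding local_morphism_def[abs_def]
    by (rule pullback_gauge_transformation[OF Q \<theta> mP sm(1,2)])
  also have "\<dots> = ?\<phi>' (Ad ?G (inv\<^bsub>?G\<^esub> (?c p)) (pullback ?M ?M (\<lambda>q. ?s (?\<pi> q)) \<omega> p u)) +
      ?\<phi>' (maurer_cartan ?M ?G ?c p u)"
    unfolding horizontal maurer_cartan_lie_hom[OF G H hom mP c]
    using Ad_lie_hom[OF G H hom G.inv_closed[OF cG]] lie_homD(5)[OF hom G H cG] by simp
  also have "\<dots> = ?\<phi>' (pullback ?M ?M (\<lambda>q. right_action P (?s (?\<pi> q)) (?c q)) \<omega> p u)"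
  proof -
    have "linear ?\<phi>'"
      unfolding lie_alg_hom_def
      by (rule tangent_map_linear[OF lie_groupD(2)[OF G] lie_groupD(2)[OF H]])
        (rule lie_homD(6)[OF hom G H G.one_closed])
    from linear_add[OF this] pullback_gauge_transformation[OF P \<omega> mP s\<pi> c]
    show ?thesis by simp
  qed
  also have "pullback ?M ?M (\<lambda>q. right_action P (?s (?\<pi> q)) (?c q)) \<omega> p u =
      pullback ?M ?M (\<lambda>q. q) \<omega> p u"
    by (rule pullback_cong[OF mP mP smooth_map_at_id[OF mP pp] D(2) p]) (simp add: D(8))
  also have "\<dots> = blinfun_apply (\<omega> p) u"
    by (simp add: pullback_def tangent_map_id[OF mP pp])
  finally show ?thesis .
qed

end

section \<open>Related connections and families of local maps\<close>

theorem theorem4p2: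
  fixes P :: "('p, 'pe::banach, 'g, 'ge::banach, 'b, 'be::banach) pbundle"
    and Q :: "('q, 'qe::banach, 'h, 'he::banach, 'b, 'be) pbundle"
    and G :: "('g, 'ge) lie_grp" and H :: "('h, 'he) lie_grp" and B :: "('b, 'be) atlas"
    and I :: "'i set" and U :: "'i \<Rightarrow> 'b set"
    and \<Phi> :: "'i \<Rightarrow> 'p \<Rightarrow> 'b \<times> 'g" and \<Psi> :: "'i \<Rightarrow> 'q \<Rightarrow> 'b \<times> 'h"
    and s :: "'i \<Rightarrow> 'b \<Rightarrow> 'p" and t :: "'i \<Rightarrow> 'b \<Rightarrow> 'q"
    and g_trans :: "'i \<Rightarrow> 'i \<Rightarrow> 'b \<Rightarrow> 'g" and h_trans :: "'i \<Rightarrow> 'i \<Rightarrow> 'b \<Rightarrow> 'h"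
    and \<omega> :: "('p, 'pe, 'ge) form" and \<theta> :: "('q, 'qe, 'he) form"
    and \<omega>_loc :: "'i \<Rightarrow> 'b \<Rightarrow> 'be \<Rightarrow> 'ge" and \<theta>_loc :: "'i \<Rightarrow> 'b \<Rightarrow> 'be \<Rightarrow> 'he"
    and \<phi> :: "'g \<Rightarrow> 'h"
  assumes "principal_bundle P" and "principal_bundle Q"
    and "struct_group P = G" and "struct_group Q = H"
    and "base_space P = B" and "base_space Q = B"
    and "trivializing_cover P I U \<Phi>" and "trivializing_cover Q I U \<Psi>"
    and "connection_form P \<omega>" and "connection_form Q \<theta>"
    and "lie_hom G H \<phi>"
    and "s = (\<lambda>\<alpha>. natural_section P (U \<alpha>) (\<Phi> \<alpha>))"
    and "t = (\<lambda>\<alpha>. natural_section Q (U \<alpha>) (\<Psi> \<alpha>))"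
    and "g_trans = (\<lambda>\<alpha> \<beta>. transition P (s \<alpha>) (s \<beta>))"
    and "h_trans = (\<lambda>\<alpha> \<beta>. transition Q (t \<alpha>) (t \<beta>))"
    and "\<omega>_loc = (\<lambda>\<alpha>. local_connection_form P \<omega> (s \<alpha>))"
    and "\<theta>_loc = (\<lambda>\<alpha>. local_connection_form Q \<theta> (t \<alpha>))"
  shows "((\<exists>f. bundle_morphism P Q f \<phi> \<and> related_connections P Q f \<phi> \<omega> \<theta>) \<longleftrightarrow>
           (\<exists>h. compatible_family B G H \<phi> I U g_trans h_trans \<omega>_loc \<theta>_loc h)) \<and>
         (\<forall>f. bundle_morphism P Q f \<phi> \<and> related_connections P Q f \<phi> \<omega> \<theta> \<longrightarrow>
           (\<exists>h. corresponding Q I U s t f h) \<and>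
           (\<forall>h. corresponding Q I U s t f h \<longrightarrow>
              compatible_family B G H \<phi> I U g_trans h_trans \<omega>_loc \<theta>_loc h)) \<and>
         (\<forall>h. compatible_family B G H \<phi> I U g_trans h_trans \<omega>_loc \<theta>_loc h \<longrightarrow>
           (\<exists>f. bundle_morphism P Q f \<phi> \<and> related_connections P Q f \<phi> \<omega> \<theta> \<and>
                corresponding Q I U s t f h))"
proof -
  have P: "principal_bundle P" and Q: "principal_bundle Q" and \<omega>: "connection_form P \<omega>"
    and \<theta>: "connection_form Q \<theta>" and hom: "lie_hom (struct_group P) (struct_group Q) \<phi>"
    and base: "base_space Q = base_space P"
    using assms by auto
  have cover: "(\<Union>\<alpha>\<in>I. U \<alpha>) = pts (base_space P)"
    and \<Phi>: "\<And>\<alpha>. \<alpha> \<in> I \<Longrightarrow> local_trivialization P (U \<alpha>) (\<Phi> \<alpha>)"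
    and \<Psi>: "\<And>\<alpha>. \<alpha> \<in> I \<Longrightarrow> local_trivialization Q (U \<alpha>) (\<Psi> \<alpha>)"
    using assms(7,8) unfolding trivializing_cover_def by auto
  have s: "s \<alpha> = natural_section P (U \<alpha>) (\<Phi> \<alpha>)" and t: "t \<alpha> = natural_section Q (U \<alpha>) (\<Psi> \<alpha>)"
    for \<alpha> using assms(12,13) by auto
  have G: "lie_group (struct_group P)" and H: "lie_group (struct_group Q)"
    by (rule principal_bundleD(2)[OF P], rule principal_bundleD(2)[OF Q])
  interpret G: group "struct_group P" by (rule lie_groupD(1)[OF G])
  interpret H: group "struct_group Q" by (rule lie_groupD(1)[OF H])
  note mP = principal_bundleD(1)[OF P] and mQ = principal_bundleD(1)[OF Q]
    and mB = principal_bundleD(3)[OF P] and mH = lie_groupD(2)[OF H]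
  note loc = P Q base hom
  note D = local_trivializationD[OF P \<Phi>] and E = local_trivializationD[OF Q \<Psi>, unfolded base]
  note homD = lie_homD[OF hom G H] and act = principal_bundleD(7)[OF Q]
  have g_trans: "g_trans \<alpha> \<beta> x \<in> carrier (struct_group P)"
      "right_action P (s \<alpha> x) (g_trans \<alpha> \<beta> x) = s \<beta> x"
    and h_trans: "h_trans \<alpha> \<beta> x \<in> carrier (struct_group Q)"
      "right_action Q (t \<alpha> x) (h_trans \<alpha> \<beta> x) = t \<beta> x"
    if "\<alpha> \<in> I" "\<beta> \<in> I" "x \<in> U \<alpha>" "x \<in> U \<beta>" for \<alpha> \<beta> x
    using transition_natural_section[OF P \<Phi>[OF that(1)] \<Phi>[OF that(2)] that(3,4)]
      transition_natural_section[OF Q \<Psi>[OF that(1)] \<Psi>[OF that(2)] that(3,4)]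
    by (simp_all add: assms(14,15) s t)
  have s_pts: "s \<alpha> x \<in> pts (total_space P)" and t_pts: "t \<alpha> x \<in> pts (total_space Q)"
    if "\<alpha> \<in> I" "x \<in> U \<alpha>" for \<alpha> x
    using D(6)[OF that] E(6)[OF that] by (simp_all add: s t)
  have free: "a = b"
    if "\<alpha> \<in> I" "x \<in> U \<alpha>" "a \<in> carrier (struct_group Q)" "b \<in> carrier (struct_group Q)"
      "right_action Q (t \<alpha> x) a = right_action Q (t \<alpha> x) b" for \<alpha> x a b
    using natural_section_action_inj[OF Q \<Psi>[OF that(1)] that(2-4)] that(5) by (simp add: t)
  let ?comp = "compatible_family (base_space P) (struct_group P) (struct_group Q) \<phi> I U
    g_trans h_trans \<omega>_loc \<theta>_loc"

  \<comment> \<open>The map \<open>h\<^sub>\<alpha>\<close> is the group coordinate of \<open>f \<circ> s\<^sub>\<alpha>\<close>.\<close>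
  have forward: "\<exists>h. corresponding Q I U s t f h"
    if "bundle_morphism P Q f \<phi>" for f
    unfolding corresponding_def s t
    using local_map_of_morphism(1,2)[OF loc \<Phi> \<Psi> that]
    by (intro exI[of _ "\<lambda>\<alpha> x. snd (\<Psi> \<alpha> (f (natural_section P (U \<alpha>) (\<Phi> \<alpha>) x)))"]) blast

  have compatible: "?comp h"
    if f: "bundle_morphism P Q f \<phi>" and rel: "related_connections P Q f \<phi> \<omega> \<theta>"
      and cor: "corresponding Q I U s t f h" for f h
  proof -
    have h: "h \<alpha> x \<in> carrier (struct_group Q)" "f (s \<alpha> x) = right_action Q (t \<alpha> x) (h \<alpha> x)"
      if "\<alpha> \<in> I" "x \<in> U \<alpha>" for \<alpha> x
      using cor that unfolding corresponding_def by auto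
    have h_eq: "h \<alpha> x = snd (\<Psi> \<alpha> (f (s \<alpha> x)))" if "\<alpha> \<in> I" "x \<in> U \<alpha>" for \<alpha> x
      using E(9)[OF that h(1)[OF that]] by (simp add: h(2)[OF that] t)
    have sh: "smooth_map_at (base_space P) (charts (struct_group Q)) (h \<alpha>) x"
      if "\<alpha> \<in> I" "x \<in> U \<alpha>" for \<alpha> x
      by (rule smooth_map_at_cong[OF mB
            local_map_of_morphism(3)[OF loc \<Phi>[OF that(1)] \<Psi>[OF that(1)] f that(2)] D(1)[OF that(1)] that(2)])
        (simp add: h_eq[OF that(1)] s)
    have "smooth_map (base_space P) (U \<alpha>) (charts (struct_group Q)) (h \<alpha>)" if "\<alpha> \<in> I" for \<alpha>
      unfolding smooth_map_iff[OF mB mH] using sh[OF that] D(1)[OF that] by blast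
    moreover have "lie_alg_hom (struct_group P) (struct_group Q) \<phi> (\<omega>_loc \<alpha> x v) =
        Ad (struct_group Q) (inv\<^bsub>struct_group Q\<^esub> (h \<alpha> x)) (\<theta>_loc \<alpha> x v) +
        maurer_cartan (base_space P) (struct_group Q) (h \<alpha>) x v"
      if "\<alpha> \<in> I" "x \<in> U \<alpha>" for \<alpha> x v
      unfolding assms(16,17) s t
      by (rule local_equation_if_related[OF loc \<Phi>[OF that(1)] \<Psi>[OF that(1)] f \<theta> rel sh[OF that(1)]
            h(2)[OF that(1), unfolded s t] that(2)])
    moreover have "h_trans \<alpha> \<beta> x = h \<alpha> x \<otimes>\<^bsub>struct_group Q\<^esub> \<phi> (g_trans \<alpha> \<beta> x)
        \<otimes>\<^bsub>struct_group Q\<^esub> inv\<^bsub>struct_group Q\<^esub> (h \<beta> x)"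
      if ab: "\<alpha> \<in> I" "\<beta> \<in> I" and x: "x \<in> U \<alpha>" "x \<in> U \<beta>" for \<alpha> \<beta> x
    proof -
      note g = g_trans[OF ab x] and k = h_trans[OF ab x]
      note ha = h[OF ab(1) x(1)] and hb = h[OF ab(2) x(2)]
      have "right_action Q (t \<alpha> x) (h \<alpha> x \<otimes>\<^bsub>struct_group Q\<^esub> \<phi> (g_trans \<alpha> \<beta> x)) =
          right_action Q (f (s \<alpha> x)) (\<phi> (g_trans \<alpha> \<beta> x))"
        by (simp add: ha act t_pts ab x homD g)
      also have "\<dots> = f (right_action P (s \<alpha> x) (g_trans \<alpha> \<beta> x))"
        using f s_pts[OF ab(1) x(1)] g(1) unfolding bundle_morphism_def by simp
      also have "\<dots> = right_action Q (t \<beta> x) (h \<beta> x)" by (simp add: g hb)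
      also have "\<dots> = right_action Q (t \<alpha> x) (h_trans \<alpha> \<beta> x \<otimes>\<^bsub>struct_group Q\<^esub> h \<beta> x)"
        using act[OF t_pts[OF ab(1) x(1)] k(1) hb(1)] k(2) by simp
      finally have "h \<alpha> x \<otimes>\<^bsub>struct_group Q\<^esub> \<phi> (g_trans \<alpha> \<beta> x) =
          h_trans \<alpha> \<beta> x \<otimes>\<^bsub>struct_group Q\<^esub> h \<beta> x"
        by (intro free[OF ab(1) x(1)]) (simp_all add: ha hb g k homD)
      then show ?thesis by (simp add: H.m_assoc k hb)
    qed
    ultimately show ?thesis unfolding compatible_family_def by blast
  qed

  have backward: "\<exists>f. bundle_morphism P Q f \<phi> \<and> related_connections P Q f \<phi> \<omega> \<theta> \<and>
      corresponding Q I U s t f h" if comp: "?comp h" for h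
  proof -
    have smooth: "\<And>\<alpha>. \<alpha> \<in> I \<Longrightarrow> smooth_map (base_space P) (U \<alpha>) (charts (struct_group Q)) (h \<alpha>)"
      and loc_eq: "\<And>\<alpha> x v. \<alpha> \<in> I \<Longrightarrow> x \<in> U \<alpha> \<Longrightarrow>
        lie_alg_hom (struct_group P) (struct_group Q) \<phi> (\<omega>_loc \<alpha> x v) =
        Ad (struct_group Q) (inv\<^bsub>struct_group Q\<^esub> (h \<alpha> x)) (\<theta>_loc \<alpha> x v) +
        maurer_cartan (base_space P) (struct_group Q) (h \<alpha>) x v"
      and cocycle: "\<And>\<alpha> \<beta> x. \<alpha> \<in> I \<Longrightarrow> \<beta> \<in> I \<Longrightarrow> x \<in> U \<alpha> \<Longrightarrow> x \<in> U \<beta> \<Longrightarrow>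
        h_trans \<alpha> \<beta> x = h \<alpha> x \<otimes>\<^bsub>struct_group Q\<^esub> \<phi> (g_trans \<alpha> \<beta> x)
          \<otimes>\<^bsub>struct_group Q\<^esub> inv\<^bsub>struct_group Q\<^esub> (h \<beta> x)"
      using comp unfolding compatible_family_def by auto
    have sh: "smooth_map_at (base_space P) (charts (struct_group Q)) (h \<alpha>) x"
      if "\<alpha> \<in> I" "x \<in> U \<alpha>" for \<alpha> x
      using smooth[OF that(1)] that(2) unfolding smooth_map_iff[OF mB mH] by blast
    have hH: "h \<alpha> x \<in> carrier (struct_group Q)" if "\<alpha> \<in> I" "x \<in> U \<alpha>" for \<alpha> x
      using smooth_map_atD(2)[OF mB sh[OF that]] lie_groupD(3)[OF H] by simp
    define F where "F \<alpha> = local_morphism P Q \<phi> (U \<alpha>) (\<Phi> \<alpha>) (\<Psi> \<alpha>) (h \<alpha>)" for \<alpha>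
    have F_section: "F \<alpha> (right_action P (s \<alpha> x) g) =
        right_action Q (t \<alpha> x) (h \<alpha> x \<otimes>\<^bsub>struct_group Q\<^esub> \<phi> g)"
      if "\<alpha> \<in> I" "x \<in> U \<alpha>" "g \<in> carrier (struct_group P)" for \<alpha> x g
      using local_morphism_section[where h = "h \<alpha>", OF loc \<Phi>[OF that(1)] \<Psi>[OF that(1)] that(2) hH[OF that(1,2)] that(3)]
        act[OF t_pts[OF that(1,2)] hH[OF that(1,2)] homD(2)[OF that(3)]]
      by (simp add: F_def s t)
    have coords: "\<exists>g. g \<in> carrier (struct_group P) \<and> p = right_action P (s \<alpha> (projection P p)) g"
      if "\<alpha> \<in> I" "p \<in> over P (U \<alpha>)" for \<alpha> p
      using D(4)[OF that] D(8)[OF that] by (auto simp: s intro!: exI[of _ "snd (\<Phi> \<alpha> p)"])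
    have F_agree: "F \<alpha> p = F \<beta> p"
      if ab: "\<alpha> \<in> I" "\<beta> \<in> I" and p: "p \<in> over P (U \<alpha>)" "p \<in> over P (U \<beta>)" for \<alpha> \<beta> p
    proof -
      define x where "x = projection P p"
      have x: "x \<in> U \<alpha>" "x \<in> U \<beta>" using p by (auto simp: x_def over_iff)
      obtain g where g: "g \<in> carrier (struct_group P)" "p = right_action P (s \<beta> x) g"
        using coords[OF ab(2) p(2)] unfolding x_def by blast
      note gt = g_trans[OF ab x] and ht = h_trans[OF ab x]
      note ha = hH[OF ab(1) x(1)] and hb = hH[OF ab(2) x(2)]
      have "p = right_action P (s \<alpha> x) (g_trans \<alpha> \<beta> x \<otimes>\<^bsub>struct_group P\<^esub> g)"
        using principal_bundleD(7)[OF P s_pts[OF ab(1) x(1)] gt(1) g(1)] gt(2) g(2) by simp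
      then have "F \<alpha> p = right_action Q (t \<alpha> x)
          (h \<alpha> x \<otimes>\<^bsub>struct_group Q\<^esub> \<phi> (g_trans \<alpha> \<beta> x \<otimes>\<^bsub>struct_group P\<^esub> g))"
        using F_section[OF ab(1) x(1)] gt(1) g(1) by simp
      also have "h \<alpha> x \<otimes>\<^bsub>struct_group Q\<^esub> \<phi> (g_trans \<alpha> \<beta> x \<otimes>\<^bsub>struct_group P\<^esub> g) =
          h_trans \<alpha> \<beta> x \<otimes>\<^bsub>struct_group Q\<^esub> (h \<beta> x \<otimes>\<^bsub>struct_group Q\<^esub> \<phi> g)"
      proof -
        have "h_trans \<alpha> \<beta> x \<otimes>\<^bsub>struct_group Q\<^esub> h \<beta> x = h \<alpha> x \<otimes>\<^bsub>struct_group Q\<^esub> \<phi> (g_trans \<alpha> \<beta> x)"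
          unfolding cocycle[OF ab x] by (simp add: H.m_assoc ha hb homD gt)
        then show ?thesis using ha hb ht(1) gt(1) g(1)
          by (simp add: homD H.m_assoc[symmetric])
      qed
      also have "right_action Q (t \<alpha> x) \<dots> =
          right_action Q (t \<beta> x) (h \<beta> x \<otimes>\<^bsub>struct_group Q\<^esub> \<phi> g)"
        using act[OF t_pts[OF ab(1) x(1)] ht(1), of "h \<beta> x \<otimes>\<^bsub>struct_group Q\<^esub> \<phi> g"] ht(2) hb g(1)
        by (simp add: homD)
      also have "\<dots> = F \<beta> p" using F_section[OF ab(2) x(2) g(1)] g(2) by simp
      finally show ?thesis .
    qed
    \<comment> \<open>By \<open>F_agree\<close> the choice of \<open>\<alpha>\<close> does not matter.\<close>
    define f where "f p = F (SOME \<alpha>. \<alpha> \<in> I \<and> p \<in> over P (U \<alpha>)) p" for p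
    have f_eq: "f p = F \<alpha> p" if "\<alpha> \<in> I" "p \<in> over P (U \<alpha>)" for \<alpha> p
    proof -
      have "(SOME \<alpha>. \<alpha> \<in> I \<and> p \<in> over P (U \<alpha>)) \<in> I \<and>
          p \<in> over P (U (SOME \<alpha>. \<alpha> \<in> I \<and> p \<in> over P (U \<alpha>)))"
        by (rule someI[of "\<lambda>\<alpha>. \<alpha> \<in> I \<and> p \<in> over P (U \<alpha>)" \<alpha>]) (use that in blast)
      then show ?thesis unfolding f_def using F_agree that by blast
    qed
    have over_cover: "\<exists>\<alpha>\<in>I. p \<in> over P (U \<alpha>)" if "p \<in> pts (total_space P)" for p
    proof -
      have "projection P p \<in> pts (base_space P)"
        by (rule smooth_map_atD(2)[OF mP principal_bundleD(4)[OF P that]])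
      then show ?thesis using cover that by (auto simp: over_iff)
    qed
    have f_section: "f (right_action P (s \<alpha> x) g) =
        right_action Q (t \<alpha> x) (h \<alpha> x \<otimes>\<^bsub>struct_group Q\<^esub> \<phi> g)"
      if "\<alpha> \<in> I" "x \<in> U \<alpha>" "g \<in> carrier (struct_group P)" for \<alpha> x g
    proof -
      have "right_action P (s \<alpha> x) g \<in> over P (U \<alpha>)"
        using principal_bundleD(8,9)[OF P s_pts[OF that(1,2)] that(3)] D(7)[OF that(1,2)] that(2)
        by (simp add: over_iff s)
      then show ?thesis using f_eq that(1) F_section[OF that] by simp
    qed
    have F_smooth: "smooth_map_at (total_space P) (total_space Q) (F \<alpha>) p"
      if "\<alpha> \<in> I" "p \<in> over P (U \<alpha>)" for \<alpha> p
      unfolding F_def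
      by (rule local_morphism_smooth(3)[OF loc \<Phi>[OF that(1)] \<Psi>[OF that(1)] sh[OF that(1)] that(2)])
    have f_smooth: "smooth_map_at (total_space P) (total_space Q) f p"
      if "p \<in> pts (total_space P)" for p
    proof -
      from over_cover[OF that] obtain \<alpha> where \<alpha>: "\<alpha> \<in> I" "p \<in> over P (U \<alpha>)" by blast
      show ?thesis
        by (rule smooth_map_at_cong[OF mP F_smooth[OF \<alpha>] D(2)[OF \<alpha>(1)] \<alpha>(2)])
          (simp add: f_eq[OF \<alpha>(1)])
    qed
    have "bundle_morphism P Q f \<phi>"
      unfolding bundle_morphism_def
    proof (intro conjI ballI hom)
      show "smooth_map (total_space P) (pts (total_space P)) (total_space Q) f"
        unfolding smooth_map_iff[OF mP mQ] using f_smooth open_in_pts[OF mP] by blast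
    next
      fix p assume "p \<in> pts (total_space P)"
      then obtain \<alpha> where \<alpha>: "\<alpha> \<in> I" "p \<in> over P (U \<alpha>)" using over_cover by blast
      obtain a where a: "a \<in> carrier (struct_group P)" "p = right_action P (s \<alpha> (projection P p)) a"
        using coords[OF \<alpha>] by blast
      have x: "projection P p \<in> U \<alpha>" using \<alpha>(2) by (simp add: over_iff)
      have b: "h \<alpha> (projection P p) \<otimes>\<^bsub>struct_group Q\<^esub> \<phi> a \<in> carrier (struct_group Q)"
        using hH[OF \<alpha>(1) x] a(1) by (simp add: homD)
      have fp: "f p = right_action Q (t \<alpha> (projection P p))
          (h \<alpha> (projection P p) \<otimes>\<^bsub>struct_group Q\<^esub> \<phi> a)"
        using f_section[OF \<alpha>(1) x a(1)] a(2) by simp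
      show "projection Q (f p) = projection P p"
        unfolding fp principal_bundleD(8)[OF Q t_pts[OF \<alpha>(1) x] b]
        using E(7)[OF \<alpha>(1) x] by (simp add: t)
      fix g assume g: "g \<in> carrier (struct_group P)"
      have "f (right_action P p g) =
          f (right_action P (s \<alpha> (projection P p)) (a \<otimes>\<^bsub>struct_group P\<^esub> g))"
        using principal_bundleD(7)[OF P s_pts[OF \<alpha>(1) x] a(1) g] a(2) by simp
      also have "\<dots> = right_action Q (t \<alpha> (projection P p))
          (h \<alpha> (projection P p) \<otimes>\<^bsub>struct_group Q\<^esub> \<phi> a \<otimes>\<^bsub>struct_group Q\<^esub> \<phi> g)"
        using f_section[OF \<alpha>(1) x, of "a \<otimes>\<^bsub>struct_group P\<^esub> g"] a(1) g hH[OF \<alpha>(1) x]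
        by (simp add: homD H.m_assoc)
      also have "\<dots> = right_action Q (f p) (\<phi> g)"
        unfolding fp using act[OF t_pts[OF \<alpha>(1) x] b homD(2)[OF g]] by simp
      finally show "f (right_action P p g) = right_action Q (f p) (\<phi> g)" .
    qed
    moreover have "related_connections P Q f \<phi> \<omega> \<theta>"
      unfolding related_connections_def
    proof (intro ballI allI)
      fix p u assume "p \<in> pts (total_space P)"
      then obtain \<alpha> where \<alpha>: "\<alpha> \<in> I" "p \<in> over P (U \<alpha>)" using over_cover by blast
      have "pullback (total_space P) (total_space Q) f \<theta> p u =
          pullback (total_space P) (total_space Q) (F \<alpha>) \<theta> p u"
        by (rule pullback_cong[OF mP mQ F_smooth[OF \<alpha>] D(2)[OF \<alpha>(1)] \<alpha>(2)])
          (simp add: f_eq[OF \<alpha>(1)])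
      also have "\<dots> = lie_alg_hom (struct_group P) (struct_group Q) \<phi> (blinfun_apply (\<omega> p) u)"
        unfolding F_def
        by (rule local_morphism_related[OF loc \<Phi>[OF \<alpha>(1)] \<Psi>[OF \<alpha>(1)] \<omega> \<theta> sh[OF \<alpha>(1)]
              loc_eq[OF \<alpha>(1), unfolded assms(16,17) s t] \<alpha>(2)])
      finally show "pullback (total_space P) (total_space Q) f \<theta> p u =
          lie_alg_hom (struct_group P) (struct_group Q) \<phi> (blinfun_apply (\<omega> p) u)" .
    qed
    moreover have "corresponding Q I U s t f h"
      unfolding corresponding_def
    proof (intro ballI conjI)
      fix \<alpha> x assume \<alpha>: "\<alpha> \<in> I" and x: "x \<in> U \<alpha>"
      show "h \<alpha> x \<in> carrier (struct_group Q)" by (rule hH[OF \<alpha> x])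
      show "f (s \<alpha> x) = right_action Q (t \<alpha> x) (h \<alpha> x)"
        using f_section[OF \<alpha> x G.one_closed] hH[OF \<alpha> x] principal_bundleD(6)[OF P s_pts[OF \<alpha> x]]
        by (simp add: homD)
    qed
    ultimately show ?thesis by blast
  qed

  show ?thesis
    using forward compatible backward unfolding assms(3-5)[symmetric] by blast
qed

end
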